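(* Let $N=4$, and let $u:\mathbb{R}^4\to\mathbb{R}$ and $V^\delta:\mathbb{R}^4\to\mathbb{R}$ ($\delta>0$) be the functions defined in the context. For $x\in\mathbb{R}^4$ let $x^{(1)}\le x^{(2)}\le x^{(3)}\le x^{(4)}$ denote the ranked coordinates of $x$. Then for all $x\in\mathbb{R}^4$, $$\begin{aligned} u(x)=\;&x^{(4)}-\tfrac{\sqrt2}{4}\sinh\big(\sqrt2(x^{(4)}-x^{(3)})\big)\\ &+\tfrac{\sqrt2}{2}\arctan\Big(e^{\frac{x^{(1)}+x^{(2)}-x^{(3)}-x^{(4)}}{\sqrt2}}\Big)\cosh\Big(\tfrac{x^{(1)}-x^{(2)}+x^{(3)}-x^{(4)}}{\sqrt2}\Big)\cosh\Big(\tfrac{-x^{(1)}+x^{(2)}+x^{(3)}-x^{(4)}}{\sqrt2}\Big)\cosh\Big(\tfrac{-x^{(1)}-x^{(2)}+x^{(3)}+x^{(4)}}{\sqrt2}\Big)\\ &+\tfrac{\sqrt2}{2}\operatorname{arctanh}\Big(e^{\frac{x^{(1)}+x^{(2)}-x^{(3)}-x^{(4)}}{\sqrt2}}\Big)\sinh\Big(\tfrac{x^{(1)}-x^{(2)}+x^{(3)}-x^{(4)}}{\sqrt2}\Big)\sinh\Big(\tfrac{-x^{(1)}+x^{(2)}+x^{(3)}-x^{(4)}}{\sqrt2}\Big)\sinh\Big(\tfrac{-x^{(1)}-x^{(2)}+x^{(3)}+x^{(4)}}{\sqrt2}\Big), \end{aligned}$$ where the last term is understood as $0$ (its continuous extension)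 when all four coordinates of $x$ are equal. Additionally, $u$ is twice continuously differentiable on $\mathbb{R}^4$; $u$ is monotone, i.e. $u(x_1+y_1,\dots,x_4+y_4)\ge u(x_1,\dots,x_4)$ for all $x_i\in\mathbb{R}$ and $y_i\ge0$; $u$ is symmetric in its variables; $$u(x+\lambda(e_1+e_2+e_3+e_4))=u(x)+\lambda\quad\text{for all }x\in\mathbb{R}^4,\ \lambda\in\mathbb{R};$$ and for every $x\in\mathbb{R}^4$, if $J\subseteq\{1,2,3,4\}$ is a maximizer of $\sup_{J\subseteq\{1,2,3,4\}}e_J^\top\partial^2u(x)e_J$, then its complement $J^c$ is also a maximizer of the same expression. Moreover, as $\delta\downarrow0$, $$V^\delta(0)=\frac{\pi}{4\sqrt{2\delta}}+o\Big(\frac1{\sqrt\delta}\Big),$$ and $u$ has the following expansion at the origin: $$u(x_1,x_2,x_3,x_4)=\frac{\pi}{4\sqrt2}+\frac14(x_1+x_2+x_3+x_4)+\frac{3\pi}{16\sqrt2}\Big(x_1^2+x_2^2+x_3^2+x_4^2-\tfrac23(x_1x_2+x_1x_3+x_1x_4+x_2x_3+x_2x_4+x_3x_4)\Big)+o(|x|^2).$$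
   Context: Notation: $e_1,\dots,e_4$ is the canonical basis of $\mathbb{R}^4$; for $J\subseteq\{1,2,3,4\}$, $e_J:=\sum_{j\in J}e_j$; $\Phi(x):=\max_i x_i$; $\partial^2 u$ is the Hessian of $u$. The game. There are $N=4$ experts. At each time $t=1,2,\dots$, the player chooses a probability distribution $\alpha_t$ on $\{1,\dots,4\}$ and, simultaneously, nature chooses a probability distribution $\beta_t$ on the power set of $\{1,\dots,4\}$; both may depend on the past history of gains $\{(G^i_s,G_s): s\le t-1,\ i=1,\dots,4\}$. Given the past, $I_t\sim\alpha_t$ and $J_t\sim\beta_t$ are drawn independently. The gains of the experts are updated by $G^i_t=G^i_{t-1}+\mathbf 1_{\{i\in J_t\}}$ and the gain of the player by $G_t=G_{t-1}+\mathbf 1_{\{I_t\in J_t\}}$. Put $X_t=(G^1_t-G_t,\dots,G^4_t-G_t)\in\mathbb{R}^4$, with an arbitrary initial state $X_0\in\mathbb{R}^4$. The regret at time $t$ is $R_t=\max_iG^i_t-G_t=\Phi(X_t)$. The maturity $T$ is a geometric random variable with parameter $\delta>0$, $\mathbb{P}(T=t)=\delta(1-\delta)^t$, $t=0,1,2,\dots$, independent of the play. Let $\mathcal U$ and $\mathcal V$ be the sets of strategies $\alpha=\{\alpha_t\}$ of the player and $\beta=\{\beta_t\}$ of nature. The value of the game (the two expressions are known to coincide) is $$V^\delta(X_0):=\sup_{\beta\in\mathcal V}\inf_{\alpha\in\mathcal U}\mathbb{E}^{\alpha,\beta}[R_T]=\inf_{\alpha\in\mathcal U}\sup_{\beta\in\mathcal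 V}\mathbb{E}^{\alpha,\beta}[R_T].$$ It satisfies the dynamic programming principle $$V^\delta(x)=\delta\Phi(x)+(1-\delta)\inf_{\alpha}\sup_{\beta}\sum_{J}\beta_J\big(V^\delta(x+e_J)-\alpha(J)\big),$$ where $\alpha$ ranges over probability measures on $\{1,\dots,4\}$, $\beta$ over probability measures on the power set, and $\alpha(J)=\sum_{i\in J}\alpha_i$. The function $u$. Let $u^\delta(x):=\sqrt\delta\,V^\delta(x/\sqrt\delta)$. It is known that as $\delta\downarrow0$, $u^\delta$ converges locally uniformly to a function $u:\mathbb{R}^4\to\mathbb{R}$, which is the unique viscosity solution, in the class of functions with linear growth, of $$u(x)-\frac12\sup_{J\subseteq\{1,2,3,4\}}e_J^\top\,\partial^2u(x)\,e_J=\Phi(x),\qquad x\in\mathbb{R}^4.$$ This $u$ is the function in the theorem. *)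

theory Defs
  imports "HOL-Probability.Probability"
begin

text \<open>The experts are the elements of the index type \<^typ>\<open>4\<close>, so that vectors in
  \<open>\<real>\<^sup>4\<close> are elements of \<^typ>\<open>real^4\<close>.\<close>

definition e_set :: "4 set \<Rightarrow> real^4" where
  "e_set J = (\<Sum>j\<in>J. axis j 1)"

definition Phi :: "real^4 \<Rightarrow> real" where
  "Phi x = Max (range (\<lambda>i. x $ i))"

definition ranked :: "real^4 \<Rightarrow> nat \<Rightarrow> real" where
  "ranked x k = sort [x $ 1, x $ 2, x $ 3, x $ 4] ! (k - 1)"

subsection \<open>The game\<close>

text \<open>A gain state is \<open>((G\<^sup>1, \<dots>, G\<^sup>4), G)\<close>. The history known when the moves of round \<open>t\<close>
  are chosen is the list of the gain states at times \<open>0, \<dots>, t - 1\<close>, oldest first; its length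
  is \<open>t\<close>, so a function of the history may also depend on time. A strategy is deterministic as a
  function of the history, and its value is the mixed action played.\<close>

type_synonym gains = "(real^4) \<times> real"
type_synonym player = "gains list \<Rightarrow> 4 pmf"
type_synonym nature = "gains list \<Rightarrow> 4 set pmf"

fun update :: "gains \<Rightarrow> 4 \<Rightarrow> 4 set \<Rightarrow> gains" where
  "update (G, g) i J = (G + e_set J, g + of_bool (i \<in> J))"

fun regret :: "gains \<Rightarrow> real" where
  "regret (G, g) = Phi G - g"

text \<open>The law of the history at times \<open>0, \<dots>, t\<close>. Only the differences \<open>X\<^sub>0 = (G\<^sup>i\<^sub>0 - G\<^sub>0)\<^sub>i\<close> matter
  for the regret; the normalisation used is \<open>G\<^sub>0 = 0\<close> and \<open>G\<^sup>i\<^sub>0 = X\<^sub>0\<^sup>i\<close>. Given the past, the two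
  moves are drawn independently, hence the product \<^const>\<open>pair_pmf\<close>.\<close>

primrec play :: "player \<Rightarrow> nature \<Rightarrow> real^4 \<Rightarrow> nat \<Rightarrow> gains list pmf" where
  "play \<alpha> \<beta> x 0 = return_pmf [(x, 0)]"
| "play \<alpha> \<beta> x (Suc t) =
     bind_pmf (play \<alpha> \<beta> x t) (\<lambda>h.
       map_pmf (\<lambda>(i, J). h @ [update (last h) i J]) (pair_pmf (\<alpha> h) (\<beta> h)))"

text \<open>The law of \<open>R\<^sub>T\<close>, where \<open>T\<close> is independent of the play and \<open>P(T = t) = \<delta> (1 - \<delta>)\<^sup>t\<close> for
  \<open>t = 0, 1, 2, \<dots>\<close>. It is meaningful for \<open>0 < \<delta> \<le> 1\<close>.\<close>

definition final_regret :: "real \<Rightarrow> player \<Rightarrow> nature \<Rightarrow> real^4 \<Rightarrow> real pmf" where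
  "final_regret \<delta> \<alpha> \<beta> x =
     bind_pmf (geometric_pmf \<delta>) (\<lambda>t. map_pmf (\<lambda>h. regret (last h)) (play \<alpha> \<beta> x t))"

definition expected_regret :: "real \<Rightarrow> player \<Rightarrow> nature \<Rightarrow> real^4 \<Rightarrow> real" where
  "expected_regret \<delta> \<alpha> \<beta> x = measure_pmf.expectation (final_regret \<delta> \<alpha> \<beta> x) (\<lambda>r. r)"

text \<open>For \<open>0 < \<delta> \<le> 1\<close> the expected regrets are bounded uniformly in both strategies (one round
  changes the regret by at most 1), so the supremum and the infimum in \<^typ>\<open>real\<close> are the
  usual ones.\<close>

definition game_value :: "real \<Rightarrow> real^4 \<Rightarrow> real" where
  "game_value \<delta> x = (SUP \<beta>. INF \<alpha>. expected_regret \<delta> \<alpha> \<beta> x)"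

subsection \<open>The scaling limit\<close>

definition scaled_value :: "real \<Rightarrow> real^4 \<Rightarrow> real" where
  "scaled_value \<delta> x = sqrt \<delta> * game_value \<delta> (x /\<^sub>R sqrt \<delta>)"

text \<open>Uniform convergence on compact sets is locally uniform convergence on \<open>\<real>\<^sup>4\<close>.\<close>

definition limit_value :: "real^4 \<Rightarrow> real" where
  "limit_value = (THE u. \<forall>K. compact K \<longrightarrow> uniform_limit K scaled_value u (at_right 0))"

subsection \<open>Second order calculus\<close>

definition grad :: "(real^4 \<Rightarrow> real) \<Rightarrow> real^4 \<Rightarrow> real^4" where
  "grad f x = (\<chi> i. frechet_derivative f (at x) (axis i 1))"

definition hessian :: "(real^4 \<Rightarrow> real) \<Rightarrow> real^4 \<Rightarrow> real^4^4" where
  "hessian f x = jacobian (grad f) (at x)"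

definition twice_continuously_differentiable :: "(real^4 \<Rightarrow> real) \<Rightarrow> bool" where
  "twice_continuously_differentiable f \<longleftrightarrow>
     (\<forall>x. f differentiable (at x)) \<and> (\<forall>x. grad f differentiable (at x)) \<and>
     continuous_on UNIV (hessian f)"

definition maximizer :: "(real^4 \<Rightarrow> real) \<Rightarrow> real^4 \<Rightarrow> 4 set \<Rightarrow> bool" where
  "maximizer f x J \<longleftrightarrow>
     is_arg_max (\<lambda>K. e_set K \<bullet> (hessian f x *v e_set K)) (\<lambda>_. True) J"

end

theory Submission
  imports Defs "HOL-Real_Asymp.Real_Asymp"
begin

text \<open>The function \<open>u\<close> is known in closed form, so the theorem is proved by verification. Write
  \<open>V\<close> for the value of the game, \<open>\<Phi>\<close> for the maximum of the coordinates and \<open>e\<^sub>J\<close> for the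
  indicator vector of a set \<open>J\<close> of experts. Let \<open>u\<close> be the function of the closed formula. Four
  properties suffice: \<open>u\<close> is twice continuously differentiable, its partial derivatives are
  nonnegative, \<open>u\<close> increases by \<open>\<lambda>\<close> when all coordinates do, and
  \<open>u - \<Phi> = max\<^sub>J e\<^sub>J\<^sup>T (\<partial>\<^sup>2 u) e\<^sub>J / 2\<close>, the maximum being attained by the comb, that is, by
  the second and the fourth expert in the ranking.

  Given these properties, \<open>u(\<surd>\<delta> x) / \<surd>\<delta>\<close> is a potential for the game. A player who plays the
  gradient of \<open>u\<close> (a probability vector by the second and third property) cancels the first order
  effect of every move of nature; the second order effect is at most \<open>\<delta>\<close> times the gap
  between potential and regret, which is exactly what the discount \<open>\<delta>\<close> compensates
  (\<open>player_step\<close>). If nature tosses a fair coin between the comb and its complement, the first order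
  effect vanishes against every player and the second order effect is attained
  (\<open>nature_step\<close>). The error in each round is of order \<open>\<delta>\<close> and there are \<open>1 / \<delta>\<close> rounds on average,
  so \<open>V\<close> and the potential differ by at most a constant that is independent of \<open>x\<close> and \<open>\<delta>\<close>
  (\<open>game_value_bounds\<close>). After scaling this identifies \<open>u\<close> with the limit. The errors are uniform
  over the unbounded state space because the second derivatives are compared with \<open>u - \<Phi>\<close>, and
  monotonicity together with the shift property makes \<open>u\<close> and \<open>\<Phi>\<close> Lipschitz
  (\<open>u_fun_upper_expansion\<close>, \<open>u_fun_lower_expansion\<close>).

  For ordered \<open>y\<close>, put \<open>m = \<surd>2 (y\<^sub>2 - y\<^sub>1)\<close>, \<open>n = \<surd>2 (y\<^sub>4 - y\<^sub>3)\<close> and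
  \<open>c = (y\<^sub>3 + y\<^sub>4 - y\<^sub>1 - y\<^sub>2) / \<surd>2\<close>. In these coordinates the closed formula reads
  \<open>y\<^sub>4 + \<surd>2 / 4 (kap c cosh n - sinh n + nu c cosh m)\<close> on the region \<open>m, n \<ge> 0\<close>, \<open>m + n \<le> 2 c\<close>.
  The critical inequalities are monotone in one of \<open>m\<close>, \<open>n\<close>, which moves them to the wall
  \<open>m + n = 2 c\<close>; there only the extreme points remain, where they become inequalities in \<open>c\<close> alone
  that are read off from power series in \<open>exp (- 4 c)\<close> (\<open>hyp_series\<close>,
  \<open>comb_beats_low_single\<close>, \<open>comb_beats_high_single\<close>). The derivatives match at the walls between the
  24 chambers (\<open>wall_identities\<close>, \<open>wall_matching\<close>), hence gradient and Hessian extend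
  equivariantly and continuously (\<open>lift_continuous\<close>), and a continuous extension of a derivative
  across finitely many hyperplanes is again a derivative (\<open>has_derivative_from_generic\<close>).\<close>


section \<open>Power series for sums of arctan and artanh\<close>

text \<open>The odd power series of \<open>arctan\<close> and \<open>artanh\<close> have the same coefficients at exponents
  \<open>1 mod 4\<close> and opposite ones at exponents \<open>3 mod 4\<close>. Their sum and difference are therefore
  given by such series in the fourth power of the argument, with offset \<open>1\<close> and \<open>3\<close>.\<close>

definition step4_series :: "nat \<Rightarrow> real \<Rightarrow> real" where
  "step4_series j z = (\<Sum>k. z ^ k / real (4 * k + j))"

lemma step4_series_summable:
  assumes "0 \<le> z" "z < 1" "0 < j"
  shows "summable (\<lambda>k. z ^ k / real (4 * k + j))"
proof (rule summable_comparison_test)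
  have "norm (z ^ k / real (4 * k + j)) \<le> z ^ k" for k
  proof -
    have "z ^ k / real (4 * k + j) \<le> z ^ k / 1" using assms by (intro divide_left_mono) auto
    then show ?thesis using assms by simp
  qed
  then show "\<exists>N. \<forall>k\<ge>N. norm (z ^ k / real (4 * k + j)) \<le> z ^ k" by blast
  show "summable (\<lambda>k. z ^ k)" using assms by (simp add: summable_geometric)
qed

text \<open>Splitting off the first term relates offset \<open>j\<close> to offset \<open>j + 4\<close>. This is how the
  constants cancel in the boundary inequalities below, which are equalities to leading order
  as \<open>z\<close> tends to \<open>0\<close>.\<close>

lemma step4_series_step:
  assumes "0 \<le> z" "z < 1" "0 < j"
  shows "step4_series j z = 1 / real j + z * step4_series (j + 4) z"
proof -
  have "step4_series j z = z ^ 0 / real (4 * 0 + j) + (\<Sum>k. z ^ Suc k / real (4 * Suc k + j))"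
    unfolding step4_series_def using suminf_split_head[OF step4_series_summable[OF assms]] by simp
  also have "(\<Sum>k. z ^ Suc k / real (4 * Suc k + j)) = (\<Sum>k. z * (z ^ k / real (4 * k + (j + 4))))"
    by (intro arg_cong[where f = suminf] ext) (simp add: algebra_simps)
  also have "\<dots> = z * step4_series (j + 4) z"
    unfolding step4_series_def using assms by (intro suminf_mult step4_series_summable) auto
  finally show ?thesis by simp
qed

lemma step4_series_antimono:
  assumes "0 \<le> z" "z < 1" "0 < i" "i \<le> j"
  shows "step4_series j z \<le> step4_series i z"
  unfolding step4_series_def using assms
  by (intro suminf_le step4_series_summable divide_left_mono) auto

lemma step4_series_nonneg:
  assumes "0 \<le> z" "z < 1" "0 < j"
  shows "0 \<le> step4_series j z"
  unfolding step4_series_def using assms by (intro suminf_nonneg step4_series_summable) auto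

text \<open>Each coefficient \<open>1 / (4 k + 1) - 1 / (4 k + 3)\<close> is at most \<open>2 / 3\<close>, its value for
  \<open>k = 0\<close>, so the geometric series dominates.\<close>

lemma step4_series_1_3_gap:
  assumes "0 \<le> z" "z < 1"
  shows "(1 - z) * (step4_series 1 z - step4_series 3 z) \<le> 2 / 3"
proof -
  have s1: "summable (\<lambda>k. z ^ k / real (4 * k + 1))" using step4_series_summable[OF assms, of 1] by simp
  have s3: "summable (\<lambda>k. z ^ k / real (4 * k + 3))" using step4_series_summable[OF assms, of 3] by simp
  have "step4_series 1 z - step4_series 3 z = (\<Sum>k. z ^ k / real (4 * k + 1) - z ^ k / real (4 * k + 3))"
    unfolding step4_series_def by (rule suminf_diff[OF s1 s3])
  also have "\<dots> \<le> (\<Sum>k. 2 / 3 * z ^ k)"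
  proof (rule suminf_le)
    fix k
    have "1 / real (4 * k + 1) - 1 / real (4 * k + 3) = 2 / ((4 * real k + 1) * (4 * real k + 3))"
      by (simp add: divide_simps)
    also have "\<dots> \<le> 2 / (1 * 3)"
      by (intro divide_left_mono mult_mono) auto
    finally have "1 / real (4 * k + 1) - 1 / real (4 * k + 3) \<le> 2 / 3" by simp
    then have "z ^ k * (1 / real (4 * k + 1) - 1 / real (4 * k + 3)) \<le> z ^ k * (2 / 3)"
      by (rule mult_left_mono) (use assms in auto)
    then show "z ^ k / real (4 * k + 1) - z ^ k / real (4 * k + 3) \<le> 2 / 3 * z ^ k"
      by (simp add: algebra_simps)
    show "summable (\<lambda>k. z ^ k / real (4 * k + 1) - z ^ k / real (4 * k + 3))"
      by (rule summable_diff[OF s1 s3])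
    show "summable (\<lambda>k. 2 / 3 * z ^ k)"
      using assms by (intro summable_mult) (simp add: summable_geometric)
  qed
  also have "\<dots> = 2 / 3 / (1 - z)"
    using assms by (subst suminf_mult) (auto simp: summable_geometric suminf_geometric)
  finally show ?thesis using assms by (simp add: field_simps)
qed

lemma sums_in_pairs: "f sums (s::real) \<Longrightarrow> (\<lambda>k. f (2 * k) + f (2 * k + 1)) sums s"
  using sums_group[of f s 2] by (simp add: mult.commute numeral_2_eq_2)

lemma arctan_artanh_series:
  assumes "0 < x" "x < (1::real)"
  shows "arctan x + artanh x = 2 * x * step4_series 1 (x ^ 4)"
    and "artanh x - arctan x = 2 * x ^ 3 * step4_series 3 (x ^ 4)"
proof -
  have x4: "0 \<le> x ^ 4" "x ^ 4 < 1" using assms by (auto simp: power_less_one_iff)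
  have c: "(\<lambda>k. x ^ (4 * k + 1) / real (4 * k + 1)) sums (x * step4_series 1 (x ^ 4))"
  proof -
    have "(\<lambda>k. x * ((x ^ 4) ^ k / real (4 * k + 1))) sums (x * step4_series 1 (x ^ 4))"
      unfolding step4_series_def using step4_series_summable[OF x4, of 1] by (intro sums_mult summable_sums) simp
    moreover have "x * ((x ^ 4) ^ k / real (4 * k + 1)) = x ^ (4 * k + 1) / real (4 * k + 1)" for k
      by (simp add: power_mult)
    ultimately show ?thesis by (simp only:)
  qed
  have d: "(\<lambda>k. x ^ (4 * k + 3) / real (4 * k + 3)) sums (x ^ 3 * step4_series 3 (x ^ 4))"
  proof -
    have "(\<lambda>k. x ^ 3 * ((x ^ 4) ^ k / real (4 * k + 3))) sums (x ^ 3 * step4_series 3 (x ^ 4))"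
      unfolding step4_series_def using step4_series_summable[OF x4, of 3] by (intro sums_mult summable_sums) simp
    moreover have "x ^ 3 * ((x ^ 4) ^ k / real (4 * k + 3)) = x ^ (4 * k + 3) / real (4 * k + 3)" for k
      by (simp add: power_mult power_add)
    ultimately show ?thesis by (simp only:)
  qed
  have "(\<lambda>k. (-1) ^ k * (1 / real (k * 2 + 1) * x ^ (k * 2 + 1))) sums arctan x"
    using arctan_series[of x] summable_arctan_series[of x] assms by (simp add: sums_iff)
  from sums_in_pairs[OF this]
  have "(\<lambda>k. x ^ (4 * k + 1) / real (4 * k + 1) - x ^ (4 * k + 3) / real (4 * k + 3)) sums arctan x"
    by (simp add: algebra_simps power_add power3_eq_cube)
  with sums_diff[OF c d] have a: "arctan x = x * step4_series 1 (x ^ 4) - x ^ 3 * step4_series 3 (x ^ 4)"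
    using sums_unique2 by blast
  have lnser: "(\<lambda>n. (-1) ^ n * (1 / real (n + 1)) * (y - 1) ^ Suc n) sums ln y" if "0 < y" "y < 2" for y :: real
  proof -
    have "summable (\<lambda>n. (-1) ^ n * (1 / real (n + 1)) * (y - 1) ^ Suc n)"
    proof (rule summable_comparison_test)
      have "norm ((-1) ^ n * (1 / real (n + 1)) * (y - 1) ^ Suc n) \<le> \<bar>y - 1\<bar> ^ Suc n" for n
      proof -
        have "norm ((-1) ^ n * (1 / real (n + 1)) * (y - 1) ^ Suc n) = 1 / real (n + 1) * \<bar>y - 1\<bar> ^ Suc n"
          by (simp add: abs_mult power_abs)
        also have "\<dots> \<le> \<bar>y - 1\<bar> ^ Suc n" by (rule mult_left_le_one_le) auto
        finally show ?thesis .
      qed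
      then show "\<exists>N. \<forall>n\<ge>N. norm ((-1) ^ n * (1 / real (n + 1)) * (y - 1) ^ Suc n) \<le> \<bar>y - 1\<bar> ^ Suc n"
        by blast
      show "summable (\<lambda>n. \<bar>y - 1\<bar> ^ Suc n)"
        using that by (subst summable_Suc_iff) (auto simp: summable_geometric_iff)
    qed
    then show ?thesis using ln_series[OF that] by (simp add: sums_iff)
  qed
  have l1: "(\<lambda>n. (-1) ^ n * (1 / real (n + 1)) * x ^ Suc n) sums ln (1 + x)"
    using lnser[of "1 + x"] assms by simp
  have l2: "(\<lambda>n. (-1) ^ n * (1 / real (n + 1)) * (- x) ^ Suc n) sums ln (1 - x)"
    using lnser[of "1 - x"] assms by simp
  have eq: "(\<lambda>n. (-1) ^ n * (1 / real (n + 1)) * x ^ Suc n - (-1) ^ n * (1 / real (n + 1)) * (- x) ^ Suc n)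
     = (\<lambda>n. ((-1) ^ n + 1) * (x ^ Suc n / real (n + 1)))"
  proof
    fix n :: nat
    define s where "s = (-1 :: real) ^ n"
    have a: "(- x) ^ Suc n = - (s * x ^ Suc n)"
      unfolding s_def by (subst power_minus) simp
    have b: "s * s = 1" unfolding s_def by (metis power_minus1_even power_add mult_2)
    have "s * (1 / real (n + 1)) * x ^ Suc n - s * (1 / real (n + 1)) * (- (s * x ^ Suc n))
       = s * (x ^ Suc n / real (n + 1)) + (s * s) * (x ^ Suc n / real (n + 1))"
      by (simp add: algebra_simps)
    also have "\<dots> = (s + 1) * (x ^ Suc n / real (n + 1))" unfolding b by (simp add: distrib_right add_divide_distrib)
    finally show "(-1) ^ n * (1 / real (n + 1)) * x ^ Suc n - (-1) ^ n * (1 / real (n + 1)) * (- x) ^ Suc n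
       = ((-1) ^ n + 1) * (x ^ Suc n / real (n + 1))" unfolding a s_def .
  qed
  have "(\<lambda>n. ((-1) ^ n + 1) * (x ^ Suc n / real (n + 1))) sums (ln (1 + x) - ln (1 - x))"
    using sums_diff[OF l1 l2] by (simp only: eq)
  from sums_in_pairs[OF sums_in_pairs[OF this]]
  have "(\<lambda>k. 2 * (x ^ (4 * k + 1) / real (4 * k + 1)) + 2 * (x ^ (4 * k + 3) / real (4 * k + 3)))
     sums (ln (1 + x) - ln (1 - x))"
    by (simp add: algebra_simps power_add power3_eq_cube)
  with sums_add[OF sums_mult[OF c, of 2] sums_mult[OF d, of 2]]
  have "ln (1 + x) - ln (1 - x) = 2 * (x * step4_series 1 (x ^ 4)) + 2 * (x ^ 3 * step4_series 3 (x ^ 4))"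
    using sums_unique2 by blast
  then have b: "artanh x = x * step4_series 1 (x ^ 4) + x ^ 3 * step4_series 3 (x ^ 4)"
    using assms by (simp add: artanh_def ln_div)
  show "arctan x + artanh x = 2 * x * step4_series 1 (x ^ 4)" "artanh x - arctan x = 2 * x ^ 3 * step4_series 3 (x ^ 4)"
    using a b by simp_all
qed

section \<open>The coefficient functions of the explicit solution\<close>

text \<open>With \<open>c = (x\<^sup>(\<^sup>3\<^sup>) + x\<^sup>(\<^sup>4\<^sup>) - x\<^sup>(\<^sup>1\<^sup>) - x\<^sup>(\<^sup>2\<^sup>)) / \<surd>2\<close>, the closed formula contains \<open>c\<close> through
  the following functions. At \<open>c = 0\<close> the second one has the default value \<open>artanh 1 = 0\<close>; it occurs
  there only in combinations whose limit is \<open>0\<close>, so the default is harmless.\<close>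

definition arctan_exp :: "real \<Rightarrow> real" where "arctan_exp c = arctan (exp (- c))"
definition artanh_exp :: "real \<Rightarrow> real" where "artanh_exp c = artanh (exp (- c))"

text \<open>The explicit solution is linear in \<open>kap\<close> and \<open>nu\<close>. The pair \<open>lam\<close>, \<open>mu\<close> arises from them by
  differentiation: up to signs and elementary terms, taking derivatives exchanges \<open>kap\<close> with
  \<open>lam\<close> and \<open>nu\<close> with \<open>mu\<close>.\<close>

definition kap :: "real \<Rightarrow> real" where "kap c = arctan_exp c * cosh c + artanh_exp c * sinh c"
definition nu :: "real \<Rightarrow> real" where "nu c = arctan_exp c * cosh c - artanh_exp c * sinh c"
definition lam :: "real \<Rightarrow> real" where "lam c = arctan_exp c * sinh c + artanh_exp c * cosh c"
definition mu :: "real \<Rightarrow> real" where "mu c = artanh_exp c * cosh c - arctan_exp c * sinh c"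

lemma arctan_exp_deriv: "(arctan_exp has_real_derivative - 1 / (2 * cosh c)) (at c)"
proof -
  have "(arctan_exp has_real_derivative - exp (- c) / (1 + (exp (-c))\<^sup>2)) (at c)"
    unfolding arctan_exp_def by (auto intro!: derivative_eq_intros simp: field_simps)
  also have "- exp (- c) / (1 + (exp (-c))\<^sup>2) = - 1 / (2 * cosh c)"
  proof -
    have "exp (- c) * (2 * cosh c) = 1 + (exp (- c))\<^sup>2"
      by (simp add: cosh_def algebra_simps power2_eq_square flip: exp_add)
    moreover have "1 + (exp (- c))\<^sup>2 > 0" by (simp add: add_pos_nonneg)
    ultimately show ?thesis by (simp add: frac_eq_eq)
  qed
  finally show ?thesis .
qed

lemma artanh_exp_deriv:
  assumes "c > 0"
  shows "(artanh_exp has_real_derivative - 1 / (2 * sinh c)) (at c)"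
proof -
  have "(artanh_exp has_real_derivative (1 / (1 - (exp (- c))\<^sup>2)) * (exp (- c) * - 1)) (at c)"
    unfolding artanh_exp_def[abs_def]
    by (rule DERIV_chain2[OF artanh_real_has_field_derivative])
      (use assms in \<open>auto intro!: derivative_eq_intros\<close>)
  also have "(1 / (1 - (exp (- c))\<^sup>2)) * (exp (- c) * - 1) = - 1 / (2 * sinh c)"
  proof -
    have "exp (- c) * (2 * sinh c) = 1 - (exp (- c))\<^sup>2"
      by (simp add: sinh_def algebra_simps power2_eq_square flip: exp_add)
    moreover have "(exp (- c))\<^sup>2 < 1" using assms by (simp add: power_less_one_iff)
    ultimately show ?thesis using assms by (simp add: frac_eq_eq)
  qed
  finally show ?thesis .
qed

lemma kap_deriv: "c > 0 \<Longrightarrow> (kap has_real_derivative lam c - 1) (at c)"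
  unfolding kap_def[abs_def] lam_def
  by (auto intro!: derivative_eq_intros arctan_exp_deriv artanh_exp_deriv simp: field_simps)

lemma nu_deriv: "c > 0 \<Longrightarrow> (nu has_real_derivative - mu c) (at c)"
  unfolding nu_def[abs_def] mu_def
  by (auto intro!: derivative_eq_intros arctan_exp_deriv artanh_exp_deriv simp: field_simps)

lemma lam_deriv:
  assumes "c > 0"
  shows "(lam has_real_derivative kap c - cosh (2 * c) / sinh (2 * c)) (at c)"
proof -
  have "(lam has_real_derivative
     (- 1 / (2 * cosh c)) * sinh c + cosh c * arctan_exp c
     + ((- 1 / (2 * sinh c)) * cosh c + sinh c * artanh_exp c)) (at c)"
    unfolding lam_def[abs_def]
    using assms by (auto intro!: derivative_eq_intros arctan_exp_deriv artanh_exp_deriv)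
  moreover have "cosh (2 * c) / sinh (2 * c) = sinh c / (2 * cosh c) + cosh c / (2 * sinh c)"
    using assms by (simp add: cosh_double sinh_double divide_simps power2_eq_square)
  ultimately show ?thesis unfolding kap_def by (simp add: algebra_simps)
qed

lemma mu_deriv:
  assumes "c > 0"
  shows "(mu has_real_derivative - nu c - 1 / sinh (2 * c)) (at c)"
proof -
  have "(mu has_real_derivative
     ((- 1 / (2 * sinh c)) * cosh c + sinh c * artanh_exp c)
      - ((- 1 / (2 * cosh c)) * sinh c + cosh c * arctan_exp c)) (at c)"
    unfolding mu_def[abs_def]
    using assms by (auto intro!: derivative_eq_intros arctan_exp_deriv artanh_exp_deriv)
  moreover
  have "1 / sinh (2 * c) = cosh c / (2 * sinh c) - sinh c / (2 * cosh c)"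
    using assms cosh_square_eq[of c]
    by (simp add: sinh_double divide_simps power2_eq_square)
  then have "((- 1 / (2 * sinh c)) * cosh c + sinh c * artanh_exp c)
      - ((- 1 / (2 * cosh c)) * sinh c + cosh c * arctan_exp c) = - nu c - 1 / sinh (2 * c)"
    by (simp add: nu_def)
  ultimately show ?thesis by simp
qed

text \<open>In the variable \<open>z = exp (- 4 c)\<close> all four functions become elementary combinations of two
  series. An inequality that is linear in these functions with exponential coefficients turns
  into a linear inequality between \<open>step4_series\<close> of different offsets, and those are ordered by
  their offset.\<close>

lemma hyp_series:
  assumes "c > 0" defines "z \<equiv> exp (- (4 * c))" and "e \<equiv> exp (- (2 * c))"
  shows "0 < z" "z < 1" "z = e\<^sup>2" "0 < e"
    "lam c = step4_series 1 z + z * step4_series 3 z" "kap c = step4_series 1 z - z * step4_series 3 z"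
    "mu c = e * (step4_series 1 z + step4_series 3 z)" "nu c = e * (step4_series 1 z - step4_series 3 z)"
proof -
  define x where "x = exp (- c)"
  have x: "0 < x" "x < 1" using assms by (auto simp: x_def)
  have zx: "z = x ^ 4" by (simp add: z_def x_def flip: exp_of_nat_mult)
  have ex: "e = x\<^sup>2" by (simp add: e_def x_def flip: exp_of_nat_mult)
  show "0 < z" "z < 1" using assms by (auto simp: z_def)
  show "z = e\<^sup>2" "0 < e" using x by (auto simp: zx ex)
  have ch: "cosh c = (1 / x + x) / 2" and sh: "sinh c = (1 / x - x) / 2"
    by (auto simp: cosh_def sinh_def x_def exp_minus field_simps)
  have s: "arctan_exp c = x * step4_series 1 z - x ^ 3 * step4_series 3 z" "artanh_exp c = x * step4_series 1 z + x ^ 3 * step4_series 3 z"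
    using arctan_artanh_series[OF x] by (auto simp: arctan_exp_def artanh_exp_def zx x_def[symmetric])
  show "lam c = step4_series 1 z + z * step4_series 3 z" "kap c = step4_series 1 z - z * step4_series 3 z"
    "mu c = e * (step4_series 1 z + step4_series 3 z)" "nu c = e * (step4_series 1 z - step4_series 3 z)"
    unfolding lam_def kap_def mu_def nu_def s ch sh using x
    by (simp_all add: ex zx field_simps power2_eq_square power3_eq_cube power4_eq_xxxx)
qed

section \<open>Inequalities for the coefficient functions\<close>

lemma cosh_mono_nonneg: "0 \<le> x \<Longrightarrow> x \<le> y \<Longrightarrow> cosh x \<le> cosh (y::real)"
  by (rule cosh_real_nonneg_le_iff[THEN iffD2]) auto

lemma affine_nonneg:
  assumes "0 \<le> y" "0 \<le> s1 * x + y" "0 \<le> s" "s \<le> (s1::real)"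
  shows "0 \<le> s * x + y"
proof (cases "x \<ge> 0")
  case True then show ?thesis using assms by simp
next
  case False
  then have "s1 * x \<le> s * x" using assms by (intro mult_right_mono_neg) auto
  then show ?thesis using assms by linarith
qed

lemma coeff_bounds:
  assumes "c > 0"
  shows nu_pos: "0 \<le> nu c" and mu_pos: "0 \<le> mu c" and lam_ge_1: "1 \<le> lam c"
    and kap_le_1: "kap c \<le> 1" and nu_le: "nu c \<le> exp (- (2 * c))"
    and kap_ge: "0 \<le> kap c"
proof -
  define z where "z = exp (- (4 * c))"
  define e where "e = exp (- (2 * c))"
  note h = hyp_series[OF assms, folded z_def e_def]
  have z: "0 \<le> z" "z < 1" using h by auto
  have r1: "step4_series 1 z = 1 + z * step4_series 5 z" using step4_series_step[OF z, of 1] by simp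
  have m: "step4_series 3 z \<le> step4_series 1 z" "step4_series 5 z \<le> step4_series 3 z" "0 \<le> step4_series 3 z" "0 \<le> step4_series 5 z"
    using step4_series_antimono[OF z, of 1 3] step4_series_antimono[OF z, of 3 5] step4_series_nonneg[OF z, of 3]
      step4_series_nonneg[OF z, of 5] by auto
  have p: "0 \<le> z * step4_series 3 z" "0 \<le> z * step4_series 5 z" "z * step4_series 5 z \<le> z * step4_series 3 z" "z * step4_series 5 z \<le> step4_series 5 z"
    "z * step4_series 3 z \<le> step4_series 3 z"
    using m z by (auto intro: mult_left_mono mult_left_le_one_le)
  show "0 \<le> nu c" "0 \<le> mu c" "1 \<le> lam c" "kap c \<le> 1" "0 \<le> kap c"
    unfolding h(5-8) using h(4) m p r1 by (auto intro!: mult_nonneg_nonneg)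
  have "step4_series 1 z - step4_series 3 z \<le> 1" using r1 p m by linarith
  then have "e * (step4_series 1 z - step4_series 3 z) \<le> e * 1" using h(4) by (intro mult_left_mono) auto
  then show "nu c \<le> exp (- (2 * c))" by (simp add: h(8) e_def)
qed

lemma trig_combinations:
  "kap c * cosh n - lam c * sinh n = arctan_exp c * cosh (c - n) + artanh_exp c * sinh (c - n)"
  "nu c * cosh m + mu c * sinh m = arctan_exp c * cosh (c - m) - artanh_exp c * sinh (c - m)"
  "lam c * cosh n - kap c * sinh n = arctan_exp c * sinh (c - n) + artanh_exp c * cosh (c - n)"
  "mu c * cosh m + nu c * sinh m = artanh_exp c * cosh (c - m) - arctan_exp c * sinh (c - m)"
  by (simp_all add: kap_def lam_def nu_def mu_def cosh_diff sinh_diff algebra_simps)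

text \<open>On the wall \<open>m + n = 2 c\<close> the numbers \<open>c - m\<close> and \<open>c - n\<close> are opposite, so both sides agree by
  the parity of the hyperbolic functions. These identities are the matching of the first and
  second derivatives of the solution across \<open>x\<^sup>(\<^sup>2\<^sup>) = x\<^sup>(\<^sup>3\<^sup>)\<close>.\<close>

lemma wall_identities:
  assumes "m + n = 2 * c"
  shows "nu c * cosh m + mu c * sinh m = kap c * cosh n - lam c * sinh n"
    and "mu c * cosh m + nu c * sinh m = lam c * cosh n - kap c * sinh n"
proof -
  have "c - m = - (c - n)" using assms by simp
  then have e: "cosh (c - m) = cosh (c - n)" "sinh (c - m) = - sinh (c - n)"
    by (metis cosh_minus, metis sinh_minus)
  show "nu c * cosh m + mu c * sinh m = kap c * cosh n - lam c * sinh n"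
    unfolding trig_combinations e by simp
  show "mu c * cosh m + nu c * sinh m = lam c * cosh n - kap c * sinh n"
    unfolding trig_combinations e by simp
qed

lemma exp_forms:
  fixes c n :: real
  shows "cosh (2 * c - n) = (1 / (exp (- (2 * c)) * exp n) + exp (- (2 * c)) * exp n) / 2"
    "sinh (2 * c - n) = (1 / (exp (- (2 * c)) * exp n) - exp (- (2 * c)) * exp n) / 2"
  by (simp_all add: cosh_def sinh_def exp_minus exp_diff field_simps)

lemma exp_forms_plain:
  fixes n :: real
  shows "cosh n = (exp n + 1 / exp n) / 2" "sinh n = (exp n - 1 / exp n) / 2"
  by (simp_all add: cosh_def sinh_def exp_minus field_simps)

text \<open>In the inequalities below the substitution \<open>t = exp n\<close> (or \<open>exp m\<close>) produces
  \<open>t X + Y / t\<close>, which has the sign of an affine function of \<open>t\<^sup>2\<close>. This lemma gives the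
  range of \<open>t\<^sup>2\<close>.\<close>

lemma exp_sq_range:
  assumes "0 \<le> n" "n \<le> 2 * (c::real)"
  shows "1 \<le> (exp n)\<^sup>2" "(exp n)\<^sup>2 \<le> 1 / exp (- (4 * c))"
  using assms by (auto simp: exp_minus divide_inverse simp flip: exp_of_nat_mult)

text \<open>This is four times the derivative of the solution in its smallest coordinate. It decreases in
  \<open>n\<close> because \<open>lam c \<ge> 1\<close>, so the worst case is the wall \<open>n = 2 c - m\<close>. There it has the sign
  of an affine function of \<open>exp (2 m)\<close>, whose value at the far end \<open>m = 2 c\<close> is nonnegative by
  the bound on the gap between the two series.\<close>

lemma lowest_partial_nonneg:
  assumes "c > 0" "0 \<le> m" "0 \<le> n" "m + n \<le> 2 * c"
  shows "0 \<le> mu c * cosh m - 2 * (nu c * sinh m) - (lam c - 1) * cosh n"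
proof -
  define z where "z = exp (- (4 * c))"
  define e where "e = exp (- (2 * c))"
  note h = hyp_series[OF assms(1), folded z_def e_def]
  have z: "0 \<le> z" "z < 1" using h by auto
  have r1: "step4_series 1 z = 1 + z * step4_series 5 z" using step4_series_step[OF z, of 1] by simp
  have mo: "step4_series 3 z \<le> step4_series 1 z" "step4_series 5 z \<le> step4_series 1 z"
    using step4_series_antimono[OF z, of 1 3] step4_series_antimono[OF z, of 1 5] by auto
  define t where "t = exp m"
  have t: "t > 0" "0 \<le> t\<^sup>2" "t\<^sup>2 \<le> 1 / z" using exp_sq_range[of m c] assms by (auto simp: t_def z_def)
  define X where "X = 1 - 2 * step4_series 1 z + 3 * step4_series 3 z - z * step4_series 3 z"
  define Y where "Y = 3 * step4_series 1 z - 2 * step4_series 3 z - step4_series 5 z"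
  \<comment> \<open>\<open>X\<close> and \<open>Y\<close> are the coefficients of \<open>t\<close> and \<open>1 / t\<close> on the wall, divided by \<open>exp (- 2 c) / 2\<close>.\<close>
  have "0 \<le> t\<^sup>2 * X + Y"
  proof (rule affine_nonneg[OF _ _ t(2,3)])
    show "0 \<le> Y" using mo by (simp add: Y_def)
    have "0 \<le> 2 - 3 * ((1 - z) * (step4_series 1 z - step4_series 3 z))" using step4_series_1_3_gap[OF z] by linarith
    also have "\<dots> = X + z * Y"
      unfolding X_def Y_def using r1 by (simp add: algebra_simps)
    finally have "0 \<le> (X + z * Y) / z" using z(1) by (rule divide_nonneg_nonneg)
    also have "\<dots> = 1 / z * X + Y" using h(1) by (simp add: field_simps)
    finally show "0 \<le> 1 / z * X + Y" .
  qed
  then have "0 \<le> e / (2 * t) * (t\<^sup>2 * X + Y)" using t h(4) by simp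
  also have "\<dots> = mu c * cosh m - 2 * (nu c * sinh m) - (lam c - 1) * cosh (2 * c - m)"
  proof -
    have l: "lam c - 1 = e\<^sup>2 * (step4_series 5 z + step4_series 3 z)" using h(3,5) r1 by (simp add: algebra_simps)
    have x: "X = - step4_series 1 z + 3 * step4_series 3 z - e\<^sup>2 * step4_series 3 z - e\<^sup>2 * step4_series 5 z" 
      unfolding X_def h(3)[symmetric] using r1 by simp
    show ?thesis unfolding l x h(7,8) exp_forms unfolding exp_forms_plain Y_def e_def[symmetric] t_def[symmetric]
      using t(1) h(4) by (simp add: field_simps power2_eq_square)
  qed
  also have "\<dots> \<le> mu c * cosh m - 2 * (nu c * sinh m) - (lam c - 1) * cosh n"
    using lam_ge_1[OF assms(1)] assms by (intro diff_left_mono mult_left_mono cosh_mono_nonneg) auto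
  finally show ?thesis .
qed

text \<open>The difference of the two sides is, up to the factor 2, the difference of the derivatives in the
  third and in the second coordinate. It decreases in \<open>m\<close> and vanishes on the wall
  \<open>m = 2 c - n\<close>.\<close>

lemma middle_partials_ordered:
  assumes "c > 0" "0 \<le> m" "0 \<le> n" "m + n \<le> 2 * c"
  shows "mu c * cosh m + nu c * sinh m \<le> lam c * cosh n - kap c * sinh n"
proof -
  have "mu c * cosh m + nu c * sinh m \<le> mu c * cosh (2 * c - n) + nu c * sinh (2 * c - n)"
    using assms by (intro add_mono mult_left_mono cosh_mono_nonneg nu_pos mu_pos) auto
  also have "\<dots> = lam c * cosh n - kap c * sinh n" by (rule wall_identities) simp
  finally show ?thesis .
qed

text \<open>This expression is \<open>2 exp n (kap c cosh n - sinh n)\<close>. It is affine in \<open>exp (2 n)\<close>, and the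
  endpoint \<open>n = 2 c\<close> amounts to \<open>kap c \<ge> tanh (2 c)\<close>.\<close>

lemma kap_affine:
  assumes "c > 0" "0 \<le> n" "n \<le> 2 * c"
  shows "0 \<le> (exp n)\<^sup>2 * (kap c - 1) + (kap c + 1)"
proof -
  define z where "z = exp (- (4 * c))"
  note h = hyp_series[OF assms(1), folded z_def]
  have z: "0 \<le> z" "z < 1" using h by auto
  have r1: "step4_series 1 z = 1 + z * step4_series 5 z" using step4_series_step[OF z, of 1] by simp
  have m: "step4_series 3 z \<le> step4_series 1 z" "0 \<le> step4_series 5 z"
    using step4_series_antimono[OF z, of 1 3] step4_series_nonneg[OF z, of 5] by auto
  show ?thesis
  proof (rule affine_nonneg[of _ "1 / z"])
    show "0 \<le> kap c + 1" using kap_ge[OF assms(1)] by simp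
    show "0 \<le> (exp n)\<^sup>2" "(exp n)\<^sup>2 \<le> 1 / z" using exp_sq_range[of n c] assms by (auto simp: z_def)
    have "z * step4_series 3 z \<le> z * step4_series 1 z" using z m by (intro mult_left_mono) auto
    then have "(1 - z) * step4_series 1 z \<le> kap c" by (simp add: h(6) algebra_simps)
    moreover have "1 * (1 - z) \<le> step4_series 1 z * (1 - z)"
      using z m r1 by (intro mult_right_mono) auto
    ultimately have "1 - z \<le> kap c" by (simp add: mult.commute)
    then have "1 - z \<le> kap c" "0 \<le> z * kap c" using kap_ge[OF assms(1)] z by auto
    moreover have "kap c - 1 + z * (kap c + 1) = kap c - (1 - z) + z * kap c" by (simp add: algebra_simps)
    ultimately have "0 \<le> kap c - 1 + z * (kap c + 1)" by linarith
    then have "0 \<le> (kap c - 1 + z * (kap c + 1)) / z" using z by (intro divide_nonneg_nonneg) auto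
    then show "0 \<le> 1 / z * (kap c - 1) + (kap c + 1)" using h(1) by (simp add: field_simps)
  qed
qed

lemma top_gap_curvature_nonneg:
  assumes "c > 0" "0 \<le> n" "n \<le> 2 * c"
  shows "0 \<le> kap c * cosh n - sinh n"
proof -
  have "0 \<le> ((exp n)\<^sup>2 * (kap c - 1) + (kap c + 1)) / (2 * exp n)"
    using kap_affine[OF assms] by simp
  also have "\<dots> = kap c * cosh n - sinh n"
    unfolding exp_forms_plain by (simp add: field_simps power2_eq_square)
  finally show ?thesis .
qed

text \<open>Up to a positive factor this is the difference of the derivatives in the two largest
  coordinates. In \<open>t = exp n\<close> it factors as \<open>t - 1\<close> times an affine function that is bounded
  below by the one of \<open>kap_affine\<close>, since \<open>t \<le> t\<^sup>2\<close> and \<open>kap c \<le> 1\<close>.\<close>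

lemma top_partials_ordered:
  assumes "c > 0" "0 \<le> n" "n \<le> 2 * c"
  shows "0 \<le> 1 + kap c * sinh n - cosh n"
proof -
  define t where "t = exp n"
  have t: "1 \<le> t" using assms by (simp add: t_def)
  have "t * 1 \<le> t * t" using t by (intro mult_left_mono) auto
  then have "t \<le> t\<^sup>2" by (simp add: power2_eq_square)
  then have "t\<^sup>2 * (kap c - 1) \<le> t * (kap c - 1)"
    using kap_le_1[OF assms(1)] by (intro mult_right_mono_neg) auto
  then have "0 \<le> t * (kap c - 1) + (kap c + 1)" using kap_affine[OF assms] by (simp add: t_def)
  then have "0 \<le> (t - 1) * (t * (kap c - 1) + (kap c + 1)) / (2 * t)" using t by simp
  also have "\<dots> = 1 + kap c * sinh n - cosh n"
    unfolding exp_forms_plain t_def[symmetric] using t by (simp add: field_simps)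
  finally show ?thesis .
qed

text \<open>Curvature of the solution along the comb direction, compared with the second smallest coordinate
  alone. The expression decreases in \<open>m\<close>; on the wall \<open>m = 2 c - n\<close> the substitution
  \<open>t = exp n\<close> leaves an increasing affine function of \<open>t\<^sup>2\<close>, so only \<open>n = 0\<close> has to be checked.
  Both sides agree there to leading order as \<open>c\<close> grows, which corresponds to the game with three
  experts, and this is why the full series are needed.\<close>

lemma comb_beats_low_single:
  assumes "c > 0" "0 \<le> m" "0 \<le> n" "m + n \<le> 2 * c"
  shows "0 \<le> 3 * (kap c * cosh n - sinh n) - nu c * cosh m - 4 * (mu c * sinh m)"
proof -
  define z where "z = exp (- (4 * c))"
  define e where "e = exp (- (2 * c))"
  note h = hyp_series[OF assms(1), folded z_def e_def]
  have z: "0 \<le> z" "z < 1" using h by auto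
  have r: "step4_series 1 z = 1 + z * step4_series 5 z" "step4_series 3 z = 1/3 + z * step4_series 7 z"
    using step4_series_step[OF z, of 1] step4_series_step[OF z, of 3] by simp_all
  have mo: "step4_series 3 z \<le> step4_series 1 z" "step4_series 5 z \<le> step4_series 3 z" "step4_series 7 z \<le> step4_series 5 z" "0 \<le> step4_series 7 z"
    using step4_series_antimono[OF z, of 1 3] step4_series_antimono[OF z, of 3 5] step4_series_antimono[OF z, of 5 7]
      step4_series_nonneg[OF z, of 7] by auto
  define t where "t = exp n"
  have t: "t > 0" "1 \<le> t\<^sup>2" using exp_sq_range[of n c] assms by (auto simp: t_def z_def)
  define X where "X = z * (3 * step4_series 5 z + 3 * step4_series 1 z + 2 * step4_series 3 z)"
  define Y where "Y = 3 * kap c + 3 - 5 * step4_series 1 z - 3 * step4_series 3 z"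
  have X0: "0 \<le> X" unfolding X_def using mo z by (intro mult_nonneg_nonneg) auto
  have "0 \<le> z * (step4_series 5 z + 3 * step4_series 1 z - 3 * step4_series 7 z - step4_series 3 z)"
    using mo z by (intro mult_nonneg_nonneg) auto
  also have "\<dots> = X + Y"
    unfolding X_def Y_def h(6) using r by (simp add: algebra_simps)
  finally have "0 \<le> 1 * X + Y" by simp
  also have "1 * X + Y \<le> t\<^sup>2 * X + Y" using X0 t by (intro add_right_mono mult_right_mono) auto
  finally have "0 \<le> 1 / (2 * t) * (t\<^sup>2 * X + Y)" using t by simp
  also have "\<dots> = 3 * (kap c * cosh n - sinh n) - nu c * cosh (2 * c - n) - 4 * (mu c * sinh (2 * c - n))"
  proof -
    have k: "3 * kap c - 3 = 3 * z * step4_series 5 z - 3 * z * step4_series 3 z"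
      using h(6) r by (simp add: algebra_simps)
    have x: "X = 3 * kap c - 3 + e * e * (3 * step4_series 1 z + 5 * step4_series 3 z)" 
      unfolding X_def k using h(3) by (simp add: algebra_simps power2_eq_square)
    show ?thesis unfolding x h(7,8) exp_forms unfolding exp_forms_plain Y_def e_def[symmetric] t_def[symmetric]
      using t(1) h(4) by (simp add: field_simps power2_eq_square)
  qed
  also have "\<dots> \<le> 3 * (kap c * cosh n - sinh n) - nu c * cosh m - 4 * (mu c * sinh m)"
  proof -
    have "nu c * cosh m \<le> nu c * cosh (2 * c - n)"
      using assms by (intro mult_left_mono cosh_mono_nonneg nu_pos) auto
    moreover have "mu c * sinh m \<le> mu c * sinh (2 * c - n)"
      using assms by (intro mult_left_mono mu_pos) auto
    ultimately show ?thesis by linarith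
  qed
  finally show ?thesis .
qed

text \<open>The same comparison with the largest coordinate alone. The coefficient of \<open>cosh m\<close> is at most \<open>0\<close> by
  the bound on the gap between the two series, which again moves the worst case to the wall; there
  the critical end is \<open>n = 2 c\<close>.\<close>

lemma comb_beats_high_single:
  assumes "c > 0" "0 \<le> m" "0 \<le> n" "m + n \<le> 2 * c"
  shows "0 \<le> 3 * (nu c * cosh m) - (kap c * cosh n - sinh n)
     + (cosh (2 * c - n) - cosh m) / sinh (2 * c) - 4 * ((lam c - 1) * sinh n)"
proof -
  define z where "z = exp (- (4 * c))"
  define e where "e = exp (- (2 * c))"
  note h = hyp_series[OF assms(1), folded z_def e_def]
  have z: "0 \<le> z" "z < 1" using h by auto
  have r: "step4_series 1 z = 1 + z * step4_series 5 z" "step4_series 3 z = 1/3 + z * step4_series 7 z" "step4_series 5 z = 1/5 + z * step4_series 9 z"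
    "step4_series 7 z = 1/7 + z * step4_series 11 z"
    using step4_series_step[OF z, of 1] step4_series_step[OF z, of 3] step4_series_step[OF z, of 5] step4_series_step[OF z, of 7]
    by simp_all
  have mo: "step4_series 5 z \<le> step4_series 3 z" "step4_series 7 z \<le> step4_series 5 z" "0 \<le> step4_series 7 z" "step4_series 9 z \<le> step4_series 7 z"
    using step4_series_antimono[OF z, of 3 5] step4_series_antimono[OF z, of 5 7] step4_series_antimono[OF z, of 7 9]
      step4_series_nonneg[OF z, of 7] by auto
  define t where "t = exp n"
  have t: "t > 0" "0 \<le> t\<^sup>2" "t\<^sup>2 \<le> 1 / z" using exp_sq_range[of n c] assms by (auto simp: t_def z_def)
  define X where "X = 3 * z * step4_series 1 z - 6 * z * step4_series 3 z - 5 * step4_series 1 z + 5"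
  define Y where "Y = 6 * step4_series 1 z - 3 * step4_series 3 z + 5 * z * step4_series 3 z - 5"
  have "0 \<le> t\<^sup>2 * X + Y"
  proof (rule affine_nonneg[OF _ _ t(2,3)])
    have "0 \<le> z * (6 * step4_series 5 z - 3 * step4_series 7 z + 5 * step4_series 3 z)"
      using mo z by (intro mult_nonneg_nonneg) auto
    also have "\<dots> = 6 * (z * step4_series 5 z) - 3 * (z * step4_series 7 z) + 5 * z * step4_series 3 z"
      by (simp add: algebra_simps)
    also have "\<dots> = 6 * (step4_series 1 z - 1) - 3 * (step4_series 3 z - 1/3) + 5 * z * step4_series 3 z"
      using r(1,2) by simp
    also have "\<dots> = Y" by (simp add: Y_def)
    finally show "0 \<le> Y" .
    have "0 \<le> z * (9 * (step4_series 5 z - step4_series 7 z) + 5 * (step4_series 3 z - step4_series 9 z))"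
      using mo z by (intro mult_nonneg_nonneg) auto
    also have "\<dots> = (z * z * (9 * (step4_series 5 z - step4_series 7 z) + 5 * (step4_series 3 z - step4_series 9 z))) / z" using h(1) by simp
    also have "z * z * (9 * (step4_series 5 z - step4_series 7 z) + 5 * (step4_series 3 z - step4_series 9 z)) = X + z * Y"
    proof -
      have a: "z * step4_series 5 z = step4_series 1 z - 1" "z * step4_series 7 z = step4_series 3 z - 1/3" "z * step4_series 9 z = step4_series 5 z - 1/5"
        using r by auto
      have "z * z * (9 * (step4_series 5 z - step4_series 7 z) + 5 * (step4_series 3 z - step4_series 9 z))
        = 9 * z * (z * step4_series 5 z) - 9 * z * (z * step4_series 7 z) + 5 * z * z * step4_series 3 z - 5 * z * (z * step4_series 9 z)"
        by (simp add: algebra_simps)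
      also have "\<dots> = 9 * z * (z * step4_series 5 z) - 9 * z * (step4_series 3 z - 1/3) + 5 * z * z * step4_series 3 z - 5 * (z * step4_series 5 z) + z"
        unfolding a(2,3) by (simp add: algebra_simps)
      also have "\<dots> = X + z * Y" unfolding a(1) X_def Y_def by (simp add: algebra_simps)
      finally show ?thesis .
    qed
    also have "(X + z * Y) / z = 1 / z * X + Y" using h(1) by (simp add: field_simps)
    finally show "0 \<le> 1 / z * X + Y" .
  qed
  then have "0 \<le> 1 / (2 * t) * (t\<^sup>2 * X + Y)" using t by simp
  also have "\<dots> = 3 * (nu c * cosh (2 * c - n)) - (kap c * cosh n - sinh n) - 4 * ((lam c - 1) * sinh n)"
    unfolding h(5,6,8) exp_forms unfolding exp_forms_plain X_def Y_def e_def[symmetric] t_def[symmetric] h(3)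
    using t(1) h(4) by (simp add: field_simps power2_eq_square)
  also have "\<dots> \<le> 3 * (nu c * cosh m) - (kap c * cosh n - sinh n)
     + (cosh (2 * c - n) - cosh m) / sinh (2 * c) - 4 * ((lam c - 1) * sinh n)"
  proof -
    have sh: "sinh (2 * c) = (1 - z) / (2 * e)"
      using h(3,4) by (simp add: sinh_def e_def exp_minus field_simps power2_eq_square)
    have "3 * nu c \<le> 1 / sinh (2 * c)"
    proof -
      have "(1 - z) * (3 * nu c) \<le> 2 * e"
        using mult_left_mono[OF step4_series_1_3_gap[OF z], of "3 * e"] h(4) by (simp add: h(8) mult_ac)
      then have "3 * nu c \<le> 2 * e / (1 - z)" using z by (simp add: pos_le_divide_eq mult.commute)
      also have "\<dots> = 1 / sinh (2 * c)" unfolding sh by simp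
      finally show ?thesis .
    qed
    then have "3 * nu c * (cosh (2 * c - n) - cosh m) \<le> 1 / sinh (2 * c) * (cosh (2 * c - n) - cosh m)"
      using assms by (intro mult_right_mono) (auto intro!: cosh_mono_nonneg)
    then show ?thesis by (simp add: algebra_simps diff_divide_distrib)
  qed
  finally show ?thesis .
qed

lemma curvature_bounded:
  assumes "c > 0" "0 \<le> m" "0 \<le> n" "m + n \<le> 2 * c"
  shows "kap c * cosh n - sinh n + nu c * cosh m \<le> 2"
proof -
  have "kap c * cosh n \<le> 1 * cosh n" using kap_le_1[OF assms(1)] by (intro mult_right_mono) auto
  moreover have "cosh n - sinh n = exp (- n)" by (simp add: cosh_minus_sinh)
  moreover have "exp (- n) \<le> 1" using assms by simp
  moreover have "nu c * cosh m \<le> exp (- (2 * c)) * exp (2 * c)"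
  proof (rule mult_mono)
    have "cosh m \<le> cosh (2 * c)" using assms by (intro cosh_mono_nonneg) auto
    also have "\<dots> \<le> exp (2 * c)" using assms(1) by (simp add: cosh_def)
    finally show "cosh m \<le> exp (2 * c)" .
  qed (use assms nu_le in auto)
  moreover have "exp (- (2 * c)) * exp (2 * c) = 1" by (simp flip: exp_add)
  ultimately show ?thesis by linarith
qed

text \<open>The quotient is the loss of curvature if nature uses the pair of leaders instead of the comb.
  A product formula for the difference of hyperbolic cosines shows that it is controlled by
  \<open>c - (m + n) / 2\<close>, the distance to the wall on which the two choices coincide.\<close>

lemma top_pair_defect:
  fixes c m n :: real
  assumes "c > 0" "0 \<le> m" "0 \<le> n" "m + n \<le> 2 * c"
  shows "0 \<le> (cosh (2 * c - n) - cosh m) / sinh (2 * c)"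
    and "(cosh (2 * c - n) - cosh m) / sinh (2 * c) \<le> 2 * sinh (c - (m + n) / 2)"
proof -
  have s: "sinh (2 * c) > 0" using assms by simp
  show "0 \<le> (cosh (2 * c - n) - cosh m) / sinh (2 * c)"
    using assms s by (intro divide_nonneg_pos) (auto intro!: cosh_mono_nonneg)
  have "2 * c - n = c + (m - n) / 2 + (c - (m + n) / 2)" "m = c + (m - n) / 2 - (c - (m + n) / 2)"
    by (simp_all add: field_simps)
  then have "cosh (2 * c - n) - cosh m = cosh (c + (m - n) / 2 + (c - (m + n) / 2)) - cosh (c + (m - n) / 2 - (c - (m + n) / 2))"
    by simp
  also have "\<dots> = 2 * sinh (c - (m + n) / 2) * sinh (c + (m - n) / 2)"
    unfolding cosh_add cosh_diff by simp
  also have "\<dots> \<le> 2 * sinh (c - (m + n) / 2) * sinh (2 * c)"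
    using assms by (intro mult_left_mono) (auto simp: field_simps)
  finally show "(cosh (2 * c - n) - cosh m) / sinh (2 * c) \<le> 2 * sinh (c - (m + n) / 2)"
    using s by (simp add: field_simps)
qed

section \<open>The solution and its derivatives in the ordered chamber\<close>

text \<open>Inside the chamber of ordered points the solution separates in three linear coordinates:
  the two outer gaps, and the spread between the upper and the lower pair. The middle gap is
  what remains of twice the spread.\<close>

definition gap_low :: "real^4 \<Rightarrow> real" where "gap_low y = sqrt 2 * (y $ 2 - y $ 1)"
definition gap_high :: "real^4 \<Rightarrow> real" where "gap_high y = sqrt 2 * (y $ 4 - y $ 3)"
definition spread :: "real^4 \<Rightarrow> real" where "spread y = sqrt 2 / 2 * (y $ 3 + y $ 4 - y $ 1 - y $ 2)"

definition ordered :: "real^4 \<Rightarrow> bool" where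
  "ordered y \<longleftrightarrow> y $ 1 \<le> y $ 2 \<and> y $ 2 \<le> y $ 3 \<and> y $ 3 \<le> y $ 4"
definition strictly_ordered :: "real^4 \<Rightarrow> bool" where
  "strictly_ordered y \<longleftrightarrow> y $ 1 < y $ 2 \<and> y $ 2 < y $ 3 \<and> y $ 3 < y $ 4"

lemma spread_decomp: "2 * spread y = gap_low y + gap_high y + 2 * (sqrt 2 * (y $ 3 - y $ 2))"
  by (simp add: spread_def gap_low_def gap_high_def algebra_simps)

lemma ordered_gaps:
  assumes "ordered y"
  shows "0 \<le> gap_low y" "0 \<le> gap_high y" "gap_low y + gap_high y \<le> 2 * spread y" "0 \<le> spread y"
    "gap_high y \<le> 2 * spread y" "gap_low y \<le> 2 * spread y"
proof -
  have "0 \<le> sqrt 2 * (y $ 3 - y $ 2)" using assms by (simp add: ordered_def)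
  moreover show g: "0 \<le> gap_low y" "0 \<le> gap_high y" using assms by (auto simp: ordered_def gap_low_def gap_high_def)
  ultimately show "gap_low y + gap_high y \<le> 2 * spread y" "0 \<le> spread y"
    "gap_high y \<le> 2 * spread y" "gap_low y \<le> 2 * spread y"
    using spread_decomp[of y] by linarith+
qed

lemma strictly_ordered_spread_pos:
  assumes "strictly_ordered y" shows "0 < spread y"
  using assms unfolding strictly_ordered_def spread_def by (intro mult_pos_pos) auto

lemma strictly_ordered_imp_ordered: "strictly_ordered y \<Longrightarrow> ordered y"
  by (auto simp: strictly_ordered_def ordered_def)

text \<open>The closed formula in the chamber, after the products of hyperbolic functions have been turned
  into sums. Beyond the factor \<open>\<surd>2 / 4\<close>, the three slopes below are its derivatives with respect to
  \<open>spread\<close>, \<open>gap_high\<close> and \<open>gap_low\<close> (without the summand \<open>y $ 4\<close>).\<close>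

definition U_chamber :: "real^4 \<Rightarrow> real" where
  "U_chamber y = y $ 4 + sqrt 2 / 4 * (kap (spread y) * cosh (gap_high y) - sinh (gap_high y)
     + nu (spread y) * cosh (gap_low y))"
definition slope_spread :: "real^4 \<Rightarrow> real" where
  "slope_spread y = (lam (spread y) - 1) * cosh (gap_high y) - mu (spread y) * cosh (gap_low y)"
definition slope_high :: "real^4 \<Rightarrow> real" where
  "slope_high y = kap (spread y) * sinh (gap_high y) - cosh (gap_high y)"
definition slope_low :: "real^4 \<Rightarrow> real" where
  "slope_low y = nu (spread y) * sinh (gap_low y)"

text \<open>Second derivatives in the same coordinates: \<open>curv_high\<close> and \<open>curv_low\<close> belong to the gaps,
  \<open>twist_high\<close> and \<open>- twist_low\<close> are the mixed derivatives with the spread, and the derivative in the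
  spread alone is \<open>curv_high + curv_low - pair_defect\<close>.\<close>

definition curv_high :: "real^4 \<Rightarrow> real" where
  "curv_high y = kap (spread y) * cosh (gap_high y) - sinh (gap_high y)"
definition curv_low :: "real^4 \<Rightarrow> real" where
  "curv_low y = nu (spread y) * cosh (gap_low y)"
definition twist_high :: "real^4 \<Rightarrow> real" where
  "twist_high y = (lam (spread y) - 1) * sinh (gap_high y)"
definition twist_low :: "real^4 \<Rightarrow> real" where
  "twist_low y = mu (spread y) * sinh (gap_low y)"
definition pair_defect :: "real^4 \<Rightarrow> real" where
  "pair_defect y = (cosh (2 * spread y - gap_high y) - cosh (gap_low y)) / sinh (2 * spread y)"

text \<open>The factor \<open>r\<close> may blow up at \<open>0\<close>. The product extends continuously by \<open>0\<close> as soon as the other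
  factor vanishes fast enough, uniformly in terms of \<open>c\<close>. This handles the points where all four
  coordinates agree.\<close>

lemma continuous_on_singular_product:
  fixes c \<phi> :: "'a::t2_space \<Rightarrow> real" and r b :: "real \<Rightarrow> real"
  assumes c: "continuous_on S c" "\<And>x. x \<in> S \<Longrightarrow> 0 \<le> c x"
    and \<phi>: "continuous_on S \<phi>" "\<And>x. x \<in> S \<Longrightarrow> \<bar>\<phi> x\<bar> \<le> b (c x)"
    and r: "\<And>t. 0 < t \<Longrightarrow> isCont r t" "((\<lambda>t. r t * b t) \<longlongrightarrow> 0) (at_right 0)" and b0: "b 0 = 0"
  shows "continuous_on S (\<lambda>x. r (c x) * \<phi> x)"
  unfolding continuous_on_eq_continuous_within
proof
  fix x assume x: "x \<in> S"
  have cx: "continuous (at x within S) c" and px: "continuous (at x within S) \<phi>"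
    using c \<phi> x by (auto simp: continuous_on_eq_continuous_within)
  show "continuous (at x within S) (\<lambda>x. r (c x) * \<phi> x)"
  proof (cases "c x = 0")
    case False
    then have "isCont r (c x)" using c(2)[OF x] r by auto
    then have "continuous (at x within S) (\<lambda>x. r (c x))"
      using cx continuous_within_compose3 by blast
    then show ?thesis using px by (intro continuous_intros)
  next
    case True
    then have p0: "\<phi> x = 0" using \<phi>(2)[OF x] b0 by simp
    show ?thesis unfolding continuous_within p0 mult_zero_right
    proof (rule tendstoI)
      fix e :: real assume e: "e > 0"
      from tendstoD[OF r(2) e] obtain d where d: "d > 0" "\<And>t. 0 < t \<Longrightarrow> t < d \<Longrightarrow> \<bar>r t * b t\<bar> < e"
        unfolding eventually_at_right_field by (auto simp: dist_real_def)
      have "\<forall>\<^sub>F y in at x within S. dist (c y) 0 < d"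
        using tendstoD[OF cx[unfolded continuous_within] d(1)] True by simp
      moreover have "\<forall>\<^sub>F y in at x within S. y \<in> S"
        by (simp add: eventually_at_filter)
      ultimately show "\<forall>\<^sub>F y in at x within S. dist (r (c y) * \<phi> y) 0 < e"
      proof eventually_elim
        case (elim y)
        show ?case
        proof (cases "c y = 0")
          case True
          then have "\<phi> y = 0" using \<phi>(2)[OF elim(2)] b0 by simp
          then show ?thesis using e by simp
        next
          case False
          then have "0 < c y" "c y < d" using c(2)[OF elim(2)] elim(1) by (auto simp: dist_real_def)
          have "\<bar>r (c y) * \<phi> y\<bar> \<le> \<bar>r (c y) * b (c y)\<bar>"
            unfolding abs_mult using \<phi>(2)[OF elim(2)] by (intro mult_left_mono) auto
          also have "\<dots> < e" by (rule d(2)) fact+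
          finally show ?thesis by (simp add: dist_real_def)
        qed
      qed
    qed
  qed
qed

lemma continuous_gaps [continuous_intros]:
  "continuous_on S gap_low" "continuous_on S gap_high" "continuous_on S spread"
  unfolding gap_low_def[abs_def] gap_high_def[abs_def] spread_def[abs_def] by (intro continuous_intros)+

lemma isCont_arctan_exp: "isCont arctan_exp t" using arctan_exp_deriv DERIV_isCont by blast
lemma isCont_artanh_exp: "0 < t \<Longrightarrow> isCont artanh_exp t" using artanh_exp_deriv DERIV_isCont by blast

lemma continuous_arctan_exp_spread: "continuous_on S (\<lambda>y. arctan_exp (spread y))"
  by (rule continuous_on_compose2[of UNIV arctan_exp])
    (auto intro: continuous_gaps continuous_at_imp_continuous_on isCont_arctan_exp)

text \<open>The singularity of \<open>artanh (exp (- t))\<close> at \<open>0\<close> is only logarithmic.\<close>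

lemma artanh_exp_tendsto: "((\<lambda>t. artanh_exp t * (cosh t * sinh (2 * t))) \<longlongrightarrow> 0) (at_right 0)"
  unfolding artanh_exp_def artanh_def cosh_def sinh_def by simp real_asymp

lemma continuous_artanh_exp_spread:
  assumes "continuous_on {y. ordered y} \<phi>"
    and "\<And>y. ordered y \<Longrightarrow> \<bar>\<phi> y\<bar> \<le> cosh (spread y) * sinh (2 * spread y)"
  shows "continuous_on {y. ordered y} (\<lambda>y. artanh_exp (spread y) * \<phi> y)"
  by (rule continuous_on_singular_product[where b = "\<lambda>t. cosh t * sinh (2 * t)"])
    (use assms ordered_gaps(4) in \<open>auto intro: continuous_gaps isCont_artanh_exp artanh_exp_tendsto\<close>)

lemma cosh_diff_le:
  fixes a b d :: real
  assumes "0 \<le> a" "a \<le> d" "0 \<le> b" "b \<le> d"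
  shows "\<bar>cosh a - cosh b\<bar> \<le> sinh d"
proof -
  have "1 \<le> cosh a" "1 \<le> cosh b" by (auto simp: cosh_real_ge_1)
  moreover have "cosh a \<le> cosh d" "cosh b \<le> cosh d" using assms by (auto intro!: cosh_mono_nonneg)
  moreover have "cosh d - sinh d \<le> 1" using assms by (simp add: cosh_minus_sinh)
  ultimately show ?thesis by linarith
qed

lemma continuous_kap_spread: "continuous_on {y. ordered y} (\<lambda>y. kap (spread y))"
proof -
  have "continuous_on {y. ordered y} (\<lambda>y. artanh_exp (spread y) * sinh (spread y))"
  proof (rule continuous_artanh_exp_spread)
    fix y assume "ordered y"
    note g = ordered_gaps[OF this]
    have "1 * sinh (spread y) \<le> cosh (spread y) * sinh (2 * spread y)"
      using g by (intro mult_mono) (auto simp: cosh_real_ge_1)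
    then show "\<bar>sinh (spread y)\<bar> \<le> cosh (spread y) * sinh (2 * spread y)" using g by simp
  qed (intro continuous_intros)
  from continuous_on_add[OF _ this, of "\<lambda>y. arctan_exp (spread y) * cosh (spread y)"]
  show ?thesis unfolding kap_def by (simp add: continuous_intros continuous_arctan_exp_spread)
qed

lemma continuous_nu_spread: "continuous_on {y. ordered y} (\<lambda>y. nu (spread y))"
proof -
  have "continuous_on {y. ordered y} (\<lambda>y. 2 * (arctan_exp (spread y) * cosh (spread y)) - kap (spread y))"
    by (intro continuous_intros continuous_arctan_exp_spread continuous_kap_spread)
  then show ?thesis by (simp add: kap_def nu_def algebra_simps)
qed

lemma continuous_artanh_exp_cosh:
  assumes "continuous_on {y. ordered y} \<psi>" "\<And>y. ordered y \<Longrightarrow> \<bar>\<psi> y\<bar> \<le> sinh (2 * spread y)"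
  shows "continuous_on {y. ordered y} (\<lambda>y. artanh_exp (spread y) * (cosh (spread y) * \<psi> y))"
proof (rule continuous_artanh_exp_spread)
  show "continuous_on {y. ordered y} (\<lambda>y. cosh (spread y) * \<psi> y)"
    by (intro continuous_intros assms)
  show "\<bar>cosh (spread y) * \<psi> y\<bar> \<le> cosh (spread y) * sinh (2 * spread y)" if "ordered y" for y
    unfolding abs_mult using assms(2)[OF that] by (intro mult_mono) auto
qed

lemma chamber_continuous:
  shows "continuous_on {y. ordered y} U_chamber" "continuous_on {y. ordered y} slope_spread"
    "continuous_on {y. ordered y} slope_high" "continuous_on {y. ordered y} slope_low"
    "continuous_on {y. ordered y} curv_high" "continuous_on {y. ordered y} curv_low"
    "continuous_on {y. ordered y} twist_high" "continuous_on {y. ordered y} twist_low"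
    "continuous_on {y. ordered y} pair_defect"
proof -
  let ?S = "{y. ordered y}"
  note ci = continuous_intros continuous_arctan_exp_spread continuous_kap_spread continuous_nu_spread
  show "continuous_on ?S U_chamber" unfolding U_chamber_def[abs_def] by (intro ci)
  show "continuous_on ?S slope_high" unfolding slope_high_def[abs_def] by (intro ci)
  show "continuous_on ?S slope_low" unfolding slope_low_def[abs_def] by (intro ci)
  show "continuous_on ?S curv_high" unfolding curv_high_def[abs_def] by (intro ci)
  show "continuous_on ?S curv_low" unfolding curv_low_def[abs_def] by (intro ci)
  have b0: "continuous_on ?S (\<lambda>y. artanh_exp (spread y) * (cosh (spread y) * (cosh (gap_high y) - cosh (gap_low y))))"
    by (rule continuous_artanh_exp_cosh) (auto intro!: ci cosh_diff_le simp: ordered_gaps)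
  have "continuous_on ?S (\<lambda>y. artanh_exp (spread y) * (cosh (spread y) * (cosh (gap_high y) - cosh (gap_low y)))
     + arctan_exp (spread y) * sinh (spread y) * (cosh (gap_high y) + cosh (gap_low y)) - cosh (gap_high y))"
    by (intro continuous_on_diff continuous_on_add[OF b0] ci)
  then show "continuous_on ?S slope_spread" by (simp add: slope_spread_def[abs_def] lam_def mu_def algebra_simps)
  have b1: "continuous_on ?S (\<lambda>y. artanh_exp (spread y) * (cosh (spread y) * sinh (gap_high y)))"
    by (rule continuous_artanh_exp_cosh) (auto intro!: ci simp: ordered_gaps)
  have "continuous_on ?S (\<lambda>y. artanh_exp (spread y) * (cosh (spread y) * sinh (gap_high y))
     + arctan_exp (spread y) * sinh (spread y) * sinh (gap_high y) - sinh (gap_high y))"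
    by (intro continuous_on_diff continuous_on_add[OF b1] ci)
  then show "continuous_on ?S twist_high" by (simp add: twist_high_def[abs_def] lam_def algebra_simps)
  have b2: "continuous_on ?S (\<lambda>y. artanh_exp (spread y) * (cosh (spread y) * sinh (gap_low y)))"
    by (rule continuous_artanh_exp_cosh) (auto intro!: ci simp: ordered_gaps)
  have "continuous_on ?S (\<lambda>y. artanh_exp (spread y) * (cosh (spread y) * sinh (gap_low y))
     - arctan_exp (spread y) * sinh (spread y) * sinh (gap_low y))"
    by (intro continuous_on_diff[OF b2] ci)
  then show "continuous_on ?S twist_low" by (simp add: twist_low_def[abs_def] mu_def algebra_simps)
  have "continuous_on ?S (\<lambda>y. inverse (sinh (2 * spread y)) * (cosh (2 * spread y - gap_high y) - cosh (gap_low y)))"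
  proof (rule continuous_on_singular_product[where b = "\<lambda>t. cosh (2 * t) - 1"
        and r = "\<lambda>t. inverse (sinh (2 * t))" and c = spread])
    show "((\<lambda>t::real. inverse (sinh (2 * t)) * (cosh (2 * t) - 1)) \<longlongrightarrow> 0) (at_right 0)"
      unfolding cosh_def sinh_def by simp real_asymp
    fix y assume "y \<in> ?S"
    then have o: "ordered y" by simp
    note g = ordered_gaps[OF o]
    have "1 \<le> cosh (gap_low y)" by (simp add: cosh_real_ge_1)
    moreover have "cosh (gap_low y) \<le> cosh (2 * spread y - gap_high y)"
      "cosh (2 * spread y - gap_high y) \<le> cosh (2 * spread y)" using g by (auto intro!: cosh_mono_nonneg)
    ultimately show "\<bar>cosh (2 * spread y - gap_high y) - cosh (gap_low y)\<bar> \<le> cosh (2 * spread y) - 1" by linarith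
  qed (auto intro!: ci simp: ordered_gaps)
  then show "continuous_on ?S pair_defect" by (simp add: pair_defect_def[abs_def] divide_inverse mult.commute)
qed

lemma gaps_linear: "bounded_linear gap_low" "bounded_linear gap_high" "bounded_linear spread"
  unfolding gap_low_def[abs_def] gap_high_def[abs_def] spread_def[abs_def]
  by (auto simp flip: linear_conv_bounded_linear intro!: linearI simp: algebra_simps add_divide_distrib diff_divide_distrib)

lemmas gaps_derivative =
  gaps_linear[THEN bounded_linear_imp_has_derivative]

text \<open>Partial derivatives of \<open>U_chamber\<close> by the chain rule.\<close>

definition grad_chamber :: "4 \<Rightarrow> real^4 \<Rightarrow> real" where
  "grad_chamber k y = (if k = 1 then - slope_spread y - 2 * slope_low y else if k = 2 then - slope_spread y + 2 * slope_low y
     else if k = 3 then slope_spread y - 2 * slope_high y else 4 + slope_spread y + 2 * slope_high y) / 4"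

definition low :: "4 \<Rightarrow> bool" where "low k \<longleftrightarrow> k = 1 \<or> k = 2"

text \<open>The Hessian is described by its values on indicator vectors: \<open>single_curv\<close> on single coordinates
  and \<open>pair_curv\<close> on pairs, up to the factor \<open>\<surd>2 / 8\<close>. All pairs have the curvature of the comb except the two lowest and
  the two highest coordinates. An off-diagonal entry is recovered by polarization. In this form
  the behaviour under permutations of equal coordinates is visible.\<close>

definition single_curv :: "4 \<Rightarrow> real^4 \<Rightarrow> real" where
  "single_curv k y = curv_high y + curv_low y - pair_defect y + 4 * (if low k then curv_low y else curv_high y)
     + (if k = 1 then - 4 * twist_low y else if k = 2 then 4 * twist_low y
        else if k = 3 then - 4 * twist_high y else 4 * twist_high y)"

definition pair_curv :: "4 \<Rightarrow> 4 \<Rightarrow> real^4 \<Rightarrow> real" where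
  "pair_curv k l y = 4 * (curv_high y + curv_low y - (if low k = low l then pair_defect y else 0))"

definition hess_scaled :: "4 \<Rightarrow> 4 \<Rightarrow> real^4 \<Rightarrow> real" where
  "hess_scaled k l y = (if k = l then single_curv k y
     else (pair_curv k l y - single_curv k y - single_curv l y) / 2)"

definition hess_chamber :: "4 \<Rightarrow> 4 \<Rightarrow> real^4 \<Rightarrow> real" where
  "hess_chamber k l y = sqrt 2 / 8 * hess_scaled k l y"

lemma chamber_derivatives:
  assumes "strictly_ordered y"
  shows U_chamber_derivative: "(U_chamber has_derivative (\<lambda>h. \<Sum>j\<in>UNIV. grad_chamber j y * h $ j)) (at y)"
    and slope_spread_derivative: "(slope_spread has_derivative (\<lambda>h. (curv_high y + curv_low y - pair_defect y) * spread h + twist_high y * gap_high h - twist_low y * gap_low h)) (at y)"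
    and slope_high_derivative: "(slope_high has_derivative (\<lambda>h. twist_high y * spread h + curv_high y * gap_high h)) (at y)"
    and slope_low_derivative: "(slope_low has_derivative (\<lambda>h. curv_low y * gap_low h - twist_low y * spread h)) (at y)"
proof -
  note c = strictly_ordered_spread_pos[OF assms]
  have h: "(cosh has_real_derivative sinh x) (at x)" "(sinh has_real_derivative cosh x) (at x)" for x :: real
    by (auto intro!: derivative_eq_intros)
  have v: "((\<lambda>y. y $ 4) has_derivative (\<lambda>h. h $ 4)) (at y)" 
    by (rule bounded_linear_imp_has_derivative) (rule bounded_linear_vec_nth)
  note d = v
    DERIV_compose_FDERIV[OF kap_deriv[OF c] gaps_derivative(3)]
    DERIV_compose_FDERIV[OF nu_deriv[OF c] gaps_derivative(3)]
    DERIV_compose_FDERIV[OF lam_deriv[OF c] gaps_derivative(3)]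
    DERIV_compose_FDERIV[OF mu_deriv[OF c] gaps_derivative(3)]
    DERIV_compose_FDERIV[OF h(1) gaps_derivative(1)]
    DERIV_compose_FDERIV[OF h(1) gaps_derivative(2)]
    DERIV_compose_FDERIV[OF h(2) gaps_derivative(1)]
    DERIV_compose_FDERIV[OF h(2) gaps_derivative(2)]
  show "(U_chamber has_derivative (\<lambda>h. \<Sum>j\<in>UNIV. grad_chamber j y * h $ j)) (at y)"
    unfolding U_chamber_def[abs_def]
  proof (rule has_derivative_eq_rhs, (rule d derivative_intros)+, rule ext)
    fix h :: "real^4"
    have q: "sqrt 2 * (sqrt 2 * z) = 2 * z" for z :: real by (simp flip: mult.assoc)
    have s: "sqrt 2 / 4 * gap_high h = (h $ 4 - h $ 3) / 2" "sqrt 2 / 4 * gap_low h = (h $ 2 - h $ 1) / 2"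
      "sqrt 2 / 4 * spread h = (h $ 3 + h $ 4 - h $ 1 - h $ 2) / 4"
      by (simp_all add: gap_low_def gap_high_def spread_def q)
    show "h $ 4 + sqrt 2 / 4 *
          (kap (spread y) * (gap_high h * sinh (gap_high y)) +
           spread h * (lam (spread y) - 1) * cosh (gap_high y) - gap_high h * cosh (gap_high y) +
           (nu (spread y) * (gap_low h * sinh (gap_low y)) + spread h * - mu (spread y) * cosh (gap_low y)))
        = (\<Sum>j\<in>UNIV. grad_chamber j y * h $ j)" (is "?lhs = _")
    proof -
      have "?lhs = h $ 4 + sqrt 2 / 4 * gap_high h * slope_high y + sqrt 2 / 4 * spread h * slope_spread y + sqrt 2 / 4 * gap_low h * slope_low y"
        unfolding slope_spread_def slope_high_def slope_low_def by (simp add: field_simps)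
      also have "\<dots> = (\<Sum>j\<in>UNIV. grad_chamber j y * h $ j)"
        unfolding s sum_4 grad_chamber_def by (simp add: field_simps)
      finally show ?thesis .
    qed
  qed
  show "(slope_spread has_derivative (\<lambda>h. (curv_high y + curv_low y - pair_defect y) * spread h + twist_high y * gap_high h - twist_low y * gap_low h)) (at y)"
    unfolding slope_spread_def[abs_def]
  proof (rule has_derivative_eq_rhs, (rule d derivative_intros)+, rule ext)
    fix h :: "real^4"
    define S where "S = sinh (2 * spread y)"
    have S: "S \<noteq> 0" using c by (simp add: S_def)
    have D: "pair_defect y = cosh (2 * spread y) / S * cosh (gap_high y) - sinh (gap_high y) - 1 / S * cosh (gap_low y)"
      using S by (simp add: pair_defect_def cosh_diff S_def[symmetric] diff_divide_distrib)
    show "(lam (spread y) - 1) * (gap_high h * sinh (gap_high y)) +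
         (spread h * (kap (spread y) - cosh (2 * spread y) / sinh (2 * spread y)) - 0) * cosh (gap_high y) -
         (mu (spread y) * (gap_low h * sinh (gap_low y)) +
          spread h * (- nu (spread y) - 1 / sinh (2 * spread y)) * cosh (gap_low y))
       = (curv_high y + curv_low y - pair_defect y) * spread h + twist_high y * gap_high h - twist_low y * gap_low h"
      unfolding D curv_high_def curv_low_def twist_high_def twist_low_def S_def[symmetric] by (simp add: algebra_simps)
  qed
  show "(slope_high has_derivative (\<lambda>h. twist_high y * spread h + curv_high y * gap_high h)) (at y)"
    unfolding slope_high_def[abs_def]
    by (rule has_derivative_eq_rhs, (rule d derivative_intros)+, rule ext)
      (simp add: twist_high_def curv_high_def algebra_simps)
  show "(slope_low has_derivative (\<lambda>h. curv_low y * gap_low h - twist_low y * spread h)) (at y)"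
    unfolding slope_low_def[abs_def]
    by (rule has_derivative_eq_rhs, (rule d derivative_intros)+, rule ext)
      (simp add: curv_low_def twist_low_def algebra_simps)
qed

lemma grad_chamber_derivative:
  assumes "strictly_ordered y"
  shows "(grad_chamber k has_derivative (\<lambda>h. \<Sum>j\<in>UNIV. hess_chamber k j y * h $ j)) (at y)"
proof -
  note d = chamber_derivatives(2-4)[OF assms]
  note H = hess_chamber_def hess_scaled_def single_curv_def pair_curv_def low_def sum_4
  note s = gap_low_def gap_high_def spread_def
  consider "k = 1" | "k = 2" | "k = 3" | "k = 4" using exhaust_4 by blast
  then show ?thesis
  proof cases
    case 1
    have "((\<lambda>y. 1 / 4 * (- slope_spread y - 2 * slope_low y)) has_derivative (\<lambda>h. \<Sum>j\<in>UNIV. hess_chamber 1 j y * h $ j)) (at y)"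
      by (rule has_derivative_eq_rhs, (rule d derivative_intros)+, rule ext)
        (simp add: H s field_simps)
    then show ?thesis by (simp add: 1 grad_chamber_def[abs_def])
  next
    case 2
    have "((\<lambda>y. 1 / 4 * (- slope_spread y + 2 * slope_low y)) has_derivative (\<lambda>h. \<Sum>j\<in>UNIV. hess_chamber 2 j y * h $ j)) (at y)"
      by (rule has_derivative_eq_rhs, (rule d derivative_intros)+, rule ext)
        (simp add: H s field_simps)
    then show ?thesis by (simp add: 2 grad_chamber_def[abs_def])
  next
    case 3
    have "((\<lambda>y. 1 / 4 * (slope_spread y - 2 * slope_high y)) has_derivative (\<lambda>h. \<Sum>j\<in>UNIV. hess_chamber 3 j y * h $ j)) (at y)"
      by (rule has_derivative_eq_rhs, (rule d derivative_intros)+, rule ext)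
        (simp add: H s field_simps)
    then show ?thesis by (simp add: 3 grad_chamber_def[abs_def])
  next
    case 4
    have "((\<lambda>y. 1 / 4 * (4 + slope_spread y + 2 * slope_high y)) has_derivative (\<lambda>h. \<Sum>j\<in>UNIV. hess_chamber 4 j y * h $ j)) (at y)"
      by (rule has_derivative_eq_rhs, (rule d derivative_intros)+, rule ext)
        (simp add: H s field_simps)
    then show ?thesis by (simp add: 4 grad_chamber_def[abs_def])
  qed
qed

lemma grad_chamber_hess_chamber_continuous:
  "continuous_on {y. ordered y} (grad_chamber k)" "continuous_on {y. ordered y} (hess_chamber k l)"
proof -
  have i: "continuous_on S (\<lambda>x. if b then f x else g x)"
    if "continuous_on S f" "continuous_on S g" for S b and f g :: "real^4 \<Rightarrow> real" using that by (cases b) auto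
  show "continuous_on {y. ordered y} (grad_chamber k)"
    unfolding grad_chamber_def[abs_def] by (intro i continuous_intros chamber_continuous) auto
  show "continuous_on {y. ordered y} (hess_chamber k l)"
    unfolding hess_chamber_def[abs_def] hess_scaled_def single_curv_def pair_curv_def
    by (intro i continuous_intros chamber_continuous) auto
qed

lemma wall_low: "y $ 1 = y $ 2 \<Longrightarrow> gap_low y = 0" by (simp add: gap_low_def)
lemma wall_high: "y $ 3 = y $ 4 \<Longrightarrow> gap_high y = 0" by (simp add: gap_high_def)
lemma wall_middle: "y $ 2 = y $ 3 \<Longrightarrow> gap_low y + gap_high y = 2 * spread y"
  by (simp add: spread_decomp)

text \<open>At the walls of the chamber the data attached to two merging coordinates coincide. For the outer
  walls a gap vanishes together with its hyperbolic sine; for the middle wall this is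
  \<open>wall_identities\<close>.\<close>

lemma wall_matching:
  "y $ 1 = y $ 2 \<Longrightarrow> grad_chamber 1 y = grad_chamber 2 y \<and> single_curv 1 y = single_curv 2 y"
  "y $ 2 = y $ 3 \<Longrightarrow> grad_chamber 2 y = grad_chamber 3 y \<and> single_curv 2 y = single_curv 3 y \<and> pair_defect y = 0"
  "y $ 3 = y $ 4 \<Longrightarrow> grad_chamber 3 y = grad_chamber 4 y \<and> single_curv 3 y = single_curv 4 y"
proof -
  show "y $ 1 = y $ 2 \<Longrightarrow> grad_chamber 1 y = grad_chamber 2 y \<and> single_curv 1 y = single_curv 2 y"
    by (simp add: grad_chamber_def single_curv_def low_def slope_low_def twist_low_def wall_low)
  show "y $ 3 = y $ 4 \<Longrightarrow> grad_chamber 3 y = grad_chamber 4 y \<and> single_curv 3 y = single_curv 4 y"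
    by (simp add: grad_chamber_def single_curv_def low_def slope_high_def twist_high_def wall_high)
  assume "y $ 2 = y $ 3"
  note w = wall_identities[OF wall_middle[OF this]]
  have "2 * spread y - gap_high y = gap_low y" using wall_middle[OF \<open>y $ 2 = y $ 3\<close>] by linarith
  then have D: "pair_defect y = 0" by (simp add: pair_defect_def)
  have "grad_chamber 3 y - grad_chamber 2 y = ((lam (spread y) * cosh (gap_high y) - kap (spread y) * sinh (gap_high y))
      - (mu (spread y) * cosh (gap_low y) + nu (spread y) * sinh (gap_low y))) / 2"
    by (simp add: grad_chamber_def slope_spread_def slope_high_def slope_low_def field_simps)
  moreover have "single_curv 3 y - single_curv 2 y = 4 * ((kap (spread y) * cosh (gap_high y) - lam (spread y) * sinh (gap_high y))
      - (nu (spread y) * cosh (gap_low y) + mu (spread y) * sinh (gap_low y)))"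
    by (simp add: single_curv_def low_def curv_high_def curv_low_def twist_high_def twist_low_def field_simps)
  ultimately show "grad_chamber 2 y = grad_chamber 3 y \<and> single_curv 2 y = single_curv 3 y \<and> pair_defect y = 0"
    using w D by simp
qed

lemma ordered_value_matching:
  assumes "ordered y" "y $ k = y $ l"
  shows "grad_chamber k y = grad_chamber l y" "single_curv k y = single_curv l y"
proof -
  have o: "y $ 1 \<le> y $ 2" "y $ 2 \<le> y $ 3" "y $ 3 \<le> y $ 4" using assms(1) by (auto simp: ordered_def)
  have "grad_chamber k y = grad_chamber l y \<and> single_curv k y = single_curv l y"
    using exhaust_4[of k] exhaust_4[of l] assms(2) o wall_matching[of y]
    by (elim disjE; force)
  then show "grad_chamber k y = grad_chamber l y" "single_curv k y = single_curv l y" by auto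
qed

section \<open>Permutations and equivariant extension\<close>

definition permute :: "(4 \<Rightarrow> 4) \<Rightarrow> real^4 \<Rightarrow> real^4" where
  "permute \<pi> x = (\<chi> i. x $ \<pi> i)"

lemma permute_nth [simp]: "permute \<pi> x $ i = x $ \<pi> i" by (simp add: permute_def)

text \<open>A family indexed by pairs of coordinates that is invariant under the permutations fixing the
  ordered point. This is the condition for an equivariant extension from the chamber to the whole
  space.\<close>

definition compatible :: "(4 \<Rightarrow> 4 \<Rightarrow> real^4 \<Rightarrow> real) \<Rightarrow> bool" where
  "compatible F \<longleftrightarrow> (\<forall>y \<tau> k l. ordered y \<longrightarrow> bij \<tau> \<longrightarrow> permute \<tau> y = y \<longrightarrow> F (\<tau> k) (\<tau> l) y = F k l y)"

lemma low_permute: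
  assumes "ordered y" "y $ 2 < y $ 3" "permute \<tau> y = y"
  shows "low (\<tau> k) = low k"
proof -
  have e: "y $ \<tau> k = y $ k" using assms(3) by (metis permute_nth)
  have o: "y $ 1 \<le> y $ 2" "y $ 3 \<le> y $ 4" using assms(1) by (auto simp: ordered_def)
  show ?thesis
    using exhaust_4[of k] exhaust_4[of "\<tau> k"] e o assms(2)
    by (elim disjE) (auto simp: low_def)
qed

lemma compatible_U_chamber: "compatible (\<lambda>k l. U_chamber)"
  by (simp add: compatible_def)

lemma compatible_grad_chamber: "compatible (\<lambda>k l. grad_chamber k)" "compatible (\<lambda>k l. grad_chamber l)"
  unfolding compatible_def by (metis ordered_value_matching(1) permute_nth)+

lemma compatible_hess_chamber: "compatible hess_chamber"
  unfolding compatible_def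
proof (intro allI impI)
  fix y \<tau> and k l :: 4
  assume y: "ordered y" and \<tau>: "bij \<tau>" "permute \<tau> y = y"
  have s: "single_curv (\<tau> k) y = single_curv k y" for k
    using y \<tau> by (metis ordered_value_matching(2) permute_nth)
  have p: "pair_curv (\<tau> k) (\<tau> l) y = pair_curv k l y"
  proof (cases "y $ 2 = y $ 3")
    case True
    then show ?thesis using wall_matching(2)[of y] by (simp add: pair_curv_def)
  next
    case False
    then have "y $ 2 < y $ 3" using y by (simp add: ordered_def)
    then show ?thesis using low_permute[OF y _ \<tau>(2)] by (simp add: pair_curv_def)
  qed
  have "\<tau> k = \<tau> l \<longleftrightarrow> k = l" using \<tau>(1) by (simp add: bij_def inj_eq)
  then show "hess_chamber (\<tau> k) (\<tau> l) y = hess_chamber k l y" by (simp add: hess_chamber_def hess_scaled_def s p)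
qed

lemma mset_permute:
  fixes x :: "real^4" and \<pi> :: "4 \<Rightarrow> 4"
  assumes "bij \<pi>"
  shows "mset [x $ \<pi> 1, x $ \<pi> 2, x $ \<pi> 3, x $ \<pi> 4] = mset [x $ 1, x $ 2, x $ 3, x $ (4::4)]"
proof -
  have m: "mset [f 1, f 2, f 3, f 4] = image_mset f (mset_set (UNIV :: 4 set))" for f :: "4 \<Rightarrow> real"
    unfolding UNIV_4 by simp
  have i: "inj_on \<pi> UNIV" "\<pi> ` UNIV = UNIV" using assms by (auto simp: bij_def)
  have "mset [x $ \<pi> 1, x $ \<pi> 2, x $ \<pi> 3, x $ \<pi> 4] = image_mset (\<lambda>i. x $ \<pi> i) (mset_set (UNIV :: 4 set))"
    by (rule m)
  also have "\<dots> = image_mset (($) x) (image_mset \<pi> (mset_set UNIV))" by (simp add: image_mset.compositionality o_def)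
  also have "image_mset \<pi> (mset_set UNIV) = mset_set UNIV" using image_mset_mset_set[OF i(1)] i(2) by simp
  also have "image_mset (($) x) (mset_set UNIV) = mset [x $ 1, x $ 2, x $ 3, x $ 4]" by (rule m[symmetric])
  finally show ?thesis .
qed

lemma ranked_permute:
  assumes "bij \<pi>" shows "ranked (permute \<pi> x) k = ranked x k"
proof -
  have "sort [permute \<pi> x $ 1, permute \<pi> x $ 2, permute \<pi> x $ 3, permute \<pi> x $ 4]
      = sort [x $ 1, x $ 2, x $ 3, x $ 4]"
    using mset_permute[OF assms, of x] by (intro properties_for_sort) auto
  then show ?thesis by (simp add: ranked_def)
qed

lemma ranked_ordered:
  assumes "ordered y"
  shows "ranked y 1 = y $ 1" "ranked y 2 = y $ 2" "ranked y 3 = y $ 3" "ranked y 4 = y $ 4"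
proof -
  have "sort [y $ 1, y $ 2, y $ 3, y $ 4] = [y $ 1, y $ 2, y $ 3, y $ 4]"
    using assms by (intro sorted_sort_id) (auto simp: ordered_def)
  then show "ranked y 1 = y $ 1" "ranked y 2 = y $ 2" "ranked y 3 = y $ 3" "ranked y 4 = y $ 4"
    unfolding ranked_def by (simp_all add: numeral_eq_Suc)
qed

lemma ordered_rearrangement_unique:
  assumes "bij \<sigma>" "bij \<pi>" "ordered (permute \<sigma> x)" "ordered (permute \<pi> x)"
  shows "permute \<sigma> x = permute \<pi> x"
proof -
  have "permute \<sigma> x $ k = permute \<pi> x $ k" for k
    using exhaust_4[of k] ranked_ordered[OF assms(3)] ranked_ordered[OF assms(4)]
    unfolding ranked_permute[OF assms(1)] ranked_permute[OF assms(2)] by metis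
  then show ?thesis by (simp add: vec_eq_iff)
qed

lemma ordering_permutation_exists: "\<exists>\<pi>. bij \<pi> \<and> ordered (permute \<pi> x)"
proof -
  define xs where "xs = sort_key (($) x) [1, 2, 3, 4 :: 4]"
  have xs: "length xs = 4" "set xs = UNIV" "sorted (map (($) x) xs)"
    by (auto simp: xs_def UNIV_4 sorted_sort_key simp del: sort_key_simps)
  then obtain a b c d where abcd: "xs = [a, b, c, d]"
    by (auto simp: numeral_eq_Suc length_Suc_conv)
  define \<pi> :: "4 \<Rightarrow> 4" where "\<pi> = (\<lambda>k. if k = 1 then a else if k = 2 then b else if k = 3 then c else d)"
  have v: "\<pi> 1 = a" "\<pi> 2 = b" "\<pi> 3 = c" "\<pi> 4 = d" by (auto simp: \<pi>_def)
  have "range \<pi> = UNIV" using xs(2) unfolding UNIV_4 image_insert v abcd by simp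
  then have "bij \<pi>" by (simp add: bij_def finite_UNIV_surj_inj)
  moreover have "ordered (permute \<pi> x)" using xs(3) by (simp add: ordered_def v abcd)
  ultimately show ?thesis by blast
qed

text \<open>Ties make the sorting permutation ambiguous; an arbitrary choice is made, and \<open>compatible\<close>
  ensures that it does not matter.\<close>

definition sorter :: "real^4 \<Rightarrow> 4 \<Rightarrow> 4" where
  "sorter x = (SOME \<pi>. bij \<pi> \<and> ordered (permute \<pi> x))"

lemma sorter: "bij (sorter x)" "ordered (permute (sorter x) x)"
  using someI_ex[OF ordering_permutation_exists[of x]] by (auto simp: sorter_def)

text \<open>The equivariant extension of chamber data. Scalars, vectors and matrices are all covered by
  families with two indices, of which one or both may be ignored.\<close>

definition lift :: "(4 \<Rightarrow> 4 \<Rightarrow> real^4 \<Rightarrow> real) \<Rightarrow> 4 \<Rightarrow> 4 \<Rightarrow> real^4 \<Rightarrow> real" where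
  "lift F i j x = F (inv (sorter x) i) (inv (sorter x) j) (permute (sorter x) x)"

lemma lift_eq:
  assumes "compatible F" "bij \<pi>" "ordered (permute \<pi> x)"
  shows "lift F (\<pi> k) (\<pi> l) x = F k l (permute \<pi> x)"
proof -
  define \<sigma> where "\<sigma> = sorter x"
  have \<sigma>: "bij \<sigma>" "ordered (permute \<sigma> x)" using sorter by (auto simp: \<sigma>_def)
  have e: "permute \<sigma> x = permute \<pi> x" by (rule ordered_rearrangement_unique) fact+
  define \<tau> where "\<tau> = inv \<sigma> \<circ> \<pi>"
  have "bij \<tau>" unfolding \<tau>_def using \<sigma> assms(2) by (intro bij_comp bij_imp_bij_inv)
  moreover have "permute \<tau> (permute \<sigma> x) = permute \<sigma> x"
  proof -
    have "permute \<tau> (permute \<sigma> x) = permute \<pi> x"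
      unfolding vec_eq_iff \<tau>_def using \<sigma>(1) by (simp add: bij_def surj_f_inv_f)
    then show ?thesis by (simp add: e)
  qed
  ultimately have "F (\<tau> k) (\<tau> l) (permute \<sigma> x) = F k l (permute \<sigma> x)"
    using assms(1) \<sigma>(2) by (simp add: compatible_def)
  then show ?thesis by (simp add: lift_def \<tau>_def e flip: \<sigma>_def)
qed

lemma permute_bounded_linear: "bounded_linear (permute \<pi>)"
  unfolding linear_conv_bounded_linear[symmetric]
  by (intro linearI) (simp_all add: vec_eq_iff)

lemma lift_permute:
  assumes "compatible F" "bij p"
  shows "lift F i j (permute p x) = lift F (p i) (p j) x"
proof -
  define \<sigma> where "\<sigma> = sorter (permute p x)"
  have \<sigma>: "bij \<sigma>" "ordered (permute \<sigma> (permute p x))" using sorter by (auto simp: \<sigma>_def)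
  have e: "permute \<sigma> (permute p x) = permute (p \<circ> \<sigma>) x" by (simp add: vec_eq_iff)
  obtain k l where k: "i = \<sigma> k" "j = \<sigma> l" using \<sigma>(1) by (metis bij_pointE)
  have "lift F (\<sigma> k) (\<sigma> l) (permute p x) = F k l (permute (p \<circ> \<sigma>) x)"
    using lift_eq[OF assms(1) \<sigma>] e by simp
  also have "\<dots> = lift F ((p \<circ> \<sigma>) k) ((p \<circ> \<sigma>) l) x"
    using lift_eq[OF assms(1), of "p \<circ> \<sigma>" x] \<sigma> assms(2) e by (simp add: bij_comp)
  finally show ?thesis by (simp add: k)
qed

lemma closed_ordered: "closed {y. ordered y}"
  unfolding ordered_def by (intro closed_Collect_conj closed_Collect_le continuous_intros)

lemma open_strictly_ordered: "open {y. strictly_ordered y}"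
  unfolding strictly_ordered_def by (intro open_Collect_conj open_Collect_less continuous_intros)

lemma continuous_permute: "continuous_on S (permute \<pi>)"
  using permute_bounded_linear by (rule linear_continuous_on)

text \<open>The space is a finite union of closed cones on which a fixed permutation sorts the point, and
  on each of them the extension is a composition of continuous maps.\<close>

lemma lift_continuous:
  assumes "compatible F" "\<And>k l. continuous_on {y. ordered y} (F k l)"
  shows "continuous_on UNIV (lift F i j)"
proof -
  define K where "K \<pi> = permute \<pi> -` {y. ordered y}" for \<pi>
  have "continuous_on (\<Union>\<pi>\<in>{\<pi>. bij \<pi>}. K \<pi>) (lift F i j)"
  proof (rule continuous_on_closed_Union)
    show "finite {\<pi> :: 4 \<Rightarrow> 4. bij \<pi>}" by (rule finite)
    fix \<pi> :: "4 \<Rightarrow> 4" assume "\<pi> \<in> {\<pi>. bij \<pi>}"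
    then have \<pi>: "bij \<pi>" by simp
    show "closed (K \<pi>)" unfolding K_def
      by (rule continuous_closed_vimage[OF closed_ordered])
        (use continuous_permute[of UNIV \<pi>] in \<open>simp add: continuous_on_eq_continuous_at\<close>)
    obtain k l where k: "i = \<pi> k" "j = \<pi> l" using \<pi> by (metis bij_pointE)
    have "continuous_on (K \<pi>) (\<lambda>x. F k l (permute \<pi> x))"
      by (rule continuous_on_compose2[OF assms(2) continuous_permute]) (auto simp: K_def)
    moreover have "lift F i j x = F k l (permute \<pi> x)" if "x \<in> K \<pi>" for x
      using lift_eq[OF assms(1) \<pi>] that unfolding k K_def by simp
    ultimately show "continuous_on (K \<pi>) (lift F i j)" by (simp cong: continuous_on_cong)
  qed
  moreover have "(\<Union>\<pi>\<in>{\<pi>. bij \<pi>}. K \<pi>) = UNIV"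
    using ordering_permutation_exists by (auto simp: K_def)
  ultimately show ?thesis by simp
qed

section \<open>Derivatives across the hyperplanes of equal coordinates\<close>

definition generic :: "real^4 \<Rightarrow> bool" where "generic x \<longleftrightarrow> inj (\<lambda>i. x $ i)"

lemma lift_derivative_generic:
  assumes F: "compatible F" and D: "compatible D"
    and der: "\<And>k y. strictly_ordered y \<Longrightarrow> (F k k has_derivative (\<lambda>h. \<Sum>j\<in>UNIV. D k j y * h $ j)) (at y)"
    and x: "generic x"
  shows "(lift F i i has_derivative (\<lambda>h. \<Sum>j\<in>UNIV. lift D i j x * h $ j)) (at x)"
proof -
  define \<pi> where "\<pi> = sorter x"
  have \<pi>: "bij \<pi>" "ordered (permute \<pi> x)" using sorter by (auto simp: \<pi>_def)
  have inj: "x $ \<pi> k \<noteq> x $ \<pi> l" if "k \<noteq> l" for k l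
    using x \<pi>(1) that by (auto simp: generic_def inj_def bij_def)
  have s: "strictly_ordered (permute \<pi> x)"
    using \<pi>(2) inj by (simp add: strictly_ordered_def ordered_def less_le)
  obtain k where k: "i = \<pi> k" using \<pi>(1) by (metis bij_pointE)
  have "((\<lambda>x. F k k (permute \<pi> x)) has_derivative (\<lambda>h. \<Sum>j\<in>UNIV. D k j (permute \<pi> x) * permute \<pi> h $ j)) (at x)"
    by (rule has_derivative_compose[OF bounded_linear_imp_has_derivative[OF permute_bounded_linear] der[OF s]])
  also have "(\<lambda>h. \<Sum>j\<in>UNIV. D k j (permute \<pi> x) * permute \<pi> h $ j) = (\<lambda>h. \<Sum>j\<in>UNIV. lift D i j x * h $ j)"
  proof
    fix h :: "real^4"
    have "(\<Sum>j\<in>UNIV. D k j (permute \<pi> x) * permute \<pi> h $ j) = (\<Sum>j\<in>UNIV. lift D i (\<pi> j) x * h $ \<pi> j)"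
      unfolding k lift_eq[OF D \<pi>] by simp
    also have "\<dots> = (\<Sum>j\<in>UNIV. lift D i j x * h $ j)"
      by (rule sum.reindex_bij_betw[OF \<pi>(1), of "\<lambda>j. lift D i j x * h $ j"])
    finally show "(\<Sum>j\<in>UNIV. D k j (permute \<pi> x) * permute \<pi> h $ j) = (\<Sum>j\<in>UNIV. lift D i j x * h $ j)" .
  qed
  finally show ?thesis
  proof (rule has_derivative_transform_within_open)
    show "open (permute \<pi> -` {y. strictly_ordered y})"
      by (rule continuous_open_vimage[OF open_strictly_ordered])
        (use continuous_permute[of UNIV \<pi>] in \<open>simp add: continuous_on_eq_continuous_at\<close>)
    show "x \<in> permute \<pi> -` {y. strictly_ordered y}" using s by simp
    fix z assume "z \<in> permute \<pi> -` {y. strictly_ordered y}"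
    then have "ordered (permute \<pi> z)" by (simp add: strictly_ordered_imp_ordered)
    then show "F k k (permute \<pi> z) = lift F i i z"
      using lift_eq[OF F \<pi>(1)] by (simp add: k)
  qed
qed

text \<open>Any direction with distinct coordinates would do: moving along it by a small amount separates
  equal coordinates.\<close>

definition ramp :: "real^4" where
  "ramp = (\<chi> i. if i = 1 then 1 else if i = 2 then 2 else if i = 3 then 3 else 4)"

lemma generic_nearby: "\<forall>\<^sub>F t in at_right 0. generic (y + t *\<^sub>R ramp)"
proof -
  define v :: "real^4" where "v = ramp"
  have v: "v $ 1 = 1" "v $ 2 = 2" "v $ 3 = 3" "v $ 4 = 4" by (auto simp: v_def ramp_def)
  have vij: "v $ i \<noteq> v $ j" if "i \<noteq> j" for i j
    using that exhaust_4[of i] exhaust_4[of j] v by auto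
  have "\<forall>\<^sub>F t in at_right 0. i \<noteq> j \<longrightarrow> y $ i + t * v $ i \<noteq> y $ j + t * v $ j" for i j
  proof (cases "i = j")
    case False
    show ?thesis
    proof (cases "y $ i = y $ j")
      case True
      have "\<forall>\<^sub>F t in at_right (0::real). 0 < t" by (simp add: eventually_at_right_less)
      then show ?thesis by eventually_elim (use True vij[OF False] in auto)
    next
      case ne: False
      have "((\<lambda>t. (y $ i + t * v $ i) - (y $ j + t * v $ j)) \<longlongrightarrow> (y $ i + 0 * v $ i) - (y $ j + 0 * v $ j)) (at_right 0)"
        by (intro tendsto_intros)
      then have "\<forall>\<^sub>F t in at_right 0. (y $ i + t * v $ i) - (y $ j + t * v $ j) \<noteq> 0"
        using ne by (intro tendsto_imp_eventually_ne) auto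
      then show ?thesis by eventually_elim simp
    qed
  qed simp
  then have "\<forall>\<^sub>F t in at_right 0. \<forall>i j. i \<noteq> j \<longrightarrow> y $ i + t * v $ i \<noteq> y $ j + t * v $ j"
    by (simp add: eventually_all_finite)
  then show ?thesis
    by eventually_elim (auto simp: generic_def inj_def v_def)
qed

lemma generic_on_segment:
  assumes "generic y"
  shows "finite {s. \<not> generic (x + s *\<^sub>R (y - x))}"
proof -
  have "{s. \<not> generic (x + s *\<^sub>R (y - x))} \<subseteq>
     (\<Union>(i, j)\<in>{(i, j). i \<noteq> j}. {s. x $ i + s * (y $ i - x $ i) = x $ j + s * (y $ j - x $ j)})"
    by (auto simp: generic_def inj_def)
  moreover have "finite {s. x $ i + s * (y $ i - x $ i) = x $ j + s * (y $ j - x $ j)}" if "i \<noteq> j" for i j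
  proof -
    have ne: "y $ i \<noteq> y $ j" using assms that by (auto simp: generic_def inj_def)
    define a b where "a = x $ i - x $ j" and "b = y $ i - y $ j"
    have "{s. x $ i + s * (y $ i - x $ i) = x $ j + s * (y $ j - x $ j)} \<subseteq> {a / (a - b)}"
    proof
      fix s assume "s \<in> {s. x $ i + s * (y $ i - x $ i) = x $ j + s * (y $ j - x $ j)}"
      then have "a = s * (a - b)" by (simp add: a_def b_def algebra_simps)
      moreover have "a - b \<noteq> 0" using ne calculation by (auto simp: b_def a_def)
      ultimately show "s \<in> {a / (a - b)}" by (simp add: field_simps)
    qed
    then show ?thesis by (rule finite_subset) simp
  qed
  ultimately show ?thesis by (rule_tac finite_subset) auto
qed

text \<open>Derivatives that extend continuously across the hyperplanes are derivatives there as well. If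
  \<open>y\<close> is generic, the segment from \<open>x\<close> to \<open>y\<close> meets the hyperplanes only finitely often, and the
  fundamental theorem of calculus bounds the increment. For the remaining \<open>y\<close> the bound
  follows from density of generic points.\<close>

lemma has_derivative_from_generic:
  fixes f :: "real^4 \<Rightarrow> real" and D :: "4 \<Rightarrow> real^4 \<Rightarrow> real"
  assumes f: "continuous_on UNIV f" and D: "\<And>j. continuous_on UNIV (D j)"
    and der: "\<And>x. generic x \<Longrightarrow> (f has_derivative (\<lambda>h. \<Sum>j\<in>UNIV. D j x * h $ j)) (at x)"
  shows "(f has_derivative (\<lambda>h. \<Sum>j\<in>UNIV. D j x * h $ j)) (at x)"
proof -
  define L where "L z h = (\<Sum>j\<in>UNIV. D j z * h $ j)" for z h
  have Llin: "bounded_linear (L z)" for z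
    unfolding L_def linear_conv_bounded_linear[symmetric]
    by (intro linearI) (simp_all add: sum.distrib sum_distrib_left algebra_simps)
  have "(f has_derivative L x) (at x)"
    unfolding has_derivative_within_alt
  proof (intro conjI Llin allI impI)
    fix e :: real assume e: "0 < e"
    have "\<forall>j. \<exists>d>0. \<forall>z. dist z x < d \<longrightarrow> \<bar>D j z - D j x\<bar> < e / 4"
    proof
      fix j
      have "0 < e / 4" using e by simp
      then show "\<exists>d>0. \<forall>z. dist z x < d \<longrightarrow> \<bar>D j z - D j x\<bar> < e / 4"
        using D[of j] unfolding continuous_on_iff dist_real_def by blast
    qed
    then obtain d where d: "\<And>j. d j > 0" "\<And>j z. dist z x < d j \<Longrightarrow> \<bar>D j z - D j x\<bar> < e / 4" by metis
    define r where "r = Min (range d)"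
    have r: "r > 0" "\<And>j. r \<le> d j" using d(1) by (auto simp: r_def)
    have near: "\<bar>L z h - L x h\<bar> \<le> e * norm h" if "dist z x < r" for z h
    proof -
      have "L z h - L x h = (\<Sum>j\<in>UNIV. (D j z - D j x) * h $ j)"
        by (simp add: L_def sum_subtractf algebra_simps)
      also have "\<bar>\<dots>\<bar> \<le> (\<Sum>j\<in>(UNIV :: 4 set). e / 4 * norm h)"
      proof (rule order_trans[OF sum_abs sum_mono])
        fix j :: 4
        have "dist z x < d j" using that r(2)[of j] by linarith
        then show "\<bar>(D j z - D j x) * h $ j\<bar> \<le> e / 4 * norm h"
          unfolding abs_mult using d(2)[of z j] component_le_norm_cart[of h j] e
          by (intro mult_mono) auto
      qed
      also have "\<dots> = e * norm h" by simp
      finally show ?thesis .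
    qed
    have gen: "\<bar>f y - f x - L x (y - x)\<bar> \<le> e * norm (y - x)" if y: "dist y x < r" "generic y" for y
    proof -
      define p where "p s = x + s *\<^sub>R (y - x)" for s
      define g where "g s = f (p s) - L x (p s)" for s
      have pd: "(p has_derivative (\<lambda>t. t *\<^sub>R (y - x))) (at s)" for s
        unfolding p_def by (auto intro!: derivative_eq_intros)
      have pc: "continuous_on {0..1} p" unfolding p_def by (intro continuous_intros)
      have Lt: "L z (t *\<^sub>R h) = t * L z h" for z t h
        using linear_scale[OF bounded_linear.linear[OF Llin[of z]], of t h] by simp
      have "((\<lambda>s. L (p s) (y - x) - L x (y - x)) has_integral (g 1 - g 0)) {0..1}"
      proof (rule fundamental_theorem_of_calculus_interior_strong[OF generic_on_segment[OF y(2), of x]])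
        have "continuous_on {0..1} (\<lambda>s. f (p s))"
          by (rule continuous_on_compose2[OF f pc]) simp
        moreover have "continuous_on {0..1} (\<lambda>s. L x (p s))"
          by (rule continuous_on_compose2[OF linear_continuous_on[OF Llin, of UNIV x] pc]) simp
        ultimately show "continuous_on {0..1} g" unfolding g_def by (rule continuous_on_diff)
        fix s assume "s \<in> {0<..<1} - {s. \<not> generic (x + s *\<^sub>R (y - x))}"
        then have gs: "generic (p s)" by (simp add: p_def)
        have "(f has_derivative L (p s)) (at (p s))" using der[OF gs] by (simp add: L_def[abs_def])
        from has_derivative_compose[OF pd this]
        have "((\<lambda>s. f (p s)) has_vector_derivative L (p s) (y - x)) (at s)"
          by (simp add: has_vector_derivative_def Lt)
        moreover from has_derivative_compose[OF pd bounded_linear_imp_has_derivative[OF Llin[of x]]]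
        have "((\<lambda>s. L x (p s)) has_vector_derivative L x (y - x)) (at s)"
          by (simp add: has_vector_derivative_def Lt)
        ultimately show "(g has_vector_derivative L (p s) (y - x) - L x (y - x)) (at s)"
          unfolding g_def by (rule has_vector_derivative_diff)
      qed simp
      note int = this
      have "norm (g 1 - g 0) \<le> e * norm (y - x) * measure lborel {0..1::real}"
      proof (rule has_integral_bound_real[OF _ finite.emptyI int])
        show "0 \<le> e * norm (y - x)" using e by simp
        fix s :: real assume "s \<in> {0..1} - {}"
        then have "\<bar>s\<bar> \<le> 1" by simp
        then have "norm (s *\<^sub>R (y - x)) \<le> norm (y - x)" by (simp add: mult_left_le_one_le)
        then have "dist (p s) x < r" using y(1) by (simp add: p_def dist_norm)
        then show "norm (L (p s) (y - x) - L x (y - x)) \<le> e * norm (y - x)" using near by simp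
      qed
      moreover have "g 1 - g 0 = f y - f x - L x (y - x)"
        by (simp add: g_def p_def linear_diff[OF bounded_linear.linear[OF Llin]])
      ultimately show ?thesis by simp
    qed
    show "\<exists>d>0. \<forall>y\<in>UNIV. norm (y - x) < d \<longrightarrow> norm (f y - f x - L x (y - x)) \<le> e * norm (y - x)"
    proof (intro exI[of _ r] conjI ballI impI r)
      fix y assume y: "norm (y - x) < r"
      \<comment> \<open>Approach \<open>y\<close> by generic points.\<close>
      define q where "q t = y + t *\<^sub>R ramp" for t
      have q: "(q \<longlongrightarrow> y) (at_right 0)"
      proof -
        have "(q \<longlongrightarrow> y + 0 *\<^sub>R ramp) (at_right 0)" unfolding q_def by (intro tendsto_intros)
        then show ?thesis by simp
      qed
      have fq: "((\<lambda>t. f (q t)) \<longlongrightarrow> f y) (at_right 0)"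
        using f q by (simp add: continuous_on_eq_continuous_at isCont_tendsto_compose)
      have "((\<lambda>t. L x (q t - x)) \<longlongrightarrow> L x (y - x)) (at_right 0)"
        by (intro bounded_linear.tendsto[OF Llin] tendsto_intros q)
      from tendsto_norm[OF tendsto_diff[OF tendsto_diff[OF fq tendsto_const] this]]
      have "((\<lambda>t. norm (f (q t) - f x - L x (q t - x))) \<longlongrightarrow> norm (f y - f x - L x (y - x))) (at_right 0)" .
      moreover have "((\<lambda>t. e * norm (q t - x)) \<longlongrightarrow> e * norm (y - x)) (at_right 0)"
        by (intro tendsto_intros q)
      moreover have "\<forall>\<^sub>F t in at_right 0. norm (f (q t) - f x - L x (q t - x)) \<le> e * norm (q t - x)"
      proof -
        have "\<forall>\<^sub>F t in at_right 0. dist (q t) x < r"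
          using order_tendstoD(2)[OF tendsto_dist[OF q tendsto_const], of x r] y by (simp add: dist_norm)
        moreover have "\<forall>\<^sub>F t in at_right 0. generic (q t)" unfolding q_def by (rule generic_nearby)
        ultimately show ?thesis by eventually_elim (use gen in simp)
      qed
      ultimately show "norm (f y - f x - L x (y - x)) \<le> e * norm (y - x)"
        by (intro tendsto_le[of "at_right 0"]) auto
    qed
  qed
  then show ?thesis by (simp add: L_def[abs_def])
qed

section \<open>The global solution and its differential equation\<close>

definition u_fun :: "real^4 \<Rightarrow> real" where "u_fun x = lift (\<lambda>k l. U_chamber) 1 1 x"
definition u_grad :: "4 \<Rightarrow> real^4 \<Rightarrow> real" where "u_grad j x = lift (\<lambda>k l. grad_chamber k) j j x"
definition u_hess :: "4 \<Rightarrow> 4 \<Rightarrow> real^4 \<Rightarrow> real" where "u_hess i j x = lift hess_chamber i j x"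

lemma u_fun_eq: "bij \<pi> \<Longrightarrow> ordered (permute \<pi> x) \<Longrightarrow> u_fun x = U_chamber (permute \<pi> x)"
  by (metis u_fun_def lift_eq[OF compatible_U_chamber] lift_def)

lemma u_grad_eq: "bij \<pi> \<Longrightarrow> ordered (permute \<pi> x) \<Longrightarrow> u_grad (\<pi> k) x = grad_chamber k (permute \<pi> x)"
  by (simp add: u_grad_def lift_eq[OF compatible_grad_chamber(1)])

lemma u_hess_eq: "bij \<pi> \<Longrightarrow> ordered (permute \<pi> x) \<Longrightarrow> u_hess (\<pi> k) (\<pi> l) x = hess_chamber k l (permute \<pi> x)"
  by (simp add: u_hess_def lift_eq[OF compatible_hess_chamber])

lemma u_fun_continuous: "continuous_on UNIV u_fun"
  unfolding u_fun_def[abs_def] by (rule lift_continuous[OF compatible_U_chamber chamber_continuous(1)])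
lemma u_grad_continuous: "continuous_on UNIV (u_grad j)"
  unfolding u_grad_def[abs_def] by (rule lift_continuous[OF compatible_grad_chamber(1) grad_chamber_hess_chamber_continuous(1)])
lemma u_hess_continuous: "continuous_on UNIV (u_hess i j)"
  unfolding u_hess_def[abs_def] by (rule lift_continuous[OF compatible_hess_chamber grad_chamber_hess_chamber_continuous(2)])

lemma u_fun_derivative: "(u_fun has_derivative (\<lambda>h. \<Sum>j\<in>UNIV. u_grad j x * h $ j)) (at x)"
proof (rule has_derivative_from_generic[OF u_fun_continuous u_grad_continuous])
  fix x assume "generic x"
  from lift_derivative_generic[OF compatible_U_chamber compatible_grad_chamber(2) U_chamber_derivative this, of 1]
  show "(u_fun has_derivative (\<lambda>h. \<Sum>j\<in>UNIV. u_grad j x * h $ j)) (at x)"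
    by (simp add: u_fun_def[abs_def] u_grad_def lift_def[abs_def])
qed

lemma u_grad_derivative: "(u_grad i has_derivative (\<lambda>h. \<Sum>j\<in>UNIV. u_hess i j x * h $ j)) (at x)"
proof (rule has_derivative_from_generic[OF u_grad_continuous u_hess_continuous])
  fix x assume "generic x"
  from lift_derivative_generic[OF compatible_grad_chamber(1) compatible_hess_chamber grad_chamber_derivative this, of i]
  show "(u_grad i has_derivative (\<lambda>h. \<Sum>j\<in>UNIV. u_hess i j x * h $ j)) (at x)"
    by (simp add: u_grad_def[abs_def] u_hess_def)
qed

lemma ordered_spread_zero:
  assumes "ordered y" "spread y = 0"
  shows "gap_low y = 0" "gap_high y = 0" "y $ 3 = y $ 2"
proof -
  note g = ordered_gaps[OF assms(1)]
  show "gap_low y = 0" "gap_high y = 0" using g assms(2) by auto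
  then show "y $ 3 = y $ 2" using spread_decomp[of y] assms(2) by simp
qed

lemma kap_0: "kap 0 = pi / 4" "nu 0 = pi / 4" "lam 0 = 0" "mu 0 = 0"
  by (simp_all add: kap_def nu_def lam_def mu_def arctan_exp_def artanh_exp_def artanh_def)

text \<open>All sign conditions in one place, including the points with vanishing spread, where
  \<open>exp (- 4 c) = 1\<close> and the series are not available but everything is explicit.\<close>

lemma chamber_inequalities:
  assumes "ordered y"
  shows "0 \<le> curv_high y" "0 \<le> curv_low y" "0 \<le> twist_high y" "0 \<le> twist_low y" "0 \<le> pair_defect y"
    "0 \<le> 3 * curv_high y - curv_low y - 4 * twist_low y" "0 \<le> 3 * curv_low y - curv_high y + pair_defect y - 4 * twist_high y"
    "curv_high y + curv_low y \<le> 2" "pair_defect y \<le> 2 * sinh (sqrt 2 * (y $ 3 - y $ 2))" "0 \<le> grad_chamber k y"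
proof -
  note g = ordered_gaps[OF assms]
  have *: "0 \<le> curv_high y \<and> 0 \<le> curv_low y \<and> 0 \<le> twist_high y \<and> 0 \<le> twist_low y \<and> 0 \<le> pair_defect y \<and>
    0 \<le> 3 * curv_high y - curv_low y - 4 * twist_low y \<and> 0 \<le> 3 * curv_low y - curv_high y + pair_defect y - 4 * twist_high y \<and>
    curv_high y + curv_low y \<le> 2 \<and> pair_defect y \<le> 2 * sinh (sqrt 2 * (y $ 3 - y $ 2)) \<and> 0 \<le> grad_chamber k y"
  proof (cases "spread y = 0")
    case True
    note z = True ordered_spread_zero[OF assms True]
    have "grad_chamber k y = 1 / 4"
      using exhaust_4[of k] by (auto simp: grad_chamber_def slope_spread_def slope_high_def slope_low_def z kap_0)
    then show ?thesis
      using pi_gt_zero pi_less_4 by (simp add: curv_high_def curv_low_def twist_high_def twist_low_def pair_defect_def z kap_0)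
  next
    case False
    then have c: "0 < spread y" using g by simp
    note ab = c g(1-3)
    have G1: "0 \<le> grad_chamber 1 y"
      using lowest_partial_nonneg[OF ab] by (simp add: grad_chamber_def slope_spread_def slope_low_def algebra_simps)
    have M: "0 \<le> slope_low y" using nu_pos[OF c] g by (simp add: slope_low_def)
    have G2: "grad_chamber 1 y \<le> grad_chamber 2 y" using M by (simp add: grad_chamber_def)
    have G3: "grad_chamber 2 y \<le> grad_chamber 3 y"
      using middle_partials_ordered[OF ab] by (simp add: grad_chamber_def slope_spread_def slope_low_def slope_high_def field_simps)
    have G4: "grad_chamber 3 y \<le> grad_chamber 4 y"
      using top_partials_ordered[OF c g(2,5)] by (simp add: grad_chamber_def slope_high_def field_simps)
    have "0 \<le> grad_chamber k y" using exhaust_4[of k] G1 G2 G3 G4 by (elim disjE) auto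
    moreover have eq: "spread y - (gap_low y + gap_high y) / 2 = sqrt 2 * (y $ 3 - y $ 2)"
      using spread_decomp[of y] by (simp add: field_simps)
    moreover have "pair_defect y \<le> 2 * sinh (sqrt 2 * (y $ 3 - y $ 2))"
      using top_pair_defect(2)[OF ab] unfolding eq pair_defect_def .
    moreover have "0 \<le> twist_high y" using lam_ge_1[OF c] g(2) by (simp add: twist_high_def)
    ultimately show ?thesis
      using top_gap_curvature_nonneg[OF c g(2,5)] nu_pos[OF c] mu_pos[OF c] g(1,2)
        comb_beats_low_single[OF ab] comb_beats_high_single[OF ab] curvature_bounded[OF ab]
        top_pair_defect(1)[OF ab]
      by (simp add: curv_high_def curv_low_def twist_high_def twist_low_def pair_defect_def mult.assoc)
  qed
  show "0 \<le> curv_high y" "0 \<le> curv_low y" "0 \<le> twist_high y" "0 \<le> twist_low y" "0 \<le> pair_defect y"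
    "0 \<le> 3 * curv_high y - curv_low y - 4 * twist_low y" "0 \<le> 3 * curv_low y - curv_high y + pair_defect y - 4 * twist_high y"
    "curv_high y + curv_low y \<le> 2" "pair_defect y \<le> 2 * sinh (sqrt 2 * (y $ 3 - y $ 2))" "0 \<le> grad_chamber k y"
    using * by auto
qed

lemma hess_chamber_symmetric: "hess_chamber k l y = hess_chamber l k y"
  by (auto simp: hess_chamber_def hess_scaled_def pair_curv_def)

definition quad_chamber :: "4 set \<Rightarrow> real^4 \<Rightarrow> real" where
  "quad_chamber J y = (\<Sum>k\<in>J. \<Sum>l\<in>J. hess_chamber k l y)"
definition quad :: "4 set \<Rightarrow> real^4 \<Rightarrow> real" where
  "quad J x = (\<Sum>i\<in>J. \<Sum>j\<in>J. u_hess i j x)"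

lemma sum_of_bool: "sum f J = (\<Sum>k\<in>UNIV. of_bool (k \<in> J) * f k)" for f :: "4 \<Rightarrow> real"
  by (rule sum.mono_neutral_cong_left) auto

lemma quad_chamber_expand:
  "quad_chamber J y = sqrt 2 / 8 * (\<Sum>k\<in>UNIV. \<Sum>l\<in>UNIV. of_bool (k \<in> J) * of_bool (l \<in> J) * hess_scaled k l y)"
proof -
  have "quad_chamber J y = sqrt 2 / 8 * (\<Sum>k\<in>J. \<Sum>l\<in>J. hess_scaled k l y)"
    by (simp add: quad_chamber_def hess_chamber_def sum_distrib_left)
  then show ?thesis
    by (simp only: sum_of_bool[of _ J] sum_distrib_left mult.assoc)
qed

lemma quad_chamber_complement: "quad_chamber (- J) y = quad_chamber J y"
  unfolding quad_chamber_expand sum_4 hess_scaled_def single_curv_def pair_curv_def low_def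
  by (cases "1 \<in> J"; cases "2 \<in> J"; cases "3 \<in> J"; cases "4 \<in> J") (simp_all add: field_simps)

text \<open>One inequality for each of the 16 subsets; up to complements these are the comb and the pairs
  tied with it, the pair of leaders, the four single experts and the empty set.\<close>

lemma quad_chamber_le:
  assumes "ordered y"
  shows "quad_chamber J y \<le> sqrt 2 / 2 * (curv_high y + curv_low y)"
proof -
  note i = chamber_inequalities[OF assms]
  have "(\<Sum>k\<in>UNIV. \<Sum>l\<in>UNIV. of_bool (k \<in> J) * of_bool (l \<in> J) * hess_scaled k l y) \<le> 4 * (curv_high y + curv_low y)"
    unfolding sum_4 hess_scaled_def single_curv_def pair_curv_def low_def
    using i(1-7)
    by (cases "1 \<in> J"; cases "2 \<in> J"; cases "3 \<in> J"; cases "4 \<in> J") (simp_all add: field_simps)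
  from mult_left_mono[OF this, of "sqrt 2 / 8"] show ?thesis
    unfolding quad_chamber_expand by simp
qed

text \<open>A pair of experts is a comb if it is neither strictly ahead of the complementary pair nor
  strictly behind it. The slack \<open>d\<close> makes the notion stable along a short segment.\<close>

definition interleaved :: "4 set \<Rightarrow> real^4 \<Rightarrow> real \<Rightarrow> bool" where
  "interleaved J x d \<longleftrightarrow> (\<exists>a\<in>J. \<exists>b\<in>-J. x $ a \<le> x $ b + d) \<and> (\<exists>a\<in>J. \<exists>b\<in>-J. x $ b \<le> x $ a + d)"

text \<open>Only the pair of leaders and the pair of laggards have less curvature than the comb. If such a
  pair is interleaved up to \<open>d\<close>, then the middle gap is at most \<open>d\<close>, and \<open>top_pair_defect\<close> makes
  the loss small.\<close>

lemma quad_chamber_ge: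
  assumes y: "ordered y" and J: "card J = 2" "interleaved J y d" and d: "0 \<le> d"
  shows "sqrt 2 / 2 * (curv_high y + curv_low y) - sqrt 2 * sinh (sqrt 2 * d) \<le> quad_chamber J y"
proof -
  note i = chamber_inequalities[OF y]
  from J(1) obtain k l where kl: "J = {k, l}" "k \<noteq> l" by (auto simp: card_2_iff)
  have q: "quad_chamber J y = sqrt 2 / 8 * pair_curv k l y"
    unfolding quad_chamber_def kl(1) using kl(2) hess_chamber_symmetric[of l k]
    by (simp add: hess_chamber_def hess_scaled_def field_simps)
  have "4 * (curv_high y + curv_low y) - 8 * sinh (sqrt 2 * d) \<le> pair_curv k l y"
  proof (cases "low k = low l")
    case False
    then show ?thesis using d by (simp add: pair_curv_def)
  next
    case True
    have o: "y $ 1 \<le> y $ 2" "y $ 2 \<le> y $ 3" "y $ 3 \<le> y $ 4" using y by (auto simp: ordered_def)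
    have lo: "y $ b \<le> y $ 2" if "low b" for b using that o by (auto simp: low_def)
    have hi: "y $ 3 \<le> y $ b" if "\<not> low b" for b using that o exhaust_4[of b] by (auto simp: low_def)
    have "y $ 3 \<le> y $ 2 + d"
    proof (cases "low k")
      case low: True
      then have "J = {1, 2}" using True kl by (auto simp: low_def)
      then have "\<not> low b" if "b \<in> - J" for b using that by (auto simp: low_def)
      moreover obtain a b where "a \<in> J" "b \<in> - J" "y $ b \<le> y $ a + d" using J(2) by (auto simp: interleaved_def)
      moreover have "low a" using \<open>a \<in> J\<close> \<open>J = {1, 2}\<close> by (auto simp: low_def)
      ultimately show ?thesis using lo[of a] hi[of b] by force
    next
      case high: False
      then have "J = {3, 4}" using True kl exhaust_4[of k] exhaust_4[of l] by (auto simp: low_def)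
      then have "low b" if "b \<in> - J" for b using that exhaust_4[of b] by (auto simp: low_def)
      moreover obtain a b where "a \<in> J" "b \<in> - J" "y $ a \<le> y $ b + d" using J(2) by (auto simp: interleaved_def)
      moreover have "\<not> low a" using \<open>a \<in> J\<close> \<open>J = {3, 4}\<close> by (auto simp: low_def)
      ultimately show ?thesis using lo[of b] hi[of a] by force
    qed
    then have "sqrt 2 * (y $ 3 - y $ 2) \<le> sqrt 2 * d" by (intro mult_left_mono) auto
    then have "sinh (sqrt 2 * (y $ 3 - y $ 2)) \<le> sinh (sqrt 2 * d)" by simp
    then have "pair_defect y \<le> 2 * sinh (sqrt 2 * d)" using i(9) by linarith
    then show ?thesis using True by (simp add: pair_curv_def)
  qed
  from mult_left_mono[OF this, of "sqrt 2 / 8"] show ?thesis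
    unfolding q by (simp add: field_simps)
qed

lemma quad_image:
  assumes "bij \<pi>" "ordered (permute \<pi> x)"
  shows "quad (\<pi> ` J) x = quad_chamber J (permute \<pi> x)"
proof -
  have i: "inj_on \<pi> J" using assms(1) by (auto simp: bij_def inj_on_def)
  show ?thesis
    unfolding quad_def quad_chamber_def sum.reindex[OF i] o_def u_hess_eq[OF assms] ..
qed

lemma Phi_permute: "bij \<pi> \<Longrightarrow> Phi (permute \<pi> x) = Phi x"
proof -
  assume "bij \<pi>"
  then have "range (\<lambda>i. x $ \<pi> i) = range (\<lambda>i. x $ i)" by (metis bij_is_surj image_image)
  then show ?thesis by (simp add: Phi_def)
qed

lemma Phi_ordered: "ordered y \<Longrightarrow> Phi y = y $ 4"
  unfolding Phi_def UNIV_4 by (auto simp: ordered_def)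

lemma u_fun_minus_Phi:
  assumes "bij \<pi>" "ordered (permute \<pi> x)"
  shows "u_fun x - Phi x = sqrt 2 / 4 * (curv_high (permute \<pi> x) + curv_low (permute \<pi> x))"
  using Phi_permute[OF assms(1), of x] Phi_ordered[OF assms(2)]
  by (simp add: u_fun_eq[OF assms] U_chamber_def curv_high_def curv_low_def)

lemma image_preimage_sorter: "sorter x ` (sorter x -` J) = J"
  by (subst image_vimage_eq, subst bij_is_surj[OF sorter(1)], rule Int_UNIV_right)

text \<open>The differential equation as an inequality for every choice of nature.\<close>

lemma pde_le: "quad J x \<le> 2 * (u_fun x - Phi x)"
proof -
  have "quad J x = quad_chamber (sorter x -` J) (permute (sorter x) x)"
    using quad_image[OF sorter, of x "sorter x -` J"] by (simp only: image_preimage_sorter)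
  also have "\<dots> \<le> 2 * (u_fun x - Phi x)"
    unfolding u_fun_minus_Phi[OF sorter] using quad_chamber_le[OF sorter(2)] by simp
  finally show ?thesis .
qed

text \<open>The solution is affine along the diagonal, so the diagonal lies in the kernel of the Hessian.\<close>

lemma quad_complement: "quad (- J) x = quad J x"
proof -
  have "quad (- J) x = quad_chamber (sorter x -` (- J)) (permute (sorter x) x)"
    using quad_image[OF sorter, of x "sorter x -` (- J)"] by (simp only: image_preimage_sorter)
  also have "\<dots> = quad_chamber (sorter x -` J) (permute (sorter x) x)"
    by (simp only: vimage_Compl quad_chamber_complement)
  also have "\<dots> = quad J x"
    using quad_image[OF sorter, of x "sorter x -` J"] by (simp only: image_preimage_sorter)
  finally show ?thesis .
qed

text \<open>The differential equation is attained by combs, with an explicit error for approximate combs.\<close>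

lemma pde_comb:
  assumes "card J = 2" "interleaved J x d" "0 \<le> d"
  shows "2 * (u_fun x - Phi x) - sqrt 2 * sinh (sqrt 2 * d) \<le> quad J x"
proof -
  define \<sigma> where "\<sigma> = sorter x"
  have \<sigma>: "bij \<sigma>" "ordered (permute \<sigma> x)" using sorter by (auto simp: \<sigma>_def)
  \<comment> \<open>Transport \<open>J\<close> to the ordered chamber.\<close>
  define K where "K = \<sigma> -` J"
  have K: "\<sigma> ` K = J" unfolding K_def \<sigma>_def by (rule image_preimage_sorter)
  have "inj_on \<sigma> K" using \<sigma>(1) by (auto simp: bij_def inj_on_def)
  then have "card K = 2" using assms(1) card_image[of \<sigma> K] by (simp only: K)
  moreover have "interleaved K (permute \<sigma> x) d"
  proof -
    obtain a b a' b' where ab: "a \<in> J" "b \<notin> J" "x $ a \<le> x $ b + d" "a' \<in> J" "b' \<notin> J" "x $ b' \<le> x $ a' + d"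
      using assms(2) by (auto simp: interleaved_def)
    have pre: "\<exists>k. \<sigma> k = i" for i using \<sigma>(1) by (metis bij_pointE)
    obtain k l k' l' where kl: "\<sigma> k = a" "\<sigma> l = b" "\<sigma> k' = a'" "\<sigma> l' = b'" using pre by meson
    show ?thesis unfolding interleaved_def
    proof
      show "\<exists>a\<in>K. \<exists>b\<in>- K. permute \<sigma> x $ a \<le> permute \<sigma> x $ b + d"
        using ab kl by (intro bexI[of _ k] bexI[of _ l]) (auto simp: K_def)
      show "\<exists>a\<in>K. \<exists>b\<in>- K. permute \<sigma> x $ b \<le> permute \<sigma> x $ a + d"
        using ab kl by (intro bexI[of _ k'] bexI[of _ l']) (auto simp: K_def)
    qed
  qed
  ultimately have "sqrt 2 / 2 * (curv_high (permute \<sigma> x) + curv_low (permute \<sigma> x)) - sqrt 2 * sinh (sqrt 2 * d) \<le> quad_chamber K (permute \<sigma> x)"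
    using quad_chamber_ge[OF \<sigma>(2)] assms(3) by blast
  then show ?thesis unfolding u_fun_minus_Phi[OF \<sigma>] using quad_image[OF \<sigma>, of K] K by simp
qed

text \<open>The second and the fourth expert in the ranking.\<close>

lemma comb_exists: "\<exists>J. card J = 2 \<and> interleaved J x 0"
proof -
  define \<sigma> where "\<sigma> = sorter x"
  have \<sigma>: "bij \<sigma>" "ordered (permute \<sigma> x)" using sorter by (auto simp: \<sigma>_def)
  have inj: "\<sigma> k = \<sigma> l \<longleftrightarrow> k = l" for k l using \<sigma>(1) by (simp add: bij_def inj_eq)
  have "interleaved {\<sigma> 2, \<sigma> 4} x 0"
    unfolding interleaved_def
  proof
    show "\<exists>a\<in>{\<sigma> 2, \<sigma> 4}. \<exists>b\<in>- {\<sigma> 2, \<sigma> 4}. x $ a \<le> x $ b + 0"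
      using \<sigma>(2) by (intro bexI[of _ "\<sigma> 2"] bexI[of _ "\<sigma> 3"]) (auto simp: ordered_def inj)
    show "\<exists>a\<in>{\<sigma> 2, \<sigma> 4}. \<exists>b\<in>- {\<sigma> 2, \<sigma> 4}. x $ b \<le> x $ a + 0"
      using \<sigma>(2) by (intro bexI[of _ "\<sigma> 2"] bexI[of _ "\<sigma> 1"]) (auto simp: ordered_def inj)
  qed
  then show ?thesis by (intro exI[of _ "{\<sigma> 2, \<sigma> 4}"]) (simp add: inj)
qed

lemma gap_bounds: "0 \<le> u_fun x - Phi x" "u_fun x - Phi x \<le> 1"
proof -
  note i = chamber_inequalities[OF sorter(2)[of x]]
  have w: "0 \<le> curv_high (permute (sorter x) x) + curv_low (permute (sorter x) x)" using i(1,2) by simp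
  then show "0 \<le> u_fun x - Phi x" unfolding u_fun_minus_Phi[OF sorter] by simp
  have "sqrt 2 / 4 * (curv_high (permute (sorter x) x) + curv_low (permute (sorter x) x)) \<le> 2 / 4 * 2"
    using i(8) w by (intro mult_mono) (auto intro: real_le_lsqrt)
  then show "u_fun x - Phi x \<le> 1" unfolding u_fun_minus_Phi[OF sorter] by simp
qed

lemma u_grad_nonneg: "0 \<le> u_grad i x"
proof -
  obtain k where k: "i = sorter x k" using sorter(1) by (metis bij_pointE)
  show ?thesis unfolding k u_grad_eq[OF sorter] by (rule chamber_inequalities(10)[OF sorter(2)])
qed

lemma u_grad_sum: "(\<Sum>i\<in>UNIV. u_grad i x) = 1"
proof -
  have "(\<Sum>i\<in>UNIV. u_grad i x) = (\<Sum>k\<in>UNIV. u_grad (sorter x k) x)"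
    using sum.reindex_bij_betw[OF sorter(1), of "\<lambda>i. u_grad i x"] by simp
  also have "\<dots> = 1" unfolding u_grad_eq[OF sorter] sum_4 by (simp add: grad_chamber_def field_simps)
  finally show ?thesis .
qed

lemma e_set_nth [simp]: "e_set J $ i = of_bool (i \<in> J)"
  by (simp add: e_set_def axis_def of_bool_def)

lemma Phi_shift: "Phi (x + c *\<^sub>R e_set UNIV) = Phi x + c"
  unfolding Phi_def UNIV_4 by simp

lemma u_fun_shift: "u_fun (x + c *\<^sub>R e_set UNIV) = u_fun x + c"
proof -
  define \<pi> where "\<pi> = sorter x"
  have \<pi>: "bij \<pi>" "ordered (permute \<pi> x)" using sorter by (auto simp: \<pi>_def)
  have "ordered (permute \<pi> (x + c *\<^sub>R e_set UNIV))" using \<pi>(2) by (simp add: ordered_def)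
  from u_fun_eq[OF \<pi>(1) this] show ?thesis unfolding u_fun_eq[OF \<pi>]
    by (simp add: U_chamber_def gap_low_def gap_high_def spread_def algebra_simps)
qed

lemma u_fun_permute: "bij p \<Longrightarrow> u_fun (permute p x) = u_fun x"
proof -
  assume p: "bij p"
  show ?thesis unfolding u_fun_def lift_permute[OF compatible_U_chamber p] by (simp add: lift_def)
qed

section \<open>Expansions with uniform error\<close>

lemma derivative_along_line:
  assumes "(f has_derivative (\<lambda>h. \<Sum>j\<in>(UNIV::4 set). D j * h $ j)) (at (x + t *\<^sub>R v))"
  shows "((\<lambda>t. f (x + t *\<^sub>R v)) has_real_derivative (\<Sum>j\<in>UNIV. D j * v $ j)) (at t)"
proof -
  have "((\<lambda>t. x + t *\<^sub>R v) has_derivative (\<lambda>s. s *\<^sub>R v)) (at t)"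
    by (auto intro!: derivative_eq_intros)
  from has_derivative_compose[OF this assms]
  show ?thesis unfolding has_field_derivative_def
    by (rule has_derivative_eq_rhs) (auto simp: fun_eq_iff sum_distrib_right intro!: sum.cong)
qed

lemma u_fun_mono:
  assumes "\<And>i. 0 \<le> y $ i" shows "u_fun x \<le> u_fun (x + y)"
proof -
  have "u_fun (x + 0 *\<^sub>R y) \<le> u_fun (x + 1 *\<^sub>R y)"
  proof (rule DERIV_nonneg_imp_nondecreasing[where f = "\<lambda>s. u_fun (x + s *\<^sub>R y)" and a = 0 and b = 1])
    fix s :: real
    show "\<exists>d. ((\<lambda>s. u_fun (x + s *\<^sub>R y)) has_real_derivative d) (at s) \<and> 0 \<le> d"
    proof (intro exI conjI)
      show "((\<lambda>s. u_fun (x + s *\<^sub>R y)) has_real_derivative (\<Sum>j\<in>UNIV. u_grad j (x + s *\<^sub>R y) * y $ j)) (at s)"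
        by (rule derivative_along_line[OF u_fun_derivative])
      show "0 \<le> (\<Sum>j\<in>UNIV. u_grad j (x + s *\<^sub>R y) * y $ j)"
        using assms u_grad_nonneg by (intro sum_nonneg mult_nonneg_nonneg) auto
    qed
  qed simp
  then show ?thesis by simp
qed

lemma Phi_mono:
  assumes "\<And>i. 0 \<le> y $ i" shows "Phi x \<le> Phi (x + y)"
  unfolding Phi_def
proof (intro Max.boundedI)
  fix a assume "a \<in> range (($) x)"
  then obtain i where "a = x $ i" by auto
  then have "a \<le> (x + y) $ i" using assms[of i] by simp
  also have "\<dots> \<le> Max (range (($) (x + y)))" by (intro Max_ge) auto
  finally show "a \<le> Max (range (($) (x + y)))" .
qed auto

text \<open>Monotonicity and equivariance under diagonal shifts confine the increment along an indicator
  vector between \<open>0\<close> and the increment along the diagonal.\<close>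

lemma monotone_shift_lipschitz:
  fixes f :: "real^4 \<Rightarrow> real"
  assumes mono: "\<And>x y. (\<And>i. 0 \<le> y $ i) \<Longrightarrow> f x \<le> f (x + y)"
    and shift: "\<And>x c. f (x + c *\<^sub>R e_set UNIV) = f x + c"
  shows "\<bar>f (x + t *\<^sub>R e_set J) - f x\<bar> \<le> \<bar>t\<bar>"
proof -
  have pos: "f x \<le> f (x + t *\<^sub>R e_set J) \<and> f (x + t *\<^sub>R e_set J) \<le> f x + t" if "0 \<le> t" for x t
  proof
    show "f x \<le> f (x + t *\<^sub>R e_set J)" using that by (intro mono) simp
    have e: "x + t *\<^sub>R e_set UNIV = (x + t *\<^sub>R e_set J) + t *\<^sub>R e_set (- J)"
      by (simp add: vec_eq_iff)
    have "f (x + t *\<^sub>R e_set J) \<le> f (x + t *\<^sub>R e_set UNIV)"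
      unfolding e by (rule mono) (use that in simp)
    then show "f (x + t *\<^sub>R e_set J) \<le> f x + t" by (simp add: shift)
  qed
  show ?thesis
  proof (cases "0 \<le> t")
    case True then show ?thesis using pos[OF True, of x] by simp
  next
    case False
    then show ?thesis using pos[of "- t" "x + t *\<^sub>R e_set J"] by simp
  qed
qed

lemma u_fun_lipschitz: "\<bar>u_fun (x + t *\<^sub>R e_set J) - u_fun x\<bar> \<le> \<bar>t\<bar>"
proof (rule monotone_shift_lipschitz)
  fix x y :: "real^4" assume "\<And>i. 0 \<le> y $ i"
  then show "u_fun x \<le> u_fun (x + y)" by (rule u_fun_mono)
qed (rule u_fun_shift)

lemma Phi_lipschitz: "\<bar>Phi (x + t *\<^sub>R e_set J) - Phi x\<bar> \<le> \<bar>t\<bar>"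
proof (rule monotone_shift_lipschitz)
  fix x y :: "real^4" assume "\<And>i. 0 \<le> y $ i"
  then show "Phi x \<le> Phi (x + y)" by (rule Phi_mono)
qed (rule Phi_shift)

lemma u_fun_second_order:
  obtains \<xi> where "\<bar>\<xi>\<bar> \<le> \<bar>t\<bar>"
    "u_fun (x + t *\<^sub>R e_set J) = u_fun x + t * (\<Sum>j\<in>J. u_grad j x) + t\<^sup>2 / 2 * quad J (x + \<xi> *\<^sub>R e_set J)"
proof -
  define v where "v = e_set J"
  define p where "p m t = (if m = 0 then u_fun (x + t *\<^sub>R v)
      else if m = 1 then (\<Sum>j\<in>UNIV. u_grad j (x + t *\<^sub>R v) * v $ j)
      else (\<Sum>i\<in>UNIV. (\<Sum>j\<in>UNIV. u_hess i j (x + t *\<^sub>R v) * v $ j) * v $ i))" for m :: nat and t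
  have "\<forall>m t. m < 2 \<and> \<bar>t\<bar> \<le> \<bar>t'\<bar> \<longrightarrow> (p m has_real_derivative p (Suc m) t) (at t)" for t' :: real
  proof (intro allI impI)
    fix m :: nat and t :: real
    assume "m < 2 \<and> \<bar>t\<bar> \<le> \<bar>t'\<bar>"
    then consider "m = 0" | "m = 1" by linarith
    then show "(p m has_real_derivative p (Suc m) t) (at t)"
    proof cases
      case 1
      then show ?thesis using derivative_along_line[OF u_fun_derivative, where x = x and t = t and v = v] by (simp add: p_def[abs_def])
    next
      case 2
      have "((\<lambda>t. \<Sum>i\<in>UNIV. u_grad i (x + t *\<^sub>R v) * v $ i) has_real_derivative
         (\<Sum>i\<in>UNIV. (\<Sum>j\<in>UNIV. u_hess i j (x + t *\<^sub>R v) * v $ j) * v $ i)) (at t)"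
        by (intro DERIV_sum DERIV_cmult_right derivative_along_line u_grad_derivative)
      then show ?thesis by (simp add: 2 p_def[abs_def])
    qed
  qed
  from Maclaurin_bi_le[OF _ this, of "p 0" t] obtain \<xi> where \<xi>: "\<bar>\<xi>\<bar> \<le> \<bar>t\<bar>"
    "p 0 t = (\<Sum>m<2. p m 0 / fact m * t ^ m) + p 2 \<xi> / fact 2 * t ^ 2" by auto
  have "p 2 \<xi> = quad J (x + \<xi> *\<^sub>R e_set J)"
    by (simp add: p_def v_def quad_def)
  moreover have "p 1 0 = (\<Sum>j\<in>J. u_grad j x)"
    by (simp add: p_def v_def)
  ultimately have "u_fun (x + t *\<^sub>R e_set J) = u_fun x + t * (\<Sum>j\<in>J. u_grad j x) + t\<^sup>2 / 2 * quad J (x + \<xi> *\<^sub>R e_set J)"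
    using \<xi>(2) by (simp add: p_def[of 0] v_def numeral_2_eq_2 algebra_simps)
  with \<xi>(1) show ?thesis by (rule that)
qed

text \<open>The second derivative along the segment is bounded by \<open>2 (u - \<Phi>)\<close>, which is Lipschitz. The
  error term is thus uniform over the whole space.\<close>

lemma u_fun_upper_expansion:
  assumes "0 \<le> t"
  shows "u_fun (x + t *\<^sub>R e_set J) \<le> u_fun x + t * (\<Sum>j\<in>J. u_grad j x) + t\<^sup>2 * (u_fun x - Phi x + 2 * t)"
proof -
  obtain \<xi> where \<xi>: "\<bar>\<xi>\<bar> \<le> \<bar>t\<bar>"
    "u_fun (x + t *\<^sub>R e_set J) = u_fun x + t * (\<Sum>j\<in>J. u_grad j x) + t\<^sup>2 / 2 * quad J (x + \<xi> *\<^sub>R e_set J)"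
    by (rule u_fun_second_order)
  have "u_fun (x + \<xi> *\<^sub>R e_set J) \<le> u_fun x + t" "Phi x - t \<le> Phi (x + \<xi> *\<^sub>R e_set J)"
    using u_fun_lipschitz[where x = x and t = "\<xi>" and J = J] Phi_lipschitz[where x = x and t = "\<xi>" and J = J]
      \<xi>(1) assms by linarith+
  with pde_le[of J "x + \<xi> *\<^sub>R e_set J"]
  have "quad J (x + \<xi> *\<^sub>R e_set J) \<le> 2 * (u_fun x - Phi x + 2 * t)" by (simp add: algebra_simps)
  from mult_left_mono[OF this, of "t\<^sup>2 / 2"] show ?thesis using \<xi>(2) by (simp add: algebra_simps)
qed

lemma interleaved_line:
  assumes "interleaved J x 0" "\<bar>\<xi>\<bar> \<le> d"
  shows "interleaved J (x + \<xi> *\<^sub>R e_set J) d"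
proof -
  from assms(1) obtain a b a' b' where ab: "a \<in> J" "b \<notin> J" "x $ a \<le> x $ b" "a' \<in> J" "b' \<notin> J" "x $ b' \<le> x $ a'"
    by (auto simp: interleaved_def)
  show ?thesis unfolding interleaved_def
  proof
    show "\<exists>a\<in>J. \<exists>b\<in>- J. (x + \<xi> *\<^sub>R e_set J) $ a \<le> (x + \<xi> *\<^sub>R e_set J) $ b + d"
      using ab assms(2) by (intro bexI[of _ a] bexI[of _ b]) auto
    show "\<exists>a\<in>J. \<exists>b\<in>- J. (x + \<xi> *\<^sub>R e_set J) $ b \<le> (x + \<xi> *\<^sub>R e_set J) $ a + d"
      using ab assms(2) by (intro bexI[of _ a'] bexI[of _ b']) auto
  qed
qed

text \<open>A comb remains an approximate comb along a short segment, so the second derivative stays close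
  to \<open>2 (u - \<Phi>)\<close>, again uniformly in \<open>x\<close>.\<close>

lemma u_fun_lower_expansion:
  assumes J: "card J = 2" "interleaved J x 0"
  shows "u_fun x + t * (\<Sum>j\<in>J. u_grad j x) + t\<^sup>2 * (u_fun x - Phi x - 2 * \<bar>t\<bar> - sinh (sqrt 2 * \<bar>t\<bar>))
    \<le> u_fun (x + t *\<^sub>R e_set J)"
proof -
  obtain \<xi> where \<xi>: "\<bar>\<xi>\<bar> \<le> \<bar>t\<bar>"
    "u_fun (x + t *\<^sub>R e_set J) = u_fun x + t * (\<Sum>j\<in>J. u_grad j x) + t\<^sup>2 / 2 * quad J (x + \<xi> *\<^sub>R e_set J)"
    by (rule u_fun_second_order)
  define T where "T = \<bar>t\<bar>"
  define z where "z = x + \<xi> *\<^sub>R e_set J"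
  define S where "S = sinh (sqrt 2 * T)"
  have "sqrt 2 * S \<le> 2 * S"
    unfolding S_def T_def by (rule mult_right_mono) (auto intro: real_le_lsqrt)
  moreover have "u_fun x - T \<le> u_fun z" "Phi z \<le> Phi x + T"
    using u_fun_lipschitz[where x = x and t = "\<xi>" and J = J] Phi_lipschitz[where x = x and t = "\<xi>" and J = J]
      \<xi>(1) unfolding T_def[symmetric] z_def[symmetric] by linarith+
  moreover have "2 * (u_fun z - Phi z) - sqrt 2 * S \<le> quad J z"
    unfolding S_def T_def z_def by (rule pde_comb[OF J(1) interleaved_line[OF J(2) \<xi>(1)]]) simp
  ultimately have "2 * (u_fun x - Phi x - 2 * T - S) \<le> quad J z" by (simp add: algebra_simps)
  from mult_left_mono[OF this, of "t\<^sup>2 / 2"] show ?thesis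
    unfolding \<xi>(2) z_def[symmetric] T_def[symmetric] S_def[symmetric] by (simp add: algebra_simps)
qed

section \<open>Expectations in the game\<close>

lemma integral_bind_pmf_nonneg:
  fixes g :: "'b \<Rightarrow> real"
  assumes g: "\<And>y. 0 \<le> g y" and fin: "\<And>x. finite (set_pmf (N x))"
    and int: "integrable (measure_pmf p) (\<lambda>x. measure_pmf.expectation (N x) g)"
  shows "integrable (measure_pmf (bind_pmf p N)) g \<and>
    measure_pmf.expectation (bind_pmf p N) g = measure_pmf.expectation p (\<lambda>x. measure_pmf.expectation (N x) g)"
proof -
  have "(\<integral>\<^sup>+ y. ennreal (g y) \<partial>measure_pmf (bind_pmf p N)) = (\<integral>\<^sup>+ x. \<integral>\<^sup>+ y. ennreal (g y) \<partial>N x \<partial>p)"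
    by simp
  also have "\<dots> = (\<integral>\<^sup>+ x. ennreal (measure_pmf.expectation (N x) g) \<partial>p)"
    by (intro nn_integral_cong nn_integral_eq_integral integrable_measure_pmf_finite fin) (simp add: g)
  also have "\<dots> = ennreal (measure_pmf.expectation p (\<lambda>x. measure_pmf.expectation (N x) g))"
    by (rule nn_integral_eq_integral[OF int]) (simp add: g)
  finally have e: "(\<integral>\<^sup>+ y. ennreal (g y) \<partial>measure_pmf (bind_pmf p N)) =
     ennreal (measure_pmf.expectation p (\<lambda>x. measure_pmf.expectation (N x) g))" .
  have "0 \<le> measure_pmf.expectation p (\<lambda>x. measure_pmf.expectation (N x) g)"
    by (intro Bochner_Integration.integral_nonneg) (simp add: g)
  moreover have "integrable (measure_pmf (bind_pmf p N)) g"
    by (rule integrableI_nn_integral_finite[OF _ _ e]) (simp_all add: g)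
  moreover have "measure_pmf.expectation (bind_pmf p N) g =
      enn2real (\<integral>\<^sup>+ y. ennreal (g y) \<partial>measure_pmf (bind_pmf p N))"
    by (rule integral_eq_nn_integral) (simp_all add: g)
  ultimately show ?thesis unfolding e by simp
qed

text \<open>Reduction to nonnegative functions by splitting into positive and negative part. Integrability
  rather than boundedness is assumed because the regret grows with the length of the game.\<close>

lemma integral_bind_pmf_finite_kernel:
  fixes f :: "'b \<Rightarrow> real"
  assumes fin: "\<And>x. finite (set_pmf (N x))"
    and int: "integrable (measure_pmf p) (\<lambda>x. measure_pmf.expectation (N x) (\<lambda>y. \<bar>f y\<bar>))"
  shows "integrable (measure_pmf p) (\<lambda>x. measure_pmf.expectation (N x) f)"
    and "measure_pmf.expectation (bind_pmf p N) f = measure_pmf.expectation p (\<lambda>x. measure_pmf.expectation (N x) f)"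
proof -
  have I: "integrable (measure_pmf (N x)) h" for x and h :: "'b \<Rightarrow> real"
    by (rule integrable_measure_pmf_finite[OF fin])
  have B: "integrable (measure_pmf p) (\<lambda>x. measure_pmf.expectation (N x) h)"
    if "\<And>y. \<bar>h y\<bar> \<le> \<bar>f y\<bar>" for h
  proof (rule Bochner_Integration.integrable_bound[OF int])
    have "\<bar>measure_pmf.expectation (N x) h\<bar> \<le> measure_pmf.expectation (N x) (\<lambda>y. \<bar>f y\<bar>)" for x
      by (rule order_trans[OF integral_abs_bound integral_mono]) (auto intro: I that)
    then show "AE x in measure_pmf p. norm (measure_pmf.expectation (N x) h) \<le> norm (measure_pmf.expectation (N x) (\<lambda>y. \<bar>f y\<bar>))"
      by (intro AE_I2) (auto intro: order_trans abs_ge_self)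
  qed simp
  show "integrable (measure_pmf p) (\<lambda>x. measure_pmf.expectation (N x) f)" by (rule B) simp
  define u v where "u y = max (f y) 0" and "v y = max (- f y) 0" for y
  have uv: "f = (\<lambda>y. u y - v y)" by (auto simp: u_def v_def fun_eq_iff)
  have Bu: "integrable (measure_pmf p) (\<lambda>x. measure_pmf.expectation (N x) u)" by (rule B) (auto simp: u_def)
  have Bv: "integrable (measure_pmf p) (\<lambda>x. measure_pmf.expectation (N x) v)" by (rule B) (auto simp: v_def)
  note U = integral_bind_pmf_nonneg[OF _ fin Bu] and V = integral_bind_pmf_nonneg[OF _ fin Bv]
  have U: "integrable (measure_pmf (bind_pmf p N)) u"
    "measure_pmf.expectation (bind_pmf p N) u = measure_pmf.expectation p (\<lambda>x. measure_pmf.expectation (N x) u)"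
    and V: "integrable (measure_pmf (bind_pmf p N)) v"
    "measure_pmf.expectation (bind_pmf p N) v = measure_pmf.expectation p (\<lambda>x. measure_pmf.expectation (N x) v)"
    using U V by (auto simp: u_def v_def)
  have "measure_pmf.expectation (bind_pmf p N) f =
     measure_pmf.expectation (bind_pmf p N) u - measure_pmf.expectation (bind_pmf p N) v"
    unfolding uv by (rule Bochner_Integration.integral_diff[OF U(1) V(1)])
  also have "\<dots> = measure_pmf.expectation p (\<lambda>x. measure_pmf.expectation (N x) u - measure_pmf.expectation (N x) v)"
    unfolding U V by (rule Bochner_Integration.integral_diff[OF Bu Bv, symmetric])
  also have "\<dots> = measure_pmf.expectation p (\<lambda>x. measure_pmf.expectation (N x) f)"
    unfolding uv by (subst Bochner_Integration.integral_diff[OF I I]) simp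
  finally show "measure_pmf.expectation (bind_pmf p N) f = measure_pmf.expectation p (\<lambda>x. measure_pmf.expectation (N x) f)" .
qed

lemma finite_play: "finite (set_pmf (play \<alpha> \<beta> x t))"
  by (induction t) auto

definition mean :: "player \<Rightarrow> nature \<Rightarrow> real^4 \<Rightarrow> (gains \<Rightarrow> real) \<Rightarrow> nat \<Rightarrow> real" where
  "mean \<alpha> \<beta> x f t = measure_pmf.expectation (play \<alpha> \<beta> x t) (\<lambda>h. f (last h))"

definition one_step :: "(gains \<Rightarrow> real) \<Rightarrow> gains \<Rightarrow> 4 pmf \<Rightarrow> 4 set pmf \<Rightarrow> real" where
  "one_step f s a b = (\<Sum>J\<in>UNIV. pmf b J * (\<Sum>i\<in>UNIV. pmf a i * f (update s i J)))"

lemma mean_0: "mean \<alpha> \<beta> x f 0 = f (x, 0)"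
  by (simp add: mean_def)

lemma mean_Suc:
  "mean \<alpha> \<beta> x f (Suc t) = measure_pmf.expectation (play \<alpha> \<beta> x t) (\<lambda>h. one_step f (last h) (\<alpha> h) (\<beta> h))"
proof -
  have "mean \<alpha> \<beta> x f (Suc t) = measure_pmf.expectation (play \<alpha> \<beta> x t) (\<lambda>h.
     measure_pmf.expectation (map_pmf (\<lambda>(i, J). h @ [update (last h) i J]) (pair_pmf (\<alpha> h) (\<beta> h))) (\<lambda>h. f (last h)))"
    unfolding mean_def play.simps
    by (rule integral_bind_pmf_finite_kernel(2)) (auto intro: integrable_measure_pmf_finite finite_play)
  also have "\<dots> = measure_pmf.expectation (play \<alpha> \<beta> x t) (\<lambda>h. one_step f (last h) (\<alpha> h) (\<beta> h))"
  proof (intro Bochner_Integration.integral_cong refl)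
    fix h
    have "measure_pmf.expectation (map_pmf (\<lambda>(i, J). h @ [update (last h) i J]) (pair_pmf (\<alpha> h) (\<beta> h))) (\<lambda>h. f (last h))
      = (\<Sum>(i, J)\<in>UNIV \<times> UNIV. pmf (pair_pmf (\<alpha> h) (\<beta> h)) (i, J) * f (update (last h) i J))"
      by (simp add: case_prod_unfold) (subst integral_measure_pmf[of UNIV], auto simp: case_prod_unfold)
    also have "\<dots> = (\<Sum>i\<in>UNIV. \<Sum>J\<in>UNIV. pmf (\<alpha> h) i * pmf (\<beta> h) J * f (update (last h) i J))"
      by (simp add: sum.cartesian_product pmf_pair)
    also have "\<dots> = one_step f (last h) (\<alpha> h) (\<beta> h)"
      unfolding one_step_def by (subst sum.swap) (simp add: sum_distrib_left mult_ac)
    finally show "measure_pmf.expectation (map_pmf (\<lambda>(i, J). h @ [update (last h) i J]) (pair_pmf (\<alpha> h) (\<beta> h))) (\<lambda>h. f (last h))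
      = one_step f (last h) (\<alpha> h) (\<beta> h)" .
  qed
  finally show ?thesis .
qed

lemma drift_bounded:
  assumes "\<And>s i J. \<bar>f (update s i J) - f s\<bar> \<le> 1" "h \<in> set_pmf (play \<alpha> \<beta> x t)"
  shows "\<bar>f (last h)\<bar> \<le> \<bar>f (x, 0)\<bar> + real t"
  using assms(2)
proof (induction t arbitrary: h)
  case 0
  then show ?case by simp
next
  case (Suc t)
  then obtain h' i J where h: "h' \<in> set_pmf (play \<alpha> \<beta> x t)" "h = h' @ [update (last h') i J]" by auto
  then show ?case using Suc.IH[OF h(1)] assms(1)[of "last h'" i J] by auto
qed

lemma mean_bounded:
  assumes "\<And>s i J. \<bar>f (update s i J) - f s\<bar> \<le> 1"
  shows "\<bar>mean \<alpha> \<beta> x f t\<bar> \<le> \<bar>f (x, 0)\<bar> + real t"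
proof -
  have "\<bar>mean \<alpha> \<beta> x f t\<bar> \<le> measure_pmf.expectation (play \<alpha> \<beta> x t) (\<lambda>h. \<bar>f (last h)\<bar>)"
    unfolding mean_def by (rule integral_abs_bound)
  also have "\<dots> \<le> measure_pmf.expectation (play \<alpha> \<beta> x t) (\<lambda>h. \<bar>f (x, 0)\<bar> + real t)"
    by (rule integral_mono_AE)
      (auto intro!: integrable_measure_pmf_finite finite_play drift_bounded[OF assms] simp: AE_measure_pmf_iff)
  finally show ?thesis by simp
qed

lemma regret_drift: "\<bar>regret (update s i J) - regret s\<bar> \<le> 1"
proof -
  obtain G g where s: "s = (G, g)" by (cases s)
  have "Phi G \<le> Phi (G + e_set J)" by (rule Phi_mono) simp
  moreover have "\<bar>Phi (G + 1 *\<^sub>R e_set J) - Phi G\<bar> \<le> \<bar>1\<bar>" by (rule Phi_lipschitz)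
  ultimately show ?thesis by (auto simp: s of_bool_def)
qed

lemma geometric_expectation_sums:
  assumes d: "0 < \<delta>" "\<delta> < 1" and i: "integrable (measure_pmf (geometric_pmf \<delta>)) f"
  shows "(\<lambda>t. (1 - \<delta>) ^ t * \<delta> * f t) sums measure_pmf.expectation (geometric_pmf \<delta>) f"
proof -
  have m: "(\<lambda>t. pmf (geometric_pmf \<delta>) t * f t) = (\<lambda>t. (1 - \<delta>) ^ t * \<delta> * f t)" using d by simp
  have "integrable (count_space UNIV) (\<lambda>t. pmf (geometric_pmf \<delta>) t * f t)"
    using i unfolding measure_pmf_eq_density by (subst (asm) integrable_density) auto
  from sums_integral_count_space_nat[OF this]
  have "(\<lambda>t. (1 - \<delta>) ^ t * \<delta> * f t) sums (\<integral>t. pmf (geometric_pmf \<delta>) t * f t \<partial>count_space UNIV)"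
    unfolding m .
  also have "(\<integral>t. pmf (geometric_pmf \<delta>) t * f t \<partial>count_space UNIV) = measure_pmf.expectation (geometric_pmf \<delta>) f"
    unfolding measure_pmf_eq_density by (subst integral_density) auto
  finally show ?thesis .
qed

lemma geometric_integrable_linear:
  assumes d: "0 < \<delta>" "\<delta> < 1" and f: "\<And>t. \<bar>f t\<bar> \<le> C + real t"
  shows "integrable (measure_pmf (geometric_pmf \<delta>)) f"
proof (rule Bochner_Integration.integrable_bound)
  show "integrable (measure_pmf (geometric_pmf \<delta>)) (\<lambda>t. C + real t)"
    using integrable_real_geometric_pmf[of \<delta>] d by (intro Bochner_Integration.integrable_add) auto
  show "AE t in measure_pmf (geometric_pmf \<delta>). norm (f t) \<le> norm (C + real t)"
    by (intro AE_I2) (use f in \<open>auto intro: order_trans abs_ge_self\<close>)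
qed simp

lemma expected_regret_mean:
  assumes d: "0 < \<delta>" "\<delta> < 1"
  shows "(\<lambda>t. (1 - \<delta>) ^ t * \<delta> * mean \<alpha> \<beta> x regret t) sums expected_regret \<delta> \<alpha> \<beta> x"
    and "\<bar>expected_regret \<delta> \<alpha> \<beta> x\<bar> \<le> \<bar>Phi x\<bar> + (1 - \<delta>) / \<delta>"
proof -
  have b: "\<bar>mean \<alpha> \<beta> x regret t\<bar> \<le> \<bar>Phi x\<bar> + real t" for t
    using mean_bounded[of regret \<alpha> \<beta> x t, OF regret_drift] by simp
  have i: "integrable (measure_pmf (geometric_pmf \<delta>)) (mean \<alpha> \<beta> x regret)"
    by (rule geometric_integrable_linear[OF d b])
  have "expected_regret \<delta> \<alpha> \<beta> x = measure_pmf.expectation (geometric_pmf \<delta>)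
     (\<lambda>t. measure_pmf.expectation (map_pmf (\<lambda>h. regret (last h)) (play \<alpha> \<beta> x t)) (\<lambda>r. r))"
    unfolding expected_regret_def final_regret_def
  proof (rule integral_bind_pmf_finite_kernel(2))
    show "finite (set_pmf (map_pmf (\<lambda>h. regret (last h)) (play \<alpha> \<beta> x t)))" for t
      by (simp add: finite_play)
    have "\<bar>measure_pmf.expectation (play \<alpha> \<beta> x t) (\<lambda>h. \<bar>regret (last h)\<bar>)\<bar> \<le> \<bar>Phi x\<bar> + real t" for t
    proof -
      have "\<bar>measure_pmf.expectation (play \<alpha> \<beta> x t) (\<lambda>h. \<bar>regret (last h)\<bar>)\<bar>
          = measure_pmf.expectation (play \<alpha> \<beta> x t) (\<lambda>h. \<bar>regret (last h)\<bar>)" by simp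
      also have "\<dots> \<le> measure_pmf.expectation (play \<alpha> \<beta> x t) (\<lambda>h. \<bar>Phi x\<bar> + real t)"
        using drift_bounded[of regret _ \<alpha> \<beta> x t, OF regret_drift]
        by (intro integral_mono_AE) (auto intro!: integrable_measure_pmf_finite finite_play simp: AE_measure_pmf_iff)
      finally show ?thesis by simp
    qed
    from geometric_integrable_linear[OF d this]
    show "integrable (measure_pmf (geometric_pmf \<delta>)) (\<lambda>t. measure_pmf.expectation (map_pmf (\<lambda>h. regret (last h)) (play \<alpha> \<beta> x t)) (\<lambda>y. \<bar>y\<bar>))"
      by simp
  qed
  then have e: "expected_regret \<delta> \<alpha> \<beta> x = measure_pmf.expectation (geometric_pmf \<delta>) (mean \<alpha> \<beta> x regret)"
    by (simp add: mean_def[abs_def])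
  show "(\<lambda>t. (1 - \<delta>) ^ t * \<delta> * mean \<alpha> \<beta> x regret t) sums expected_regret \<delta> \<alpha> \<beta> x"
    unfolding e by (rule geometric_expectation_sums[OF d i])
  have "\<bar>expected_regret \<delta> \<alpha> \<beta> x\<bar> \<le> measure_pmf.expectation (geometric_pmf \<delta>) (\<lambda>t. \<bar>mean \<alpha> \<beta> x regret t\<bar>)"
    unfolding e by (rule integral_abs_bound)
  also have "\<dots> \<le> measure_pmf.expectation (geometric_pmf \<delta>) (\<lambda>t. \<bar>Phi x\<bar> + real t)"
    using i integrable_real_geometric_pmf[of \<delta>] d b
    by (intro integral_mono Bochner_Integration.integrable_add) auto
  also have "\<dots> = \<bar>Phi x\<bar> + (1 - \<delta>) / \<delta>"
    using integrable_real_geometric_pmf[of \<delta>] expectation_geometric_pmf[of \<delta>] d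
    by (subst Bochner_Integration.integral_add) auto
  finally show "\<bar>expected_regret \<delta> \<alpha> \<beta> x\<bar> \<le> \<bar>Phi x\<bar> + (1 - \<delta>) / \<delta>" .
qed

section \<open>Verification by the potential\<close>

text \<open>Multiplying the one-step inequality by \<open>(1 - \<delta>)\<^sup>t\<close> and adding up leaves the initial value, a
  discounted boundary term that vanishes because \<open>e\<close> grows linearly, and \<open>\<eta>\<close> times a geometric
  series.\<close>

lemma discounted_telescope:
  fixes \<rho> e :: "nat \<Rightarrow> real"
  assumes d: "0 < \<delta>" "\<delta> < 1"
    and step: "\<And>t. \<delta> * \<rho> t + (1 - \<delta>) * e (Suc t) \<le> e t + \<eta>"
    and e: "\<And>t. \<bar>e t\<bar> \<le> C + real t"
    and s: "(\<lambda>t. (1 - \<delta>) ^ t * \<delta> * \<rho> t) sums s"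
  shows "s \<le> e 0 + \<eta> / \<delta>"
proof -
  have part: "(\<Sum>t<n. (1 - \<delta>) ^ t * \<delta> * \<rho> t) \<le> e 0 - (1 - \<delta>) ^ n * e n + \<eta> * (\<Sum>t<n. (1 - \<delta>) ^ t)" for n
  proof (induction n)
    case (Suc n)
    have "(1 - \<delta>) ^ n * (\<delta> * \<rho> n + (1 - \<delta>) * e (Suc n)) \<le> (1 - \<delta>) ^ n * (e n + \<eta>)"
      by (rule mult_left_mono[OF step]) (use d in simp)
    then show ?case using Suc.IH by (simp add: algebra_simps)
  qed simp
  have "(\<lambda>n. (1 - \<delta>) ^ n * e n) \<longlonglongrightarrow> 0"
  proof (rule Lim_null_comparison)
    have "norm ((1 - \<delta>) ^ n * e n) \<le> C * (1 - \<delta>) ^ n + real n * (1 - \<delta>) ^ n" for n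
    proof -
      have "norm ((1 - \<delta>) ^ n * e n) = (1 - \<delta>) ^ n * \<bar>e n\<bar>" using d by (simp add: abs_mult)
      also have "\<dots> \<le> (1 - \<delta>) ^ n * (C + real n)" using d e by (intro mult_left_mono) auto
      finally show ?thesis by (simp add: algebra_simps)
    qed
    then show "\<forall>\<^sub>F n in sequentially. norm ((1 - \<delta>) ^ n * e n) \<le> C * (1 - \<delta>) ^ n + real n * (1 - \<delta>) ^ n" by simp
    have "(\<lambda>n. C * (1 - \<delta>) ^ n + real n * (1 - \<delta>) ^ n) \<longlonglongrightarrow> C * 0 + 0"
      using d powser_times_n_limit_0[of "1 - \<delta>"]
      by (intro tendsto_intros LIMSEQ_power_zero) auto
    then show "(\<lambda>n. C * (1 - \<delta>) ^ n + real n * (1 - \<delta>) ^ n) \<longlonglongrightarrow> 0" by simp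
  qed
  moreover have "(\<lambda>n. \<Sum>t<n. (1 - \<delta>) ^ t) \<longlonglongrightarrow> 1 / (1 - (1 - \<delta>))"
    using geometric_sums[of "1 - \<delta>"] d by (simp add: sums_def)
  ultimately have "(\<lambda>n. e 0 - (1 - \<delta>) ^ n * e n + \<eta> * (\<Sum>t<n. (1 - \<delta>) ^ t)) \<longlonglongrightarrow> e 0 - 0 + \<eta> * (1 / (1 - (1 - \<delta>)))"
    by (intro tendsto_intros)
  moreover have "(\<lambda>n. \<Sum>t<n. (1 - \<delta>) ^ t * \<delta> * \<rho> t) \<longlonglongrightarrow> s" using s by (simp add: sums_def)
  ultimately have "s \<le> e 0 - 0 + \<eta> * (1 / (1 - (1 - \<delta>)))"
    using part by (intro LIMSEQ_le) auto
  then show ?thesis by simp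
qed

text \<open>The scaled solution evaluated at the gains of the experts relative to the player. By equivariance
  under diagonal shifts the gain of the player can be taken out.\<close>

definition potential :: "real \<Rightarrow> gains \<Rightarrow> real" where
  "potential \<delta> s = u_fun (sqrt \<delta> *\<^sub>R fst s) / sqrt \<delta> - snd s"

lemma potential_drift:
  assumes "0 < \<delta>" shows "\<bar>potential \<delta> (update s i J) - potential \<delta> s\<bar> \<le> 1"
proof -
  obtain G g where s: "s = (G, g)" by (cases s)
  define z where "z = sqrt \<delta> *\<^sub>R G"
  have "u_fun z \<le> u_fun (z + sqrt \<delta> *\<^sub>R e_set J)" using assms by (intro u_fun_mono) simp
  moreover have "\<bar>u_fun (z + sqrt \<delta> *\<^sub>R e_set J) - u_fun z\<bar> \<le> \<bar>sqrt \<delta>\<bar>" by (rule u_fun_lipschitz)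
  ultimately have u: "0 \<le> u_fun (z + sqrt \<delta> *\<^sub>R e_set J) - u_fun z" "u_fun (z + sqrt \<delta> *\<^sub>R e_set J) - u_fun z \<le> sqrt \<delta>"
    using assms by auto
  have "potential \<delta> (update s i J) - potential \<delta> s = (u_fun (z + sqrt \<delta> *\<^sub>R e_set J) - u_fun z) / sqrt \<delta> - of_bool (i \<in> J)"
    by (simp add: potential_def s z_def scaleR_add_right diff_divide_distrib)
  moreover have "0 \<le> (u_fun (z + sqrt \<delta> *\<^sub>R e_set J) - u_fun z) / sqrt \<delta>" "(u_fun (z + sqrt \<delta> *\<^sub>R e_set J) - u_fun z) / sqrt \<delta> \<le> 1"
    using u assms by (auto simp: divide_le_eq_1)
  ultimately show ?thesis by (auto simp: of_bool_def)
qed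

lemma Phi_scale: "0 \<le> c \<Longrightarrow> Phi (c *\<^sub>R x) = c * Phi x"
proof -
  assume c: "0 \<le> c"
  have "Max ((\<lambda>a. c * a) ` range (($) x)) = c * Max (range (($) x))"
    using c by (intro mono_Max_commute[symmetric]) (auto simp: mono_def mult_left_mono)
  then show ?thesis by (simp add: Phi_def image_image)
qed

lemma potential_regret_gap:
  assumes "0 < \<delta>"
  shows "u_fun (sqrt \<delta> *\<^sub>R fst s) - Phi (sqrt \<delta> *\<^sub>R fst s) = sqrt \<delta> * (potential \<delta> s - regret s)"
  using assms by (cases s) (simp add: potential_def Phi_scale field_simps)

text \<open>Averaging over the expert chosen by the player only costs the probability that this expert gains.\<close>

lemma average_potential:
  "(\<Sum>i\<in>UNIV. pmf a i * potential \<delta> (update s i J))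
    = u_fun (sqrt \<delta> *\<^sub>R fst s + sqrt \<delta> *\<^sub>R e_set J) / sqrt \<delta> - snd s - (\<Sum>i\<in>J. pmf a i)"
proof -
  have p: "(\<Sum>i\<in>(UNIV :: 4 set). pmf a i) = 1" by (simp add: sum_pmf_eq_1)
  obtain G g where s: "s = (G, g)" by (cases s)
  have "(\<Sum>i\<in>UNIV. pmf a i * potential \<delta> (update s i J))
     = (\<Sum>i\<in>UNIV. pmf a i * (u_fun (sqrt \<delta> *\<^sub>R G + sqrt \<delta> *\<^sub>R e_set J) / sqrt \<delta> - g) - of_bool (i \<in> J) * pmf a i)"
    by (simp add: s potential_def scaleR_add_right algebra_simps)
  also have "\<dots> = (\<Sum>i\<in>UNIV. pmf a i) * (u_fun (sqrt \<delta> *\<^sub>R G + sqrt \<delta> *\<^sub>R e_set J) / sqrt \<delta> - g) - (\<Sum>i\<in>J. pmf a i)"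
    by (simp only: sum_subtractf sum_distrib_right sum_of_bool[of _ J])
  finally show ?thesis by (simp add: p s)
qed

text \<open>If the player follows the gradient, the first order term of the potential is cancelled for
  every move of nature, and the second order term is at most \<open>\<delta>\<close> times the gap between potential and
  regret. The discount absorbs this gap.\<close>

lemma player_step:
  assumes d: "0 < \<delta>" "\<delta> < 1" and a: "\<And>i. pmf a i = u_grad i (sqrt \<delta> *\<^sub>R fst s)"
  shows "\<delta> * regret s + (1 - \<delta>) * one_step (potential \<delta>) s a b \<le> potential \<delta> s + 2 * \<delta>"
proof -
  define z where "z = sqrt \<delta> *\<^sub>R fst s"
  define p where "p = potential \<delta> s"
  define r where "r = regret s"
  have sq: "sqrt \<delta> > 0" "sqrt \<delta> * sqrt \<delta> = \<delta>" using d by auto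
  have gap: "u_fun z - Phi z = sqrt \<delta> * (p - r)" unfolding z_def p_def r_def by (rule potential_regret_gap[OF d(1)])
  then have pr: "0 \<le> p - r" using gap_bounds(1)[of z] sq by (simp add: zero_le_mult_iff)
  have J: "(\<Sum>i\<in>UNIV. pmf a i * potential \<delta> (update s i J)) \<le> p + \<delta> * (p - r) + 2 * \<delta>" for J
  proof -
    have "u_fun (z + sqrt \<delta> *\<^sub>R e_set J) \<le> u_fun z + sqrt \<delta> * (\<Sum>j\<in>J. u_grad j z) + \<delta> * (sqrt \<delta> * (p - r) + 2 * sqrt \<delta>)"
      using u_fun_upper_expansion[of "sqrt \<delta>" z J] d by (simp add: gap)
    then have "u_fun (z + sqrt \<delta> *\<^sub>R e_set J) / sqrt \<delta> \<le> (u_fun z + sqrt \<delta> * (\<Sum>j\<in>J. u_grad j z) + \<delta> * (sqrt \<delta> * (p - r) + 2 * sqrt \<delta>)) / sqrt \<delta>"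
      using sq by (intro divide_right_mono) auto
    also have "\<dots> = u_fun z / sqrt \<delta> + (\<Sum>j\<in>J. u_grad j z) + \<delta> * (p - r) + 2 * \<delta>"
      using sq(1) by (simp add: add_divide_distrib) (simp add: field_simps)
    also have "u_fun z / sqrt \<delta> = p + snd s" by (simp add: p_def potential_def z_def)
    finally show ?thesis unfolding average_potential unfolding a z_def[symmetric] by simp
  qed
  have "one_step (potential \<delta>) s a b \<le> (\<Sum>J\<in>UNIV. pmf b J * (p + \<delta> * (p - r) + 2 * \<delta>))"
    unfolding one_step_def by (intro sum_mono mult_left_mono J) simp
  also have "\<dots> = p + \<delta> * (p - r) + 2 * \<delta>"
    by (simp add: sum_pmf_eq_1 flip: sum_distrib_right)
  finally have "(1 - \<delta>) * one_step (potential \<delta>) s a b \<le> (1 - \<delta>) * (p + \<delta> * (p - r) + 2 * \<delta>)"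
    using d by (intro mult_left_mono) auto
  moreover have "\<delta> * r + (1 - \<delta>) * (p + \<delta> * (p - r) + 2 * \<delta>) = p + 2 * \<delta> - \<delta> * \<delta> * (p - r) - 2 * \<delta> * \<delta>"
    by (simp add: algebra_simps)
  moreover have "0 \<le> \<delta> * \<delta> * (p - r)" "0 \<le> 2 * \<delta> * \<delta>" using pr d by auto
  ultimately show ?thesis unfolding p_def[symmetric] r_def[symmetric] by linarith
qed

lemma sinh_le_twice:
  assumes "0 \<le> y" "y \<le> (1::real)" shows "sinh y \<le> 2 * y"
proof -
  have "exp y \<le> 1 + y + y\<^sup>2" using assms by (intro exp_bound)
  moreover have "1 + - y \<le> exp (- y)" by (rule exp_ge_add_one_self)
  moreover have "y\<^sup>2 \<le> y" using assms by (simp add: power2_eq_square mult_left_le_one_le)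
  ultimately show ?thesis using assms by (simp add: sinh_def)
qed

text \<open>Nature plays a comb or its complement with equal probability. Then the player gains one half
  on average whatever the player does, and since the complement acts like the negative of the comb up to a
  diagonal shift, the first order terms cancel. The second order term is bounded below because the
  comb attains the differential equation.\<close>

lemma nature_step:
  assumes d: "0 < \<delta>" "\<delta> \<le> 1 / 2" and J: "card J = 2" "interleaved J (sqrt \<delta> *\<^sub>R fst s) 0"
    and b: "b = pmf_of_set {J, - J}"
  shows "potential \<delta> s - 7 * \<delta> \<le> \<delta> * regret s + (1 - \<delta>) * one_step (potential \<delta>) s a b"
proof -
  define z where "z = sqrt \<delta> *\<^sub>R fst s"
  define p where "p = potential \<delta> s"
  define r where "r = regret s"
  define q where "q K = (\<Sum>i\<in>UNIV. pmf a i * potential \<delta> (update s i K))" for K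
  have sq: "sqrt \<delta> > 0" "sqrt \<delta> * sqrt \<delta> = \<delta>" using d by auto
  have gap: "u_fun z - Phi z = sqrt \<delta> * (p - r)" unfolding z_def p_def r_def by (rule potential_regret_gap[OF d(1)])
  then have pr: "0 \<le> p - r" using gap_bounds(1)[of z] sq by (simp add: zero_le_mult_iff)
  have pr1: "\<delta> * (p - r) \<le> 1"
  proof -
    have "\<delta> * (p - r) = sqrt \<delta> * (sqrt \<delta> * (p - r))" using sq(2) by (simp flip: mult.assoc)
    also have "\<dots> \<le> 1 * 1" using gap_bounds[of z] d unfolding gap by (intro mult_mono) auto
    finally show ?thesis by simp
  qed
  have ne: "J \<noteq> - J" by auto
  have "one_step (potential \<delta>) s a b = (\<Sum>K\<in>UNIV. pmf b K * q K)" by (simp add: one_step_def q_def)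
  also have "\<dots> = (\<Sum>K\<in>{J, - J}. pmf b K * q K)"
    by (rule sum.mono_neutral_right) (auto simp: b)
  also have "\<dots> = (q J + q (- J)) / 2" using ne by (simp add: b)
  finally have os: "one_step (potential \<delta>) s a b = (q J + q (- J)) / 2" .
  have aJ: "(\<Sum>i\<in>J. pmf a i) + (\<Sum>i\<in>- J. pmf a i) = 1"
    using sum.Int_Diff[of UNIV "pmf a" J] by (simp add: sum_pmf_eq_1 Compl_eq_Diff_UNIV)
  have shift: "u_fun (z + sqrt \<delta> *\<^sub>R e_set (- J)) = u_fun (z + (- sqrt \<delta>) *\<^sub>R e_set J) + sqrt \<delta>"
  proof -
    have "z + sqrt \<delta> *\<^sub>R e_set (- J) = (z + (- sqrt \<delta>) *\<^sub>R e_set J) + sqrt \<delta> *\<^sub>R e_set UNIV"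
      by (simp add: vec_eq_iff)
    then show ?thesis using u_fun_shift[of "z + (- sqrt \<delta>) *\<^sub>R e_set J" "sqrt \<delta>"] by (simp only:)
  qed
  define S where "S = sinh (sqrt 2 * sqrt \<delta>)"
  have S: "S \<le> 4 * sqrt \<delta>"
  proof -
    have "sqrt 2 * sqrt \<delta> \<le> 1" using d by (simp flip: real_sqrt_mult)
    then have "S \<le> 2 * (sqrt 2 * sqrt \<delta>)" unfolding S_def using d by (intro sinh_le_twice) auto
    also have "\<dots> \<le> 2 * (2 * sqrt \<delta>)" using sq by (intro mult_left_mono mult_right_mono) (auto intro: real_le_lsqrt)
    finally show ?thesis by simp
  qed
  note J' = J[folded z_def]
  have "u_fun z + sqrt \<delta> * (\<Sum>j\<in>J. u_grad j z) + \<delta> * (u_fun z - Phi z - 2 * sqrt \<delta> - S) \<le> u_fun (z + sqrt \<delta> *\<^sub>R e_set J)"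
    using u_fun_lower_expansion[OF J', of "sqrt \<delta>"] d by (simp add: S_def)
  moreover have "u_fun z - sqrt \<delta> * (\<Sum>j\<in>J. u_grad j z) + \<delta> * (u_fun z - Phi z - 2 * sqrt \<delta> - S) \<le> u_fun (z + (- sqrt \<delta>) *\<^sub>R e_set J)"
    using u_fun_lower_expansion[OF J', of "- sqrt \<delta>"] d by (simp add: S_def)
  moreover have "\<delta> * (u_fun z - Phi z - 6 * sqrt \<delta>) \<le> \<delta> * (u_fun z - Phi z - 2 * sqrt \<delta> - S)"
    using S d by (intro mult_left_mono) auto
  ultimately have two: "2 * (u_fun z + \<delta> * (u_fun z - Phi z - 6 * sqrt \<delta>)) \<le> u_fun (z + sqrt \<delta> *\<^sub>R e_set J) + u_fun (z + (- sqrt \<delta>) *\<^sub>R e_set J)"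
    unfolding mult_2 by linarith
  have "q J + q (- J) = (u_fun (z + sqrt \<delta> *\<^sub>R e_set J) + u_fun (z + (- sqrt \<delta>) *\<^sub>R e_set J)) / sqrt \<delta> - 2 * snd s"
  proof -
    have "q J + q (- J) = u_fun (z + sqrt \<delta> *\<^sub>R e_set J) / sqrt \<delta> + u_fun (z + sqrt \<delta> *\<^sub>R e_set (- J)) / sqrt \<delta> - 2 * snd s - 1"
      unfolding q_def average_potential z_def[symmetric] using aJ by linarith
    then show ?thesis unfolding shift using sq(1) by (simp add: add_divide_distrib)
  qed
  moreover have "2 * (u_fun z + \<delta> * (u_fun z - Phi z - 6 * sqrt \<delta>)) / sqrt \<delta> \<le> (u_fun (z + sqrt \<delta> *\<^sub>R e_set J) + u_fun (z + (- sqrt \<delta>) *\<^sub>R e_set J)) / sqrt \<delta>"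
    using two sq by (intro divide_right_mono) auto
  moreover have "2 * (u_fun z + \<delta> * (u_fun z - Phi z - 6 * sqrt \<delta>)) / sqrt \<delta> = 2 * (u_fun z / sqrt \<delta> + \<delta> * (p - r) - 6 * \<delta>)"
    unfolding gap using sq(1) by (simp add: field_simps)
  moreover have "p = u_fun z / sqrt \<delta> - snd s" by (simp add: p_def potential_def z_def)
  ultimately have "(p + \<delta> * (p - r) - 6 * \<delta>) + (p + \<delta> * (p - r) - 6 * \<delta>) \<le> q J + q (- J)"
    unfolding mult_2 by linarith
  then have "p + \<delta> * (p - r) - 6 * \<delta> \<le> one_step (potential \<delta>) s a b" unfolding os by simp
  then have "(1 - \<delta>) * (p + \<delta> * (p - r) - 6 * \<delta>) \<le> (1 - \<delta>) * one_step (potential \<delta>) s a b"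
    using d by (intro mult_left_mono) auto
  moreover have "\<delta> * r + (1 - \<delta>) * (p + \<delta> * (p - r) - 6 * \<delta>) = p - 6 * \<delta> - \<delta> * (\<delta> * (p - r)) + 6 * \<delta> * \<delta>"
    by (simp add: algebra_simps)
  moreover have "\<delta> * (\<delta> * (p - r)) \<le> \<delta> * 1" using pr1 d by (intro mult_left_mono) auto
  moreover have "0 \<le> 6 * \<delta> * \<delta>" using d by simp
  ultimately show ?thesis unfolding p_def[symmetric] r_def[symmetric] by linarith
qed

lemma exists_gradient_pmf: "\<exists>a. \<forall>i. pmf a i = u_grad i z"
proof -
  have "(\<integral>\<^sup>+ i. ennreal (u_grad i z) \<partial>count_space UNIV) = (\<Sum>i\<in>UNIV. ennreal (u_grad i z))"
    by (simp add: nn_integral_count_space_finite)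
  also have "\<dots> = ennreal (\<Sum>i\<in>UNIV. u_grad i z)" by (rule sum_ennreal) (rule u_grad_nonneg)
  finally have "(\<integral>\<^sup>+ i. ennreal (u_grad i z) \<partial>count_space UNIV) = 1" by (simp add: u_grad_sum)
  then show ?thesis using pmf_embed_pmf[of "\<lambda>i. u_grad i z"] u_grad_nonneg by blast
qed

lemma expectation_play_mono:
  fixes f g :: "gains list \<Rightarrow> real"
  assumes "\<And>h. f h \<le> g h"
  shows "measure_pmf.expectation (play \<alpha> \<beta> x t) f \<le> measure_pmf.expectation (play \<alpha> \<beta> x t) g"
  by (intro integral_mono integrable_measure_pmf_finite finite_play assms)

lemma mean_combination:
  "c * mean \<alpha> \<beta> x f t + c' * mean \<alpha> \<beta> x g (Suc t)
    = measure_pmf.expectation (play \<alpha> \<beta> x t) (\<lambda>h. c * f (last h) + c' * one_step g (last h) (\<alpha> h) (\<beta> h))"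
  unfolding mean_Suc unfolding mean_def
  by (subst Bochner_Integration.integral_add) (auto intro: integrable_measure_pmf_finite finite_play)

lemma mean_plus_const:
  "mean \<alpha> \<beta> x f t + c = measure_pmf.expectation (play \<alpha> \<beta> x t) (\<lambda>h. f (last h) + c)"
  unfolding mean_def
  by (subst Bochner_Integration.integral_add) (auto intro: integrable_measure_pmf_finite finite_play)

lemma player_guarantee:
  assumes d: "0 < \<delta>" "\<delta> < 1"
  shows "\<exists>\<alpha>. \<forall>\<beta>. expected_regret \<delta> \<alpha> \<beta> x \<le> potential \<delta> (x, 0) + 2"
proof -
  define \<alpha> :: player where "\<alpha> h = (SOME a. \<forall>i. pmf a i = u_grad i (sqrt \<delta> *\<^sub>R fst (last h)))" for h
  have \<alpha>: "pmf (\<alpha> h) i = u_grad i (sqrt \<delta> *\<^sub>R fst (last h))" for h i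
    unfolding \<alpha>_def using someI_ex[OF exists_gradient_pmf[of "sqrt \<delta> *\<^sub>R fst (last h)"]] by blast
  have "expected_regret \<delta> \<alpha> \<beta> x \<le> mean \<alpha> \<beta> x (potential \<delta>) 0 + 2 * \<delta> / \<delta>" for \<beta>
  proof (rule discounted_telescope[OF d _ mean_bounded[OF potential_drift[OF d(1)]] expected_regret_mean(1)[OF d]])
    fix t
    show "\<delta> * mean \<alpha> \<beta> x regret t + (1 - \<delta>) * mean \<alpha> \<beta> x (potential \<delta>) (Suc t) \<le> mean \<alpha> \<beta> x (potential \<delta>) t + 2 * \<delta>"
      unfolding mean_combination mean_plus_const
      by (rule expectation_play_mono) (rule player_step[OF d \<alpha>])
  qed
  then show ?thesis using d by (auto simp: mean_0)
qed

lemma nature_guarantee: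
  assumes d: "0 < \<delta>" "\<delta> \<le> 1 / 2"
  shows "\<exists>\<beta>. \<forall>\<alpha>. potential \<delta> (x, 0) - 7 \<le> expected_regret \<delta> \<alpha> \<beta> x"
proof -
  define J where "J h = (SOME J. card J = 2 \<and> interleaved J (sqrt \<delta> *\<^sub>R fst (last h)) 0)" for h :: "gains list"
  have J: "card (J h) = 2" "interleaved (J h) (sqrt \<delta> *\<^sub>R fst (last h)) 0" for h
    unfolding J_def using someI_ex[OF comb_exists[of "sqrt \<delta> *\<^sub>R fst (last h)"]] by auto
  \<comment> \<open>A fair coin between a comb at the current state and its complement.\<close>
  define \<beta> :: nature where "\<beta> h = pmf_of_set {J h, - J h}" for h
  have d1: "\<delta> < 1" using d by simp
  have "- expected_regret \<delta> \<alpha> \<beta> x \<le> - mean \<alpha> \<beta> x (potential \<delta>) 0 + 7 * \<delta> / \<delta>" for \<alpha>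
  proof (rule discounted_telescope[OF d(1) d1])
    fix t
    have "mean \<alpha> \<beta> x (potential \<delta>) t + - (7 * \<delta>) \<le> \<delta> * mean \<alpha> \<beta> x regret t + (1 - \<delta>) * mean \<alpha> \<beta> x (potential \<delta>) (Suc t)"
      unfolding mean_combination mean_plus_const
      by (rule expectation_play_mono) (use nature_step[OF d J \<beta>_def] in simp)
    then show "\<delta> * (- mean \<alpha> \<beta> x regret t) + (1 - \<delta>) * (- mean \<alpha> \<beta> x (potential \<delta>) (Suc t)) \<le> - mean \<alpha> \<beta> x (potential \<delta>) t + 7 * \<delta>"
      by simp
    show "\<bar>- mean \<alpha> \<beta> x (potential \<delta>) t\<bar> \<le> \<bar>potential \<delta> (x, 0)\<bar> + real t"
      using mean_bounded[OF potential_drift[OF d(1)]] by simp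
    show "(\<lambda>t. (1 - \<delta>) ^ t * \<delta> * - mean \<alpha> \<beta> x regret t) sums - expected_regret \<delta> \<alpha> \<beta> x"
      using sums_minus[OF expected_regret_mean(1)[OF d(1) d1]] by simp
  qed
  then have "potential \<delta> (x, 0) - 7 \<le> expected_regret \<delta> \<alpha> \<beta> x" for \<alpha>
    using d by (simp add: mean_0) (smt (verit))
  then show ?thesis by blast
qed

text \<open>The two strategies confine the value of the game to a window around the potential whose
  size does not depend on \<open>\<delta>\<close> or \<open>x\<close>. After multiplication by \<open>\<surd>\<delta>\<close> the window shrinks, which
  is stronger than locally uniform convergence.\<close>

lemma game_value_bounds:
  assumes d: "0 < \<delta>" "\<delta> \<le> 1 / 2"
  shows "\<bar>game_value \<delta> x - u_fun (sqrt \<delta> *\<^sub>R x) / sqrt \<delta>\<bar> \<le> 7"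
proof -
  have d1: "\<delta> < 1" using d by simp
  define p where "p = potential \<delta> (x, 0)"
  have p: "p = u_fun (sqrt \<delta> *\<^sub>R x) / sqrt \<delta>" by (simp add: p_def potential_def)
  obtain \<alpha>0 where \<alpha>0: "\<And>\<beta>. expected_regret \<delta> \<alpha>0 \<beta> x \<le> p + 2"
    using player_guarantee[OF d(1) d1] unfolding p_def by blast
  obtain \<beta>0 where \<beta>0: "\<And>\<alpha>. p - 7 \<le> expected_regret \<delta> \<alpha> \<beta>0 x"
    using nature_guarantee[OF d] unfolding p_def by blast
  have bdd: "bdd_below (range (\<lambda>\<alpha>. expected_regret \<delta> \<alpha> \<beta> x))" for \<beta>
  proof (rule bdd_belowI2)
    show "- (\<bar>Phi x\<bar> + (1 - \<delta>) / \<delta>) \<le> expected_regret \<delta> \<alpha> \<beta> x" for \<alpha>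
      using expected_regret_mean(2)[OF d(1) d1, of \<alpha> \<beta> x] by linarith
  qed
  have up: "(INF \<alpha>. expected_regret \<delta> \<alpha> \<beta> x) \<le> p + 2" for \<beta>
    by (rule order_trans[OF cINF_lower[OF bdd, of \<alpha>0] \<alpha>0]) simp
  have "game_value \<delta> x \<le> p + 2"
    unfolding game_value_def by (rule cSUP_least) (auto intro: up)
  moreover have "p - 7 \<le> (INF \<alpha>. expected_regret \<delta> \<alpha> \<beta>0 x)" by (rule cINF_greatest) (auto intro: \<beta>0)
  moreover have "(INF \<alpha>. expected_regret \<delta> \<alpha> \<beta>0 x) \<le> game_value \<delta> x"
    unfolding game_value_def by (rule cSUP_upper) (auto intro!: bdd_aboveI2[of _ _ "p + 2"] up)
  ultimately show ?thesis unfolding p[symmetric] by linarith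
qed

lemma scaled_value_bounds:
  assumes d: "0 < \<delta>" "\<delta> \<le> 1 / 2"
  shows "\<bar>scaled_value \<delta> x - u_fun x\<bar> \<le> 7 * sqrt \<delta>"
proof -
  have "sqrt \<delta> *\<^sub>R (x /\<^sub>R sqrt \<delta>) = x" using d by simp
  then have "\<bar>game_value \<delta> (x /\<^sub>R sqrt \<delta>) - u_fun x / sqrt \<delta>\<bar> \<le> 7"
    using game_value_bounds[OF d, of "x /\<^sub>R sqrt \<delta>"] by simp
  then have "sqrt \<delta> * \<bar>game_value \<delta> (x /\<^sub>R sqrt \<delta>) - u_fun x / sqrt \<delta>\<bar> \<le> sqrt \<delta> * 7"
    using d by (intro mult_left_mono) auto
  moreover have "sqrt \<delta> * \<bar>game_value \<delta> (x /\<^sub>R sqrt \<delta>) - u_fun x / sqrt \<delta>\<bar>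
      = \<bar>sqrt \<delta> * (game_value \<delta> (x /\<^sub>R sqrt \<delta>) - u_fun x / sqrt \<delta>)\<bar>"
    using d by (simp add: abs_mult)
  moreover have "sqrt \<delta> * (game_value \<delta> (x /\<^sub>R sqrt \<delta>) - u_fun x / sqrt \<delta>) = scaled_value \<delta> x - u_fun x"
    using d by (simp add: scaled_value_def right_diff_distrib)
  ultimately show ?thesis by simp
qed

lemma limit_value_eq: "limit_value = u_fun"
  unfolding limit_value_def
proof (rule the_equality)
  have small: "\<forall>\<^sub>F \<delta> in at_right (0::real). 0 < \<delta> \<and> \<delta> \<le> 1 / 2"
    unfolding eventually_at_right_field by (intro exI[of _ "1 / 2"]) auto
  show lim: "\<forall>K. compact K \<longrightarrow> uniform_limit K scaled_value u_fun (at_right 0)"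
  proof (intro allI impI uniform_limitI)
    fix K :: "(real^4) set" and e :: real assume e: "0 < e"
    have "((\<lambda>\<delta>. 7 * sqrt \<delta>) \<longlongrightarrow> 7 * sqrt 0) (at_right 0)" by (intro tendsto_intros)
    then have "\<forall>\<^sub>F \<delta> in at_right 0. 7 * sqrt \<delta> < e" using e by (intro order_tendstoD(2)) auto
    with small show "\<forall>\<^sub>F \<delta> in at_right 0. \<forall>x\<in>K. dist (scaled_value \<delta> x) (u_fun x) < e"
    proof eventually_elim
      case (elim \<delta>)
      then show ?case using scaled_value_bounds[of \<delta>] by (auto simp: dist_real_def intro: le_less_trans)
    qed
  qed
  fix v assume v: "\<forall>K. compact K \<longrightarrow> uniform_limit K scaled_value v (at_right 0)"
  show "v = u_fun"
  proof
    fix x :: "real^4"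
    have "((\<lambda>\<delta>. scaled_value \<delta> x) \<longlongrightarrow> v x) (at_right 0)"
      by (rule tendsto_uniform_limitI[OF v[rule_format, OF compact_sing]]) (rule singletonI)
    moreover have "((\<lambda>\<delta>. scaled_value \<delta> x) \<longlongrightarrow> u_fun x) (at_right 0)"
      by (rule tendsto_uniform_limitI[OF lim[rule_format, OF compact_sing]]) (rule singletonI)
    ultimately show "v x = u_fun x" by (rule tendsto_unique[OF trivial_limit_at_right_real])
  qed
qed

section \<open>Regularity, expansion at the origin and the closed formula\<close>

lemma frechet_u_fun: "frechet_derivative u_fun (at x) = (\<lambda>h. \<Sum>j\<in>UNIV. u_grad j x * h $ j)"
  by (rule frechet_derivative_at[OF u_fun_derivative, symmetric])

lemma grad_u_fun: "grad u_fun x = (\<chi> i. u_grad i x)"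
  by (simp add: grad_def frechet_u_fun vec_eq_iff axis_def if_distrib cong: if_cong)

lemma grad_u_fun_derivative:
  "(grad u_fun has_derivative (\<lambda>h. \<chi> i. \<Sum>j\<in>UNIV. u_hess i j x * h $ j)) (at x)"
proof -
  have "((\<lambda>x. \<Sum>i\<in>UNIV. u_grad i x *\<^sub>R axis i 1) has_derivative (\<lambda>h. \<Sum>i\<in>UNIV. (\<Sum>j\<in>UNIV. u_hess i j x * h $ j) *\<^sub>R (axis i 1 :: real^4))) (at x)"
    by (intro has_derivative_sum has_derivative_scaleR_left u_grad_derivative)
  moreover have "(\<Sum>i\<in>UNIV. c i *\<^sub>R (axis i 1 :: real^4)) = (\<chi> i. c i)" for c
    by (simp add: vec_eq_iff axis_def if_distrib cong: if_cong)
  ultimately show ?thesis by (simp add: grad_u_fun[abs_def])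
qed

lemma hessian_u_fun: "hessian u_fun x = (\<chi> i j. u_hess i j x)"
  unfolding hessian_def jacobian_def frechet_derivative_at[OF grad_u_fun_derivative, symmetric]
  by (simp add: matrix_def vec_eq_iff axis_def if_distrib cong: if_cong)

lemma u_fun_twice_continuously_differentiable: "twice_continuously_differentiable u_fun"
  unfolding twice_continuously_differentiable_def
proof (intro conjI allI)
  show "u_fun differentiable (at x)" for x using u_fun_derivative differentiableI by blast
  show "grad u_fun differentiable (at x)" for x using grad_u_fun_derivative differentiableI by blast
  show "continuous_on UNIV (hessian u_fun)"
    unfolding hessian_u_fun[abs_def] by (intro continuous_on_vec_lambda u_hess_continuous)
qed

lemma quad_hessian: "e_set K \<bullet> (hessian u_fun x *v e_set K) = quad K x"
  unfolding hessian_u_fun quad_def inner_vec_def matrix_vector_mult_def by simp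

lemma u_fun_at_0: "u_fun 0 = pi / (4 * sqrt 2)" "u_grad j 0 = 1 / 4"
  "u_hess i j 0 = (if i = j then 3 * pi / (8 * sqrt 2) else - pi / (8 * sqrt 2))"
proof -
  have o: "ordered 0" by (simp add: ordered_def)
  have z: "permute id 0 = 0" by (simp add: vec_eq_iff)
  have g: "spread 0 = 0" "gap_low 0 = 0" "gap_high 0 = 0" by (auto simp: spread_def gap_low_def gap_high_def)
  have s: "sqrt 2 * k / 8 = k / (4 * sqrt 2)" for k :: real by (simp add: field_simps)
  show "u_fun 0 = pi / (4 * sqrt 2)"
  proof -
    have "u_fun 0 = sqrt 2 * pi / 8" using u_fun_eq[OF bij_id, of 0] by (simp add: z o U_chamber_def g kap_0)
    then show ?thesis by (simp only: s)
  qed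
  show "u_grad j 0 = 1 / 4"
    using u_grad_eq[OF bij_id, of 0 j] exhaust_4[of j]
    by (auto simp: z o grad_chamber_def slope_spread_def slope_high_def slope_low_def g kap_0)
  show "u_hess i j 0 = (if i = j then 3 * pi / (8 * sqrt 2) else - pi / (8 * sqrt 2))"
  proof -
    have sp: "single_curv k 0 = 3 * pi / 2" "pair_curv k l 0 = 2 * pi" for k l
      by (simp_all add: single_curv_def pair_curv_def curv_high_def curv_low_def twist_high_def twist_low_def pair_defect_def g kap_0)
    have "u_hess i j 0 = hess_chamber i j 0" using u_hess_eq[OF bij_id, of 0 i j] by (simp add: z o)
    moreover have "sqrt 2 / 8 = 1 / (4 * sqrt 2)" by (simp add: field_simps)
    ultimately show ?thesis by (simp add: hess_chamber_def hess_scaled_def sp)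
  qed
qed

text \<open>Along the segment from the origin to \<open>x\<close>, the derivative of the remainder is the first order
  remainder of the gradient paired with \<open>x\<close>, hence \<open>o(|x|\<^sup>2)\<close>.\<close>

lemma second_order_expansion:
  fixes f :: "real^4 \<Rightarrow> real"
  assumes f: "\<And>x. (f has_derivative (\<lambda>h. \<Sum>j\<in>UNIV. g j x * h $ j)) (at x)"
    and g: "\<And>i. (g i has_derivative (\<lambda>h. \<Sum>j\<in>UNIV. H i j * h $ j)) (at 0)"
  shows "(\<lambda>x. f x - (f 0 + (\<Sum>j\<in>UNIV. g j 0 * x $ j) + (\<Sum>i\<in>UNIV. \<Sum>j\<in>UNIV. H i j * x $ i * x $ j) / 2))
    \<in> o[at 0](\<lambda>x. (norm x)\<^sup>2)"
proof (rule landau_o.smallI)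
  fix e :: real assume e: "0 < e"
  define r where "r i x = g i x - g i 0 - (\<Sum>j\<in>UNIV. H i j * x $ j)" for i x
  define P where "P x = (\<Sum>j\<in>UNIV. g j 0 * x $ j) + (\<Sum>i\<in>UNIV. \<Sum>j\<in>UNIV. H i j * x $ i * x $ j) / 2" for x
  have "\<exists>d>0. \<forall>x. norm x < d \<longrightarrow> \<bar>r i x\<bar> \<le> e / 4 * norm x" for i
    using g[of i] e unfolding has_derivative_within_alt r_def
    by (auto dest!: spec[of _ "e / 4"])
  then obtain d where d: "\<And>i. d i > 0" "\<And>i x. norm x < d i \<Longrightarrow> \<bar>r i x\<bar> \<le> e / 4 * norm x" by metis
  define R where "R = Min (range d)"
  have R: "R > 0" "\<And>i. R \<le> d i" using d(1) by (auto simp: R_def)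
  have main: "\<bar>f x - (f 0 + P x)\<bar> \<le> e * (norm x)\<^sup>2" if x: "norm x < R" for x
  proof -
    define \<phi> where "\<phi> t = f (0 + t *\<^sub>R x) - P (t *\<^sub>R x)" for t
    have P: "P (t *\<^sub>R x) = t * (\<Sum>j\<in>UNIV. g j 0 * x $ j) + t\<^sup>2 * ((\<Sum>i\<in>UNIV. \<Sum>j\<in>UNIV. H i j * x $ i * x $ j) / 2)" for t
      by (simp add: P_def sum_distrib_left sum_distrib_right power2_eq_square mult_ac sum_divide_distrib)
    have D: "(\<phi> has_real_derivative (\<Sum>j\<in>UNIV. r j (t *\<^sub>R x) * x $ j)) (at t)" for t
    proof -
      have "(\<phi> has_real_derivative (\<Sum>j\<in>UNIV. g j (0 + t *\<^sub>R x) * x $ j)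
         - ((\<Sum>j\<in>UNIV. g j 0 * x $ j) + 2 * t * ((\<Sum>i\<in>UNIV. \<Sum>j\<in>UNIV. H i j * x $ i * x $ j) / 2))) (at t)"
        unfolding \<phi>_def[abs_def] P
        by (intro DERIV_diff derivative_along_line[OF f]) (auto intro!: derivative_eq_intros)
      also have "(\<Sum>j\<in>UNIV. g j (0 + t *\<^sub>R x) * x $ j)
         - ((\<Sum>j\<in>UNIV. g j 0 * x $ j) + 2 * t * ((\<Sum>i\<in>UNIV. \<Sum>j\<in>UNIV. H i j * x $ i * x $ j) / 2))
         = (\<Sum>j\<in>UNIV. r j (t *\<^sub>R x) * x $ j)"
      proof -
        have "(\<Sum>j\<in>UNIV. (\<Sum>n\<in>UNIV. H j n * (t * x $ n)) * x $ j) = t * (\<Sum>i\<in>UNIV. \<Sum>j\<in>UNIV. H i j * x $ i * x $ j)"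
          by (simp add: sum_distrib_left sum_distrib_right mult_ac)
        then show ?thesis by (simp add: r_def left_diff_distrib sum_subtractf)
      qed
      finally show ?thesis .
    qed
    have "\<bar>\<phi> 1 - \<phi> 0\<bar> \<le> e * (norm x)\<^sup>2 * \<bar>1 - 0\<bar>"
    proof (rule field_differentiable_bound[of "{0..1}" \<phi> _ "e * (norm x)\<^sup>2" 1 0, unfolded real_norm_def])
      show "(\<phi> has_real_derivative (\<Sum>j\<in>UNIV. r j (t *\<^sub>R x) * x $ j)) (at t within {0..1})" for t
        by (rule has_field_derivative_at_within[OF D])
      fix t :: real assume t: "t \<in> {0..1}"
      have nt: "norm (t *\<^sub>R x) \<le> norm x" using t by (simp add: mult_left_le_one_le)
      have "\<bar>\<Sum>j\<in>UNIV. r j (t *\<^sub>R x) * x $ j\<bar> \<le> (\<Sum>j\<in>(UNIV :: 4 set). e / 4 * norm x * norm x)"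
      proof (rule order_trans[OF sum_abs sum_mono])
        fix j :: 4
        have "\<bar>r j (t *\<^sub>R x)\<bar> \<le> e / 4 * norm (t *\<^sub>R x)"
          using nt x R(2)[of j] by (intro d(2)) linarith
        also have "\<dots> \<le> e / 4 * norm x" using nt e by (intro mult_left_mono) auto
        finally show "\<bar>r j (t *\<^sub>R x) * x $ j\<bar> \<le> e / 4 * norm x * norm x"
          unfolding abs_mult using component_le_norm_cart[of x j] e by (intro mult_mono) auto
      qed
      also have "\<dots> = e * (norm x)\<^sup>2" by (simp add: power2_eq_square)
      finally show "\<bar>\<Sum>j\<in>UNIV. r j (t *\<^sub>R x) * x $ j\<bar> \<le> e * (norm x)\<^sup>2" .
    qed auto
    moreover have "\<phi> 1 - \<phi> 0 = f x - (f 0 + P x)" by (simp add: \<phi>_def P_def)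
    ultimately show ?thesis by simp
  qed
  have "\<forall>\<^sub>F x in at 0. norm x < R" using R(1) unfolding eventually_at by (intro exI[of _ R]) auto
  then show "\<forall>\<^sub>F x in at 0. norm (f x - (f 0 + (\<Sum>j\<in>UNIV. g j 0 * x $ j) + (\<Sum>i\<in>UNIV. \<Sum>j\<in>UNIV. H i j * x $ i * x $ j) / 2)) \<le> e * norm ((norm x)\<^sup>2)"
    by eventually_elim (use main in \<open>simp add: P_def add.assoc\<close>)
qed

lemma u_fun_expansion:
  "(\<lambda>x. u_fun x - (pi / (4 * sqrt 2) + 1 / 4 * (x $ 1 + x $ 2 + x $ 3 + x $ 4)
       + 3 * pi / (16 * sqrt 2)
         * ((x $ 1)\<^sup>2 + (x $ 2)\<^sup>2 + (x $ 3)\<^sup>2 + (x $ 4)\<^sup>2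
            - 2 / 3 * (x $ 1 * x $ 2 + x $ 1 * x $ 3 + x $ 1 * x $ 4
                       + x $ 2 * x $ 3 + x $ 2 * x $ 4 + x $ 3 * x $ 4))))
     \<in> o[at 0](\<lambda>x. (norm x)\<^sup>2)"
proof -
  define w where "w = pi / (16 * sqrt 2)"
  have w: "pi / (4 * sqrt 2) = 4 * w" "3 * pi / (16 * sqrt 2) = 3 * w" "3 * pi / (8 * sqrt 2) = 6 * w" "- pi / (8 * sqrt 2) = - 2 * w"
    by (simp_all add: w_def)
  have e: "pi / (4 * sqrt 2) + 1 / 4 * (x $ 1 + x $ 2 + x $ 3 + x $ 4)
       + 3 * pi / (16 * sqrt 2)
         * ((x $ 1)\<^sup>2 + (x $ 2)\<^sup>2 + (x $ 3)\<^sup>2 + (x $ 4)\<^sup>2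
            - 2 / 3 * (x $ 1 * x $ 2 + x $ 1 * x $ 3 + x $ 1 * x $ 4
                       + x $ 2 * x $ 3 + x $ 2 * x $ 4 + x $ 3 * x $ 4))
     = u_fun 0 + (\<Sum>j\<in>UNIV. u_grad j 0 * x $ j) + (\<Sum>i\<in>UNIV. \<Sum>j\<in>UNIV. u_hess i j 0 * x $ i * x $ j) / 2"
    for x :: "real^4"
    unfolding u_fun_at_0 sum_4 w by (simp add: field_simps power2_eq_square)
  show ?thesis unfolding e by (rule second_order_expansion[OF u_fun_derivative u_grad_derivative])
qed

text \<open>Product-to-sum formulas for the first two hyperbolic factors produce the gaps \<open>m\<close> and \<open>n\<close>.\<close>

lemma u_fun_formula:
  fixes x :: "real^4"
  defines "x1 \<equiv> ranked x 1" and "x2 \<equiv> ranked x 2" and "x3 \<equiv> ranked x 3" and "x4 \<equiv> ranked x 4"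
  defines "E \<equiv> exp ((x1 + x2 - x3 - x4) / sqrt 2)"
  shows "u_fun x =
        x4 - sqrt 2 / 4 * sinh (sqrt 2 * (x4 - x3))
        + sqrt 2 / 2 * arctan E
            * cosh ((x1 - x2 + x3 - x4) / sqrt 2)
            * cosh ((- x1 + x2 + x3 - x4) / sqrt 2)
            * cosh ((- x1 - x2 + x3 + x4) / sqrt 2)
        + (if \<forall>i j. x $ i = x $ j then 0
           else sqrt 2 / 2 * artanh E
            * sinh ((x1 - x2 + x3 - x4) / sqrt 2)
            * sinh ((- x1 + x2 + x3 - x4) / sqrt 2)
            * sinh ((- x1 - x2 + x3 + x4) / sqrt 2))"
proof -
  define \<pi> where "\<pi> = sorter x"
  define y where "y = permute \<pi> x"
  have \<pi>: "bij \<pi>" "ordered y" using sorter by (auto simp: \<pi>_def y_def)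
  have r: "x1 = y $ 1" "x2 = y $ 2" "x3 = y $ 3" "x4 = y $ 4"
    using ranked_ordered[OF \<pi>(2)] ranked_permute[OF \<pi>(1), of x]
    by (simp_all add: x1_def x2_def x3_def x4_def y_def)
  define c m n where "c = spread y" and "m = gap_low y" and "n = gap_high y"
  have h: "z / sqrt 2 = sqrt 2 / 2 * z" for z :: real by (simp add: field_simps)
  have E: "E = exp (- c)" and cc: "(- x1 - x2 + x3 + x4) / sqrt 2 = c"
    unfolding E_def h r c_def spread_def by (simp_all add: algebra_simps)
  have a: "(x1 - x2 + x3 - x4) / sqrt 2 = - ((n + m) / 2)" "(- x1 + x2 + x3 - x4) / sqrt 2 = - ((n - m) / 2)"
    unfolding h r m_def n_def gap_low_def gap_high_def by (simp_all add: field_simps)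
  have n: "sqrt 2 * (x4 - x3) = n" by (simp add: r n_def gap_high_def)
  have pr: "cosh ((n + m) / 2) * cosh ((n - m) / 2) = (cosh n + cosh m) / 2"
    "sinh ((n + m) / 2) * sinh ((n - m) / 2) = (cosh n - cosh m) / 2"
  proof -
    have "cosh n = cosh ((n + m) / 2 + (n - m) / 2)" "cosh m = cosh ((n + m) / 2 - (n - m) / 2)"
      by (simp_all add: field_simps)
    then show "cosh ((n + m) / 2) * cosh ((n - m) / 2) = (cosh n + cosh m) / 2"
      "sinh ((n + m) / 2) * sinh ((n - m) / 2) = (cosh n - cosh m) / 2"
      by (simp_all only: cosh_add cosh_diff) simp_all
  qed
  have u: "u_fun x = x4 - sqrt 2 / 4 * sinh n + sqrt 2 / 2 * arctan_exp c * ((cosh n + cosh m) / 2) * cosh c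
      + sqrt 2 / 2 * artanh_exp c * ((cosh n - cosh m) / 2) * sinh c"
    using u_fun_eq[OF \<pi>(1), of x] \<pi>(2)
    by (simp add: y_def[symmetric] U_chamber_def r(4) c_def[symmetric] m_def[symmetric] n_def[symmetric] kap_def nu_def field_simps)
  have z: "c = 0" if "\<forall>i j. x $ i = x $ j"
  proof -
    have "x $ \<pi> k = x $ 1" for k using that by blast
    then show ?thesis by (simp add: c_def spread_def y_def)
  qed
  have p: "sqrt 2 / 2 * arctan_exp c * cosh (- ((n + m) / 2)) * cosh (- ((n - m) / 2)) * cosh c
    = sqrt 2 / 2 * arctan_exp c * ((cosh n + cosh m) / 2) * cosh c"
    unfolding pr(1)[symmetric] by simp
  have q: "sqrt 2 / 2 * artanh_exp c * sinh (- ((n + m) / 2)) * sinh (- ((n - m) / 2)) * sinh c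
    = sqrt 2 / 2 * artanh_exp c * ((cosh n - cosh m) / 2) * sinh c"
    unfolding pr(2)[symmetric] by simp
  show ?thesis
  proof (cases "\<forall>i j. x $ i = x $ j")
    case True
    then show ?thesis unfolding n E cc a arctan_exp_def[symmetric] p u using z by simp
  next
    case False
    show ?thesis unfolding if_not_P[OF False] n E cc a arctan_exp_def[symmetric] artanh_exp_def[symmetric] p q u by simp
  qed
qed

lemma game_value_asymptotics:
  "(\<lambda>\<delta>. game_value \<delta> 0 - pi / (4 * sqrt (2 * \<delta>))) \<in> o[at_right 0](\<lambda>\<delta>. 1 / sqrt \<delta>)"
proof (rule landau_o.smallI)
  fix e :: real assume e: "0 < e"
  have small: "\<forall>\<^sub>F \<delta> in at_right (0::real). 0 < \<delta> \<and> \<delta> \<le> 1 / 2"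
    unfolding eventually_at_right_field by (intro exI[of _ "1 / 2"]) auto
  have "((\<lambda>\<delta>. 7 * sqrt \<delta>) \<longlongrightarrow> 7 * sqrt 0) (at_right 0)" by (intro tendsto_intros)
  then have "\<forall>\<^sub>F \<delta> in at_right 0. 7 * sqrt \<delta> < e" using e by (intro order_tendstoD(2)) auto
  with small show "\<forall>\<^sub>F \<delta> in at_right 0. norm (game_value \<delta> 0 - pi / (4 * sqrt (2 * \<delta>))) \<le> e * norm (1 / sqrt \<delta>)"
  proof eventually_elim
    case (elim \<delta>)
    have "\<bar>game_value \<delta> 0 - pi / (4 * sqrt (2 * \<delta>))\<bar> \<le> 7"
      using game_value_bounds[of \<delta> 0] elim(1) by (simp add: u_fun_at_0 real_sqrt_mult)
    also have "7 \<le> e / sqrt \<delta>" using elim by (simp add: field_simps)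
    finally show ?case using elim(1) by simp
  qed
qed

theorem theorem3p1:
  "(\<forall>x. let x1 = ranked x 1; x2 = ranked x 2; x3 = ranked x 3; x4 = ranked x 4;
          E = exp ((x1 + x2 - x3 - x4) / sqrt 2) in
      limit_value x =
        x4 - sqrt 2 / 4 * sinh (sqrt 2 * (x4 - x3))
        + sqrt 2 / 2 * arctan E
            * cosh ((x1 - x2 + x3 - x4) / sqrt 2)
            * cosh ((- x1 + x2 + x3 - x4) / sqrt 2)
            * cosh ((- x1 - x2 + x3 + x4) / sqrt 2)
        + (if \<forall>i j. x $ i = x $ j then 0
           else sqrt 2 / 2 * artanh E
            * sinh ((x1 - x2 + x3 - x4) / sqrt 2)
            * sinh ((- x1 + x2 + x3 - x4) / sqrt 2)
            * sinh ((- x1 - x2 + x3 + x4) / sqrt 2)))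
   \<and> twice_continuously_differentiable limit_value
   \<and> (\<forall>x y. (\<forall>i. 0 \<le> y $ i) \<longrightarrow> limit_value x \<le> limit_value (x + y))
   \<and> (\<forall>p x. bij p \<longrightarrow> limit_value (\<chi> i. x $ p i) = limit_value x)
   \<and> (\<forall>x (c :: real). limit_value (x + c *\<^sub>R e_set UNIV) = limit_value x + c)
   \<and> (\<forall>x J. maximizer limit_value x J \<longrightarrow> maximizer limit_value x (- J))
   \<and> (\<lambda>\<delta>. game_value \<delta> 0 - pi / (4 * sqrt (2 * \<delta>))) \<in> o[at_right 0](\<lambda>\<delta>. 1 / sqrt \<delta>)
   \<and> (\<lambda>x. limit_value x
        - (pi / (4 * sqrt 2)
           + 1 / 4 * (x $ 1 + x $ 2 + x $ 3 + x $ 4)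
           + 3 * pi / (16 * sqrt 2)
             * ((x $ 1)\<^sup>2 + (x $ 2)\<^sup>2 + (x $ 3)\<^sup>2 + (x $ 4)\<^sup>2
                - 2 / 3 * (x $ 1 * x $ 2 + x $ 1 * x $ 3 + x $ 1 * x $ 4
                           + x $ 2 * x $ 3 + x $ 2 * x $ 4 + x $ 3 * x $ 4))))
       \<in> o[at 0](\<lambda>x. (norm x)\<^sup>2)"
  unfolding limit_value_eq
proof (intro conjI allI impI)
  show "let x1 = ranked x 1; x2 = ranked x 2; x3 = ranked x 3; x4 = ranked x 4;
          E = exp ((x1 + x2 - x3 - x4) / sqrt 2) in
      u_fun x =
        x4 - sqrt 2 / 4 * sinh (sqrt 2 * (x4 - x3))
        + sqrt 2 / 2 * arctan E
            * cosh ((x1 - x2 + x3 - x4) / sqrt 2)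
            * cosh ((- x1 + x2 + x3 - x4) / sqrt 2)
            * cosh ((- x1 - x2 + x3 + x4) / sqrt 2)
        + (if \<forall>i j. x $ i = x $ j then 0
           else sqrt 2 / 2 * artanh E
            * sinh ((x1 - x2 + x3 - x4) / sqrt 2)
            * sinh ((- x1 + x2 + x3 - x4) / sqrt 2)
            * sinh ((- x1 - x2 + x3 + x4) / sqrt 2))" for x
    unfolding Let_def by (rule u_fun_formula)
  show "u_fun x \<le> u_fun (x + y)" if "\<forall>i. 0 \<le> y $ i" for x y using that by (intro u_fun_mono) blast
  show "u_fun (\<chi> i. x $ p i) = u_fun x" if "bij p" for p x using u_fun_permute[OF that, of x] by (simp add: permute_def)
  show "maximizer u_fun x (- J)" if "maximizer u_fun x J" for x J
    using that unfolding maximizer_def quad_hessian is_arg_max_def by (simp add: quad_complement)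
qed (rule u_fun_twice_continuously_differentiable u_fun_shift game_value_asymptotics u_fun_expansion)+

end
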